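(* Let $D\ge 1$, $J_0>0$, $\alpha>D+1$, $\eta>0$. There exist constants $0<C,C_0<\infty$ (independent of the number of sites $N$, of $n$, $T$, $R$, $q$ and of the initial state) such that the following holds. Let $\Lambda$ be a finite $D$-dimensional lattice with $N$ sites and metric $d(\cdot,\cdot)$; let $n\ge1$ be an integer and $T>0$; let $$H(t)=\sum_{i,j\in\Lambda}h_{ij}(t)\,c_i^\dagger c_j,\qquad t\in[0,T],$$ where $h(t)$ is Hermitian for every $t$, $|h_{ij}(t)|\le J_0\,d(i,j)^{-\alpha}$ for all $i\neq j$ and $t\in[0,T]$, and the $c_i$ are either fermionic operators ($\{c_i,c_j^\dagger\}=\delta_{ij}$) or bosonic operators ($[c_i,c_j^\dagger]=\delta_{ij}$). Let $q\in\Lambda$, $O=c_q^\dagger c_q$, and let $|\psi_0\rangle\in\mathcal H_{\le n}$ be a normalized initial state. Then for all $R>0$ satisfying $$T<\frac{C_0}{n}\,R^{\min(1,(\alpha-D-\eta)/3)},$$ one has $$\big|J_H(O)-J_{H_R}(O)\big|\le C n^2\left(\frac{T^2}{R^{\alpha-D}}+\frac45\,\frac{T^{5/2}}{R^{(\alpha-D-\eta)/2}}\right).$$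
   Context: Notation. $\mathcal H_m$ is the $m$-particle sector of the Fock space over $\Lambda$, and $\mathcal H_{\le n}=\bigoplus_{m=0}^n\mathcal H_m$. $U(t)=\mathcal T\exp(-i\int_0^tH(s)\,ds)$ is the time-ordered propagator of $H$. With $X_R=\{i\in\Lambda: d(i,q)\le R\}$, the truncated Hamiltonian is $H_R(t)=\sum_{i,j\in X_R}h_{ij}(t)c_i^\dagger c_j$ (all terms with $i\notin X_R$ or $j\notin X_R$ are dropped), with propagator $U_R(t)$. The dense outputs are $$J_H(O)=\int_0^T\langle\psi_0|U(t)^\dagger O\,U(t)|\psi_0\rangle\,dt,\qquad J_{H_R}(O)=\int_0^T\langle\psi_0|U_R(t)^\dagger O\,U_R(t)|\psi_0\rangle\,dt.$$ *)

theory Defs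
  imports "HOL-Analysis.Analysis"
begin

section \<open>Finite lattices\<close>

text \<open>
  Sites are labelled by natural numbers, so that one fixed type hosts lattices of every size and
  constants that do not depend on the lattice can be quantified outside.  The metric \<open>d\<close> is
  arbitrary except that the geometry is \<open>D\<close>-dimensional: a ball of radius \<open>r\<close> contains at
  most \<open>\<kappa> r^D\<close> sites besides its centre.  Since this is required for every \<open>r > 0\<close>, it also
  gives a minimal lattice spacing, namely \<open>\<kappa>\<close> to the power \<open>-1/D\<close>.  The parameter \<open>\<kappa>\<close>
  records the kind of lattice (hypercubic, triangular, periodic, ...), not its size; for finite
  subsets of the integer lattice see \<open>integer_lattice\<close> below.
\<close>

definition finite_lattice :: "nat \<Rightarrow> real \<Rightarrow> nat set \<Rightarrow> (nat \<Rightarrow> nat \<Rightarrow> real) \<Rightarrow> bool" where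
  "finite_lattice D \<kappa> \<Lambda> d \<longleftrightarrow> finite \<Lambda> \<and> Metric_space \<Lambda> d \<and>
     (\<forall>i\<in>\<Lambda>. \<forall>r>0. real (card {j \<in> \<Lambda>. j \<noteq> i \<and> d i j \<le> r}) \<le> \<kappa> * r ^ D)"

lemma integer_lattice:
  fixes e :: "nat \<Rightarrow> int ^ 'D" and \<Lambda> :: "nat set"
  assumes "finite \<Lambda>" and inj: "inj_on e \<Lambda>"
  defines "x \<equiv> \<lambda>i. (\<chi> k. real_of_int (e i $ k)) :: real ^ 'D"
  shows "finite_lattice CARD('D) (3 ^ CARD('D)) \<Lambda> (\<lambda>i j. dist (x i) (x j))"
  unfolding finite_lattice_def
proof (intro conjI ballI allI impI)
  have x_inj: "i = j" if "i \<in> \<Lambda>" "j \<in> \<Lambda>" "x i = x j" for i j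
  proof -
    have "e i $ k = e j $ k" for k
      using arg_cong[OF that(3), of "\<lambda>v. v $ k"] by (simp add: x_def)
    then show ?thesis
      using inj that by (simp add: inj_on_def vec_eq_iff)
  qed
  show "Metric_space \<Lambda> (\<lambda>i j. dist (x i) (x j))"
    by unfold_locales (auto simp: dist_commute dist_triangle dest: x_inj)
  fix i and r :: real
  assume i: "i \<in> \<Lambda>" and r: "r > 0"
  let ?S = "{j \<in> \<Lambda>. j \<noteq> i \<and> dist (x i) (x j) \<le> r}"
  have coord: "real_of_int \<bar>e j $ k - e i $ k\<bar> \<le> dist (x i) (x j)" for j k
  proof -
    have "\<bar>(x i - x j) $ k\<bar> \<le> norm (x i - x j)"
      by (rule component_le_norm_cart)
    then show ?thesis
      by (simp add: x_def dist_norm abs_minus_commute)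
  qed
  show "real (card ?S) \<le> 3 ^ CARD('D) * r ^ CARD('D)"
  proof (cases "r < 1")
    case True
    have "?S = {}"
    proof (rule ccontr)
      assume "?S \<noteq> {}"
      then obtain j where j: "j \<in> \<Lambda>" "j \<noteq> i" "dist (x i) (x j) \<le> r" by auto
      then obtain k where "e j $ k \<noteq> e i $ k"
        using inj i by (auto simp: inj_on_def vec_eq_iff)
      then have "real_of_int \<bar>e j $ k - e i $ k\<bar> \<ge> 1" by linarith
      with coord[of j k] j(3) True show False by linarith
    qed
    then show ?thesis using r by (simp only: card.empty) simp
  next
    case False
    define m where "m = \<lfloor>r\<rfloor>"
    have m: "m \<ge> 1" using False by (simp add: m_def le_floor_iff)
    let ?f = "\<lambda>j k. e j $ k - e i $ k"
    have "?f ` ?S \<subseteq> PiE UNIV (\<lambda>_. {-m..m})"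
    proof (clarsimp simp: PiE_def Pi_def)
      fix j k assume "dist (x i) (x j) \<le> r"
      with coord[of j k] have "real_of_int \<bar>e j $ k - e i $ k\<bar> \<le> r" by linarith
      then have "\<bar>e j $ k - e i $ k\<bar> \<le> m" by (simp add: m_def le_floor_iff)
      then show "- m \<le> e j $ k - e i $ k \<and> e j $ k - e i $ k \<le> m" by linarith
    qed
    moreover have "inj_on ?f ?S"
    proof (rule inj_onI)
      fix j j' assume *: "j \<in> ?S" "j' \<in> ?S" "?f j = ?f j'"
      have "e j $ k = e j' $ k" for k using fun_cong[OF *(3), of k] by simp
      then show "j = j'" using * inj by (auto simp: inj_on_def vec_eq_iff)
    qed
    ultimately have "card ?S \<le> card (PiE (UNIV :: 'D set) (\<lambda>_. {-m..m}))"
      by (intro card_inj_on_le[of ?f]) (auto intro: finite_PiE)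
    also have "\<dots> = nat (2 * m + 1) ^ CARD('D)"
      by (simp add: card_PiE algebra_simps)
    finally have "card ?S \<le> nat (2 * m + 1) ^ CARD('D)" .
    then have "real (card ?S) \<le> real (nat (2 * m + 1)) ^ CARD('D)"
      unfolding of_nat_power[symmetric] by (rule of_nat_mono)
    also have "\<dots> \<le> (3 * r) ^ CARD('D)"
    proof (rule power_mono)
      have "real_of_int m \<le> r" by (simp add: m_def)
      then show "real (nat (2 * m + 1)) \<le> 3 * r" using m False by simp
    qed simp
    finally show ?thesis by (simp add: power_mult_distrib)
  qed
qed (rule assms(1))


section \<open>Fock space\<close>

text \<open>
  Fock space is used in the occupation-number representation: a vector is the family of its
  coefficients with respect to the occupation-number basis.  The operators act on arbitrary
  families of coefficients; the Fock space proper enters through \<open>fock_sector\<close>.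
\<close>

datatype statistics = Fermion | Boson

type_synonym config = "nat \<Rightarrow> nat"
type_synonym fock_vec = "config \<Rightarrow> complex"

definition configs :: "statistics \<Rightarrow> nat set \<Rightarrow> config set" where
  "configs st \<Lambda> = {\<nu>. (\<forall>i. i \<notin> \<Lambda> \<longrightarrow> \<nu> i = 0) \<and> (st = Fermion \<longrightarrow> (\<forall>i. \<nu> i \<le> 1))}"

definition fock_sector :: "statistics \<Rightarrow> nat set \<Rightarrow> nat \<Rightarrow> fock_vec set" where
  "fock_sector st \<Lambda> m = {\<psi>. \<forall>\<nu>. \<psi> \<nu> \<noteq> 0 \<longrightarrow> \<nu> \<in> configs st \<Lambda> \<and> (\<Sum>i\<in>\<Lambda>. \<nu> i) = m}"

definition fock_le :: "statistics \<Rightarrow> nat set \<Rightarrow> nat \<Rightarrow> fock_vec set" where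
  "fock_le st \<Lambda> n = {\<lambda>\<nu>. \<Sum>m\<le>n. \<phi> m \<nu> | \<phi>. \<forall>m\<le>n. \<phi> m \<in> fock_sector st \<Lambda> m}"

definition braket :: "statistics \<Rightarrow> nat set \<Rightarrow> fock_vec \<Rightarrow> fock_vec \<Rightarrow> complex" where
  "braket st \<Lambda> \<phi> \<psi> = (\<Sum>\<^sub>\<infinity>\<nu>\<in>configs st \<Lambda>. cnj (\<phi> \<nu>) * \<psi> \<nu>)"

text \<open>The Jordan-Wigner sign, with respect to the order of the site labels.\<close>

definition jw_sign :: "nat \<Rightarrow> config \<Rightarrow> complex" where
  "jw_sign i \<nu> = (- 1) ^ (\<Sum>j<i. \<nu> j)"

fun annihilate :: "statistics \<Rightarrow> nat \<Rightarrow> fock_vec \<Rightarrow> fock_vec" where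
  "annihilate Boson i \<psi> = (\<lambda>\<nu>. of_real (sqrt (real (\<nu> i + 1))) * \<psi> (\<nu>(i := \<nu> i + 1)))"
| "annihilate Fermion i \<psi> = (\<lambda>\<nu>. if \<nu> i = 0 then jw_sign i \<nu> * \<psi> (\<nu>(i := 1)) else 0)"

fun create :: "statistics \<Rightarrow> nat \<Rightarrow> fock_vec \<Rightarrow> fock_vec" where
  "create Boson i \<psi> =
     (\<lambda>\<nu>. if \<nu> i = 0 then 0 else of_real (sqrt (real (\<nu> i))) * \<psi> (\<nu>(i := \<nu> i - 1)))"
| "create Fermion i \<psi> = (\<lambda>\<nu>. if \<nu> i = 1 then jw_sign i \<nu> * \<psi> (\<nu>(i := 0)) else 0)"

lemma boson_ccr:
  "annihilate Boson i (create Boson j \<psi>) \<nu> - create Boson j (annihilate Boson i \<psi>) \<nu>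
     = (if i = j then \<psi> \<nu> else 0)"
  "annihilate Boson i (annihilate Boson j \<psi>) \<nu> - annihilate Boson j (annihilate Boson i \<psi>) \<nu> = 0"
proof -
  show "annihilate Boson i (annihilate Boson j \<psi>) \<nu>
      - annihilate Boson j (annihilate Boson i \<psi>) \<nu> = 0"
  proof (cases "i = j")
    case False
    then have "\<nu>(i := a, j := b) = \<nu>(j := b, i := a)" for a b by (rule fun_upd_twist)
    with False show ?thesis by simp
  qed simp
  have sq: "complex_of_real (sqrt x) * (complex_of_real (sqrt x) * z) = complex_of_real x * z"
    if "x \<ge> 0" for x z
    using that by (metis mult.assoc of_real_mult real_sqrt_mult_self abs_of_nonneg)
  show "annihilate Boson i (create Boson j \<psi>) \<nu> - create Boson j (annihilate Boson i \<psi>) \<nu>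
     = (if i = j then \<psi> \<nu> else 0)"
  proof (cases "i = j")
    case True
    have "annihilate Boson i (create Boson i \<psi>) \<nu> = of_nat (\<nu> i + 1) * \<psi> \<nu>"
      using sq[of "real (\<nu> i + 1)" "\<psi> \<nu>"] by simp
    moreover have "create Boson i (annihilate Boson i \<psi>) \<nu> = of_nat (\<nu> i) * \<psi> \<nu>"
      using sq[of "real (\<nu> i)" "\<psi> \<nu>"] by simp
    ultimately show ?thesis
      using True by (simp only:) (simp add: algebra_simps)
  next
    case False
    then have "\<nu>(i := a, j := b) = \<nu>(j := b, i := a)" for a b by (rule fun_upd_twist)
    with False show ?thesis by simp
  qed
qed

lemma jw_sign_upd:
  "jw_sign i (\<nu>(j := k)) = (if j < i then (- 1) ^ (\<nu> j + k) * jw_sign i \<nu> else jw_sign i \<nu>)"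
proof (cases "j < i")
  case True
  have *: "(\<Sum>l<i. f l) = f j + (\<Sum>l\<in>{..<i} - {j}. f l)" for f :: "nat \<Rightarrow> nat"
    using True by (simp add: sum.remove)
  have "(\<Sum>l\<in>{..<i} - {j}. (\<nu>(j := k)) l) = (\<Sum>l\<in>{..<i} - {j}. \<nu> l)"
    by (rule sum.cong) auto
  then show ?thesis
    using True *[of \<nu>] *[of "\<nu>(j := k)"]
    by (simp add: jw_sign_def power_add flip: mult.assoc power_mult_distrib)
qed (auto simp: jw_sign_def intro!: arg_cong[of _ _ "\<lambda>n. (- 1) ^ n"] sum.cong)

lemma jw_sign_square: "jw_sign i \<nu> * (jw_sign i \<nu> * z) = z"
  by (simp add: jw_sign_def flip: mult.assoc power_mult_distrib)

lemma fermion_car: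
  assumes "\<nu> \<in> configs Fermion \<Lambda>"
  shows "annihilate Fermion i (create Fermion j \<psi>) \<nu> + create Fermion j (annihilate Fermion i \<psi>) \<nu>
     = (if i = j then \<psi> \<nu> else 0)"
  and "annihilate Fermion i (annihilate Fermion j \<psi>) \<nu>
     + annihilate Fermion j (annihilate Fermion i \<psi>) \<nu> = 0"
proof -
  have upd: "\<nu> l = k \<Longrightarrow> \<nu>(l := k) = \<nu>" for l k by auto
  have twist: "\<nu>(i := a, j := b) = \<nu>(j := b, i := a)" if "i \<noteq> j" for a b
    using that by (rule fun_upd_twist)
  have "\<nu> i = 0 \<or> \<nu> i = 1" "\<nu> j = 0 \<or> \<nu> j = 1"
    using assms by (auto simp: configs_def le_Suc_eq)
  then show "annihilate Fermion i (create Fermion j \<psi>) \<nu>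
      + create Fermion j (annihilate Fermion i \<psi>) \<nu> = (if i = j then \<psi> \<nu> else 0)"
    by (cases i j rule: linorder_cases)
      (auto simp: jw_sign_upd jw_sign_square upd twist)
  show "annihilate Fermion i (annihilate Fermion j \<psi>) \<nu>
      + annihilate Fermion j (annihilate Fermion i \<psi>) \<nu> = 0"
    by (cases i j rule: linorder_cases) (auto simp: jw_sign_upd twist)
qed

lemma create_adjoint:
  assumes "i \<in> \<Lambda>"
  shows "braket st \<Lambda> (create st i \<phi>) \<psi> = braket st \<Lambda> \<phi> (annihilate st i \<psi>)"
proof (cases st)
  case Boson
  let ?A = "configs Boson \<Lambda>"
  have bij: "bij_betw (\<lambda>\<mu>. \<mu>(i := \<mu> i + 1)) ?A {\<nu> \<in> ?A. \<nu> i \<noteq> 0}"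
    by (rule bij_betw_byWitness[where f' = "\<lambda>\<nu>. \<nu>(i := \<nu> i - 1)"])
      (use assms in \<open>auto simp: configs_def\<close>)
  have "braket Boson \<Lambda> (create Boson i \<phi>) \<psi>
      = (\<Sum>\<^sub>\<infinity>\<nu>\<in>{\<nu> \<in> ?A. \<nu> i \<noteq> 0}. cnj (create Boson i \<phi> \<nu>) * \<psi> \<nu>)"
    unfolding braket_def by (rule infsum_cong_neutral) auto
  also have "\<dots> = braket Boson \<Lambda> \<phi> (annihilate Boson i \<psi>)"
    unfolding braket_def infsum_reindex_bij_betw[OF bij, symmetric]
    by (rule infsum_cong) (simp add: mult_ac)
  finally show ?thesis using Boson by simp
next
  case Fermion
  let ?A = "configs Fermion \<Lambda>"
  have bij: "bij_betw (\<lambda>\<mu>. \<mu>(i := 1)) {\<mu> \<in> ?A. \<mu> i = 0} {\<nu> \<in> ?A. \<nu> i = 1}"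
    by (rule bij_betw_byWitness[where f' = "\<lambda>\<nu>. \<nu>(i := 0)"])
      (use assms in \<open>auto simp: configs_def\<close>)
  have "braket Fermion \<Lambda> (create Fermion i \<phi>) \<psi>
      = (\<Sum>\<^sub>\<infinity>\<nu>\<in>{\<nu> \<in> ?A. \<nu> i = 1}. cnj (create Fermion i \<phi> \<nu>) * \<psi> \<nu>)"
    unfolding braket_def by (rule infsum_cong_neutral) auto
  also have "\<dots> = (\<Sum>\<^sub>\<infinity>\<mu>\<in>{\<mu> \<in> ?A. \<mu> i = 0}. cnj (\<phi> \<mu>) * annihilate Fermion i \<psi> \<mu>)"
    unfolding infsum_reindex_bij_betw[OF bij, symmetric]
  proof (rule infsum_cong)
    fix \<mu> assume "\<mu> \<in> {\<mu> \<in> ?A. \<mu> i = 0}"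
    then have "\<mu> i = 0" "\<mu>(i := 0) = \<mu>" by auto
    then show "cnj (create Fermion i \<phi> (\<mu>(i := 1))) * \<psi> (\<mu>(i := 1))
        = cnj (\<phi> \<mu>) * annihilate Fermion i \<psi> \<mu>"
      by (simp add: jw_sign_upd) (simp add: jw_sign_def)
  qed
  also have "\<dots> = braket Fermion \<Lambda> \<phi> (annihilate Fermion i \<psi>)"
    unfolding braket_def by (rule infsum_cong_neutral) auto
  finally show ?thesis using Fermion by simp
qed


section \<open>Dynamics\<close>

definition hamiltonian :: "statistics \<Rightarrow> nat set \<Rightarrow> (nat \<Rightarrow> nat \<Rightarrow> complex) \<Rightarrow> fock_vec \<Rightarrow> fock_vec"
  where "hamiltonian st X h \<psi> =
    (\<lambda>\<nu>. \<Sum>i\<in>X. \<Sum>j\<in>X. h i j * create st i (annihilate st j \<psi>) \<nu>)"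

text \<open>
  The time-ordered exponential is the Dyson series.  It is evaluated coefficientwise: the
  quadratic Hamiltonians above preserve the particle number, and each sector is
  finite-dimensional, so no topology on the Fock space is needed even though \<open>H(t)\<close> is
  unbounded for bosons.
\<close>

primrec dyson :: "(real \<Rightarrow> fock_vec \<Rightarrow> fock_vec) \<Rightarrow> fock_vec \<Rightarrow> nat \<Rightarrow> real \<Rightarrow> fock_vec" where
  "dyson H \<psi> 0 = (\<lambda>t. \<psi>)"
| "dyson H \<psi> (Suc k) = (\<lambda>t \<nu>. - \<i> * integral {0..t} (\<lambda>s. H s (dyson H \<psi> k s) \<nu>))"

definition propagator :: "(real \<Rightarrow> fock_vec \<Rightarrow> fock_vec) \<Rightarrow> real \<Rightarrow> fock_vec \<Rightarrow> fock_vec" where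
  "propagator H t \<psi> = (\<lambda>\<nu>. \<Sum>k. dyson H \<psi> k t \<nu>)"

text \<open>
  The adjoint of \<open>U(t)\<close> is moved to the other side of the inner product:
  \<open>\<langle>\<psi>\<^sub>0|U(t)\<^sup>\<dagger> O U(t)|\<psi>\<^sub>0\<rangle> = \<langle>U(t) \<psi>\<^sub>0|O U(t) \<psi>\<^sub>0\<rangle>\<close>.
\<close>

definition dense_output ::
  "statistics \<Rightarrow> nat set \<Rightarrow> real \<Rightarrow> fock_vec \<Rightarrow> (real \<Rightarrow> fock_vec \<Rightarrow> fock_vec) \<Rightarrow>
    (fock_vec \<Rightarrow> fock_vec) \<Rightarrow> complex" where
  "dense_output st \<Lambda> T \<psi>\<^sub>0 H Obs =
     integral {0..T} (\<lambda>t. braket st \<Lambda> (propagator H t \<psi>\<^sub>0) (Obs (propagator H t \<psi>\<^sub>0)))"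

end

theory Submission
  imports Defs
begin

text \<open>
  The dynamics is free, so \<open>c\<^sub>q\<close> evolves in the Heisenberg picture into a linear combination
  \<open>\<Sum>\<^sub>j w\<^sub>j c\<^sub>j\<close>, where \<open>w\<close> solves a one-particle Schroedinger equation started at \<open>q\<close> and run
  backwards from time \<open>t\<close>.  Let \<open>w\<close> be driven by the truncated Hamiltonian.  Then
  \<open>\<parallel>\<Sum>\<^sub>j w\<^sub>j c\<^sub>j \<psi>\<parallel>\<^sup>2\<close> is constant along the truncated evolution, while along the full one it drifts at
  rate at most \<open>2 n \<parallel>w (h\<^sub>R - h)\<parallel>\<close>, since \<open>\<parallel>\<Sum>\<^sub>j w\<^sub>j c\<^sub>j \<psi>\<parallel> \<le> \<surd>n \<parallel>w\<parallel> \<parallel>\<psi>\<parallel>\<close> on states with at most \<open>n\<close>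
  particles.  As \<open>w\<close> lives inside the ball of radius \<open>R\<close>, the defect \<open>w (h\<^sub>R - h)\<close> only involves
  hopping out of that ball.  Hops starting within \<open>R/2\<close> of \<open>q\<close> cost \<open>O(R\<^bsup>D-\<alpha>\<^esup>)\<close> by Schur's test; the
  others cost at most the square root of the probability that the particle is farther than \<open>R/2\<close>
  from \<open>q\<close>.  That probability is \<open>O(t R\<^bsup>-p\<^esup>)\<close> for every \<open>1 < p < \<alpha> - D\<close> inside the light cone: the
  expectation of \<open>(d(i,q) - v t)\<^sub>+\<^sup>p\<close> grows at most linearly in \<open>t\<close> once \<open>v\<close> is large.
\<close>

section \<open>Primitives of integrable functions\<close>

text \<open>The entries of \<open>h\<close> are only absolutely integrable in time, so neither
  states nor modes need be differentiable at every time. All calculus is therefore done with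
  functions that are integrals of integrable functions, and a product rule for these replaces
  differentiation. The initial state is arbitrary and may be spread over the whole lattice, so
  locality cannot be read off the many-body state. It is proved for the single mode started at
  \<open>q\<close>; the state enters only through its norm and the bound \<open>n\<close> on its
  particle number, which keeps the constants independent of the number of sites. A plain moment of
  the distance would grow like the p-th power of time already for ballistic motion. With the
  receding weight only long jumps count, which leaves one power of time; its square root, together
  with the drift and the integration of the output, makes up the T^(5/2) of the claim. The range of
  p has two sources: p > 1 makes the weight continuously differentiable, and p < \<alpha> - D makes
  the sum of d^(p - \<alpha>) over the lattice converge uniformly.\<close>

definition primitive_on :: "real \<Rightarrow> (real \<Rightarrow> complex) \<Rightarrow> (real \<Rightarrow> complex) \<Rightarrow> bool" where
  "primitive_on T f f' \<longleftrightarrow> f' absolutely_integrable_on {0..T} \<and>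
     (\<forall>t\<in>{0..T}. f t = f 0 + integral {0..t} f')"

lemma primitive_on_eq:
  "primitive_on T f f' \<Longrightarrow> 0 \<le> t \<Longrightarrow> t \<le> T \<Longrightarrow> f t = f 0 + integral {0..t} f'"
  unfolding primitive_on_def by (elim conjE bspec) simp

lemma primitive_on_integrable: "primitive_on T f f' \<Longrightarrow> f' absolutely_integrable_on {0..T}"
  unfolding primitive_on_def by (rule conjunct1)

lemma primitive_onI:
  assumes "f' absolutely_integrable_on {0..T}"
    and "\<And>t. 0 \<le> t \<Longrightarrow> t \<le> T \<Longrightarrow> f t = f 0 + integral {0..t} f'"
  shows "primitive_on T f f'"
  unfolding primitive_on_def using assms(1) by (intro conjI ballI assms(2)) auto

lemma primitive_on_mono:
  assumes f: "primitive_on T f f'" and t: "t \<le> T"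
  shows "primitive_on t f f'"
proof (rule primitive_onI)
  show "f' absolutely_integrable_on {0..t}"
    using primitive_on_integrable[OF f] t by (auto intro: absolutely_integrable_on_subinterval)
  fix x assume "0 \<le> x" "x \<le> t"
  then show "f x = f 0 + integral {0..x} f'"
    using primitive_on_eq[OF f, of x] t by (meson order_trans)
qed

lemma primitive_on_cong:
  assumes "primitive_on T f f'" and "\<And>t. 0 \<le> t \<Longrightarrow> t \<le> T \<Longrightarrow> f t = g t"
    and "\<And>t. 0 \<le> t \<Longrightarrow> t \<le> T \<Longrightarrow> f' t = g' t"
  shows "primitive_on T g g'"
proof (rule primitive_onI)
  show "g' absolutely_integrable_on {0..T}"
    by (rule absolutely_integrable_spike[where f = f' and S = "{}"])
      (use assms(3) primitive_on_integrable[OF assms(1)] in auto)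
  fix t assume t: "0 \<le> t" "t \<le> T"
  have "integral {0..t} f' = integral {0..t} g'"
    using assms(3) t by (intro Henstock_Kurzweil_Integration.integral_cong) auto
  then show "g t = g 0 + integral {0..t} g'"
    using primitive_on_eq[OF assms(1) t] assms(2)[OF t] assms(2)[of 0] t by simp
qed

lemma primitive_on_continuous:
  assumes "primitive_on T f f'"
  shows "continuous_on {0..T} f"
proof -
  have "f' integrable_on {0..T}"
    using primitive_on_integrable[OF assms] by (simp add: absolutely_integrable_on_def)
  then have "continuous_on {0..T} (\<lambda>t. f 0 + integral {0..t} f')"
    by (intro continuous_intros indefinite_integral_continuous_1)
  then show ?thesis
    by (rule continuous_on_eq) (simp add: primitive_on_eq[OF assms, symmetric])
qed

lemma primitive_on_const [simp]: "primitive_on T (\<lambda>_. c) (\<lambda>_. 0)"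
  by (simp add: primitive_on_def)

lemma primitive_on_add:
  assumes "primitive_on T f f'" "primitive_on T g g'"
  shows "primitive_on T (\<lambda>t. f t + g t) (\<lambda>t. f' t + g' t)"
proof (rule primitive_onI)
  note i = assms[THEN primitive_on_integrable]
  show "(\<lambda>t. f' t + g' t) absolutely_integrable_on {0..T}"
    using i by (rule set_integral_add)
  fix t assume t: "0 \<le> t" "t \<le> T"
  have "integral {0..t} (\<lambda>t. f' t + g' t) = integral {0..t} f' + integral {0..t} g'"
    using t i by (intro Henstock_Kurzweil_Integration.integral_add set_lebesgue_integral_eq_integral(1))
      (auto intro: absolutely_integrable_on_subinterval)
  then show "f t + g t = f 0 + g 0 + integral {0..t} (\<lambda>t. f' t + g' t)"
    using primitive_on_eq[OF assms(1) t] primitive_on_eq[OF assms(2) t] by simp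
qed

lemma primitive_on_sum:
  assumes "\<And>i. i \<in> I \<Longrightarrow> primitive_on T (f i) (f' i)"
  shows "primitive_on T (\<lambda>t. \<Sum>i\<in>I. f i t) (\<lambda>t. \<Sum>i\<in>I. f' i t)"
  using assms
proof (induction I rule: infinite_finite_induct)
  case (insert i I)
  then have "primitive_on T (f i) (f' i)" "primitive_on T (\<lambda>t. \<Sum>i\<in>I. f i t) (\<lambda>t. \<Sum>i\<in>I. f' i t)"
    by blast+
  from primitive_on_add[OF this] insert.hyps show ?case
    by simp
qed simp_all

section \<open>Product rule for primitives\<close>

lemma absolutely_integrable_mult_continuous:
  fixes f g :: "real \<Rightarrow> complex"
  assumes "f absolutely_integrable_on {0..T}" "continuous_on {0..T} g"
  shows "(\<lambda>t. f t * g t) absolutely_integrable_on {0..T}"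
proof -
  have "(\<lambda>t. g t * f t) absolutely_integrable_on {0..T}"
  proof (rule absolutely_integrable_bounded_measurable_product[where h = "(*)"])
    show "bilinear ((*) :: complex \<Rightarrow> complex \<Rightarrow> complex)"
      by (simp add: bilinear_conv_bounded_bilinear bounded_bilinear_mult)
    show "g \<in> borel_measurable (lebesgue_on {0..T})"
      by (simp add: assms(2) continuous_imp_measurable_on_sets_lebesgue)
    show "bounded (g ` {0..T})"
      using assms(2) compact_continuous_image compact_imp_bounded by blast
  qed (use assms in auto)
  then show ?thesis by (simp add: mult.commute)
qed

text \<open>This is integration by parts for functions that are merely integrable. By Fubini the
  product is an integral over a square, which the diagonal cuts into two triangles; each of them is
  an iterated integral.\<close>

lemma integral_triangle_split:
  fixes f g :: "real \<Rightarrow> complex"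
  assumes f: "f absolutely_integrable_on {0..t}" and g: "g absolutely_integrable_on {0..t}"
  shows "integral {0..t} f * integral {0..t} g =
    integral {0..t} (\<lambda>x. f x * integral {0..x} g) + integral {0..t} (\<lambda>y. integral {0..y} f * g y)"
proof -
  define M where "M = lebesgue_on {0..t}"
  have fin: "finite_measure M"
    by (simp add: M_def finite_measure_lebesgue_on)
  interpret finite_measure M by (rule fin)
  interpret P: pair_sigma_finite M M ..
  have sp: "space M = {0..t}" by (simp add: M_def)
  have iM: "integrable M f" "integrable M g"
    using f g by (auto simp: M_def absolutely_integrable_imp_integrable)
  have L: "integral\<^sup>L M k = integral {0..t} k" if "integrable M k" for k :: "real \<Rightarrow> complex"
    using that by (simp add: M_def lebesgue_integral_eq_integral)
  have id: "(\<lambda>x. x) \<in> borel_measurable M"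
    by (simp add: M_def continuous_imp_measurable_on_sets_lebesgue)
  note [measurable] = borel_measurable_integrable[OF iM(1)] borel_measurable_integrable[OF iM(2)] id
  have fstm [measurable]: "fst \<in> borel_measurable (M \<Otimes>\<^sub>M M)"
    using measurable_comp[OF measurable_fst[of M M] id] by (simp add: comp_def)
  have sndm [measurable]: "snd \<in> borel_measurable (M \<Otimes>\<^sub>M M)"
    using measurable_comp[OF measurable_snd[of M M] id] by (simp add: comp_def)
  have prod: "integrable (M \<Otimes>\<^sub>M M) (\<lambda>(x,y). f x * g y)"
  proof (rule P.Fubini_integrable)
    show "integrable M (\<lambda>x. LINT y|M. norm (case (x, y) of (x, y) \<Rightarrow> f x * g y))"
      using iM by (simp add: norm_mult)
    show "AE x in M. integrable M (\<lambda>y. case (x, y) of (x, y) \<Rightarrow> f x * g y)"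
      using iM by simp
  qed measurable
  define k where "k = (\<lambda>(x,y). if y \<le> x then f x * g y else 0)"
  define l where "l = (\<lambda>(x,y). if y \<le> x then 0 else f x * g y)"
  have kl: "integrable (M \<Otimes>\<^sub>M M) k" "integrable (M \<Otimes>\<^sub>M M) l"
    unfolding k_def l_def
    by (rule Bochner_Integration.integrable_bound[OF prod], measurable, simp add: split_beta)+
  have sub: "f absolutely_integrable_on {0..x}" "g absolutely_integrable_on {0..x}"
    if "x \<le> t" for x
    using f g that by (auto intro: absolutely_integrable_on_subinterval)
  have slice: "(LINT y|M. (if y \<le> x then h y else 0)) = integral {0..x} h"
    if "x \<in> {0..t}" "h absolutely_integrable_on {0..t}" for x and h :: "real \<Rightarrow> complex"
  proof -
    have h: "h absolutely_integrable_on {0..x}"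
      using that by (auto intro: absolutely_integrable_on_subinterval)
    have "(LINT y|M. (if y \<le> x then h y else 0)) = (LINT y:{0..t}|lebesgue. (if y \<le> x then h y else 0))"
      by (simp add: M_def integral_restrict_space set_lebesgue_integral_def)
    also have "\<dots> = (LINT y:{0..x}|lebesgue. h y)"
      unfolding set_lebesgue_integral_def
      by (rule Bochner_Integration.integral_cong) (use that in \<open>auto simp: indicator_def\<close>)
    also have "\<dots> = integral {0..x} h"
      using h by (rule set_lebesgue_integral_eq_integral)
    finally show ?thesis .
  qed
  \<comment> \<open>The part \<open>l\<close> omits the diagonal, so its slices are half-open; the
    missing endpoint is a null set.\<close>
  have slice': "(LINT y|M. (if x \<le> y then 0 else h y)) = integral {0..x} h"
    if "x \<in> {0..t}" "h absolutely_integrable_on {0..t}" for x and h :: "real \<Rightarrow> complex"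
  proof -
    have [measurable]: "h \<in> borel_measurable M"
      using absolutely_integrable_imp_integrable[OF that(2)] by (auto simp: M_def)
    have "AE y in M. y \<noteq> x"
    proof (rule AE_I')
      show "{x} \<inter> {0..t} \<in> null_sets M"
        using that(1) unfolding M_def
        by (subst null_sets_restrict_space) (auto simp: Int_absorb2)
    qed (auto simp: sp that)
    then have "(LINT y|M. (if x \<le> y then 0 else h y)) = (LINT y|M. (if y \<le> x then h y else 0))"
      by (intro integral_cong_AE) (measurable, auto elim: eventually_mono)
    then show ?thesis using slice[OF that] by simp
  qed
  have "integral {0..t} f * integral {0..t} g = (LINT x|M. f x) * (LINT y|M. g y)"
    using iM by (simp add: L)
  also have "\<dots> = (LINT x|M. (LINT y|M. f x * g y))"
    using iM by simp
  also have "\<dots> = integral\<^sup>L (M \<Otimes>\<^sub>M M) (\<lambda>(x,y). f x * g y)"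
    using P.integral_fst[OF prod] by simp
  also have "\<dots> = integral\<^sup>L (M \<Otimes>\<^sub>M M) (\<lambda>z. k z + l z)"
    by (rule Bochner_Integration.integral_cong) (auto simp: k_def l_def)
  also have "\<dots> = integral\<^sup>L (M \<Otimes>\<^sub>M M) k + integral\<^sup>L (M \<Otimes>\<^sub>M M) l"
    using kl by simp
  also have "integral\<^sup>L (M \<Otimes>\<^sub>M M) k = (LINT x|M. (LINT y|M. k (x,y)))"
    using P.integral_fst'[OF kl(1)] by simp
  also have "\<dots> = (LINT x|M. f x * integral {0..x} g)"
  proof (rule Bochner_Integration.integral_cong)
    fix x assume x: "x \<in> space M"
    have "(LINT y|M. k (x,y)) = (LINT y|M. f x * (if y \<le> x then g y else 0))"
      by (rule Bochner_Integration.integral_cong) (auto simp: k_def)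
    then show "(LINT y|M. k (x,y)) = f x * integral {0..x} g"
      using slice[of x g] x g by (simp add: sp)
  qed simp
  also have "\<dots> = integral {0..t} (\<lambda>x. f x * integral {0..x} g)"
  proof (rule L)
    have "continuous_on {0..t} (\<lambda>x. integral {0..x} g)"
      using g by (intro indefinite_integral_continuous_1 set_lebesgue_integral_eq_integral(1))
    then show "integrable M (\<lambda>x. f x * integral {0..x} g)"
      unfolding M_def
      by (intro absolutely_integrable_imp_integrable absolutely_integrable_mult_continuous f) auto
  qed
  also have "integral\<^sup>L (M \<Otimes>\<^sub>M M) l = (LINT y|M. (LINT x|M. l (x,y)))"
    using P.integral_snd[of "\<lambda>x y. l (x,y)"] kl by simp
  also have "\<dots> = (LINT y|M. integral {0..y} f * g y)"
  proof (rule Bochner_Integration.integral_cong)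
    fix y assume y: "y \<in> space M"
    have "(LINT x|M. l (x,y)) = (LINT x|M. (if y \<le> x then 0 else f x) * g y)"
      by (rule Bochner_Integration.integral_cong) (auto simp: l_def)
    then show "(LINT x|M. l (x,y)) = integral {0..y} f * g y"
      using slice'[of y f] y f by (simp add: sp)
  qed simp
  also have "\<dots> = integral {0..t} (\<lambda>y. integral {0..y} f * g y)"
  proof (rule L)
    have "continuous_on {0..t} (\<lambda>x. integral {0..x} f)"
      using f by (intro indefinite_integral_continuous_1 set_lebesgue_integral_eq_integral(1))
    then have "(\<lambda>y. g y * integral {0..y} f) absolutely_integrable_on {0..t}"
      by (intro absolutely_integrable_mult_continuous g)
    then show "integrable M (\<lambda>y. integral {0..y} f * g y)"
      unfolding M_def
      by (intro absolutely_integrable_imp_integrable) (auto simp: mult.commute)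
  qed
  finally show ?thesis .
qed

text \<open>Each factor is its initial value plus an integral. Terms with an initial value are
  linear, and \<open>integral_triangle_split\<close> supplies the product of the two
  integrals.\<close>

lemma primitive_on_mult:
  assumes f: "primitive_on T f f'" and g: "primitive_on T g g'"
  shows "primitive_on T (\<lambda>t. f t * g t) (\<lambda>t. f' t * g t + f t * g' t)"
proof (rule primitive_onI)
  have fg: "(\<lambda>t. f' t * g t) absolutely_integrable_on {0..T}"
    using f g by (intro absolutely_integrable_mult_continuous)
      (auto intro: primitive_on_continuous simp: primitive_on_integrable)
  have gf: "(\<lambda>t. f t * g' t) absolutely_integrable_on {0..T}"
    using f g absolutely_integrable_mult_continuous[where f = g' and T = T and g = f]
    by (auto intro: primitive_on_continuous simp: primitive_on_integrable mult.commute)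
  show "(\<lambda>t. f' t * g t + f t * g' t) absolutely_integrable_on {0..T}"
    using fg gf by (rule set_integral_add)
  fix t assume t: "0 \<le> t" "t \<le> T"
  let ?F = "\<lambda>x. integral {0..x} f'" and ?G = "\<lambda>x. integral {0..x} g'"
  have sub: "h absolutely_integrable_on {0..t}" if "h absolutely_integrable_on {0..T}"
    for h :: "real \<Rightarrow> complex"
    using that t by (auto intro: absolutely_integrable_on_subinterval)
  have int: "h integrable_on {0..t}" if "h absolutely_integrable_on {0..t}" for h :: "real \<Rightarrow> complex"
    using that by (rule set_lebesgue_integral_eq_integral)
  have f': "f' absolutely_integrable_on {0..t}" and g': "g' absolutely_integrable_on {0..t}"
    using f g by (auto intro: sub primitive_on_integrable)
  have FG: "continuous_on {0..t} ?F" "continuous_on {0..t} ?G"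
    using f' g' by (auto intro: indefinite_integral_continuous_1 int)
  have 1: "(\<lambda>x. f' x * ?G x) absolutely_integrable_on {0..t}"
    using f' FG by (intro absolutely_integrable_mult_continuous)
  have 2: "(\<lambda>x. ?F x * g' x) absolutely_integrable_on {0..t}"
    using absolutely_integrable_mult_continuous[OF g' FG(1)] by (simp add: mult.commute)
  have e: "f x = f 0 + ?F x" "g x = g 0 + ?G x" if "x \<in> {0..t}" for x
    using t that by (auto intro!: primitive_on_eq[OF f] primitive_on_eq[OF g])
  have "integral {0..t} (\<lambda>t. f' t * g t + f t * g' t) =
    integral {0..t} (\<lambda>x. (f' x * g 0 + f 0 * g' x) + (f' x * ?G x + ?F x * g' x))"
  proof (rule Henstock_Kurzweil_Integration.integral_cong)
    fix x assume "x \<in> {0..t}"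
    from e[OF this] show "f' x * g x + f x * g' x =
        f' x * g 0 + f 0 * g' x + (f' x * ?G x + ?F x * g' x)"
      by (simp add: algebra_simps)
  qed
  also have "\<dots> = (?F t * g 0 + f 0 * ?G t)
      + (integral {0..t} (\<lambda>x. f' x * ?G x) + integral {0..t} (\<lambda>x. ?F x * g' x))"
    using int[OF f'] int[OF g'] int[OF 1] int[OF 2]
    by (simp add: Henstock_Kurzweil_Integration.integral_add integrable_add
        integrable_on_mult_left integrable_on_mult_right)
  also have "\<dots> = ?F t * g 0 + f 0 * ?G t + ?F t * ?G t"
    using integral_triangle_split[OF f' g'] by simp
  finally show "f t * g t = f 0 * g 0 + integral {0..t} (\<lambda>t. f' t * g t + f t * g' t)"
    using e[of t] t by (simp add: algebra_simps)
qed

lemma primitive_on_cmult: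
  assumes "primitive_on T f f'"
  shows "primitive_on T (\<lambda>t. c * f t) (\<lambda>t. c * f' t)"
  using primitive_on_mult[OF primitive_on_const[of T c] assms] by simp

lemma primitive_on_cnj:
  assumes "primitive_on T f f'"
  shows "primitive_on T (\<lambda>t. cnj (f t)) (\<lambda>t. cnj (f' t))"
proof (rule primitive_onI)
  show "(\<lambda>t. cnj (f' t)) absolutely_integrable_on {0..T}"
    using absolutely_integrable_linear[OF primitive_on_integrable[OF assms] bounded_linear_cnj]
    unfolding comp_def .
  fix t assume t: "0 \<le> t" "t \<le> T"
  have "f' absolutely_integrable_on {0..t}"
    using primitive_on_integrable[OF assms] t by (auto intro: absolutely_integrable_on_subinterval)
  then have "f' integrable_on {0..t}"
    by (rule set_lebesgue_integral_eq_integral)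
  from integral_linear[OF this bounded_linear_cnj]
  have "integral {0..t} (\<lambda>t. cnj (f' t)) = cnj (integral {0..t} f')"
    by (simp only: comp_def)
  then show "cnj (f t) = cnj (f 0) + integral {0..t} (\<lambda>t. cnj (f' t))"
    by (simp only: primitive_on_eq[OF assms t] complex_cnj_add)
qed

text \<open>Serves the factorial bound on Dyson terms, where \<open>f\<close> is the integrated
  matrix norm.\<close>

lemma primitive_on_power_Suc:
  assumes "primitive_on T f f'"
  shows "primitive_on T (\<lambda>t. f t ^ Suc k) (\<lambda>t. of_nat (Suc k) * f t ^ k * f' t)"
proof (induction k)
  case 0
  then show ?case using assms by simp
next
  case (Suc k)
  show ?case
    by (rule primitive_on_cong[OF primitive_on_mult[OF assms Suc]]) (auto simp: algebra_simps)
qed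

section \<open>Time reversal and growth estimates\<close>

lemma integral_reverse:
  fixes f :: "real \<Rightarrow> complex"
  assumes f: "f absolutely_integrable_on {0..t}" and s: "0 \<le> s" "s \<le> t"
  shows "(\<lambda>x. f (t - x)) absolutely_integrable_on {0..s}"
    and "integral {0..s} (\<lambda>x. f (t - x)) = integral {0..t} f - integral {0..t - s} f"
proof -
  have im: "(\<lambda>x. t - x) ` {0..s} = {t - s..t}"
    by (simp add: image_diff_atLeastAtMost)
  have "f absolutely_integrable_on {t - s..t}"
    using f s by (auto intro: absolutely_integrable_on_subinterval)
  then have *: "(\<lambda>x. \<bar>-1 :: real\<bar> *\<^sub>R f (t - x)) absolutely_integrable_on {0..s} \<and>
      integral {0..s} (\<lambda>x. \<bar>-1 :: real\<bar> *\<^sub>R f (t - x)) = integral {t - s..t} f"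
    by (subst has_absolute_integral_change_of_variables_real)
      (auto intro!: derivative_eq_intros simp: inj_on_def im)
  then show "(\<lambda>x. f (t - x)) absolutely_integrable_on {0..s}" by simp
  have "integral {0..t - s} f + integral {t - s..t} f = integral {0..t} f"
    using s f by (intro Henstock_Kurzweil_Integration.integral_combine)
      (auto intro: set_lebesgue_integral_eq_integral)
  then show "integral {0..s} (\<lambda>x. f (t - x)) = integral {0..t} f - integral {0..t - s} f"
    using * by (simp add: algebra_simps)
qed

text \<open>The mode is solved forward from \<open>q\<close> and then read backwards, so its
  equation is needed in reversed time.\<close>

lemma primitive_on_reverse:
  assumes "primitive_on T f f'"
  shows "primitive_on T (\<lambda>t. f (T - t)) (\<lambda>t. - f' (T - t))"
proof (rule primitive_onI)
  have f': "f' absolutely_integrable_on {0..T}"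
    using assms by (rule primitive_on_integrable)
  show "(\<lambda>t. - f' (T - t)) absolutely_integrable_on {0..T}"
  proof (cases "T \<ge> 0")
    case True
    then show ?thesis
      using absolutely_integrable_linear[OF integral_reverse(1)[OF f', of T] bounded_linear_minus[OF bounded_linear_ident]]
      by (simp add: comp_def)
  qed simp
  fix t assume t: "0 \<le> t" "t \<le> T"
  show "f (T - t) = f (T - 0) + integral {0..t} (\<lambda>t. - f' (T - t))"
    using integral_reverse(2)[OF f', of t] primitive_on_eq[OF assms, of "T - t"]
      primitive_on_eq[OF assms, of T] t
    by simp
qed

lemma primitive_on_of_real_C1:
  fixes f f' :: "real \<Rightarrow> real"
  assumes f: "\<And>t. 0 \<le> t \<Longrightarrow> t \<le> T \<Longrightarrow> (f has_real_derivative f' t) (at t)"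
    and f': "continuous_on {0..T} f'"
  shows "primitive_on T (\<lambda>t. of_real (f t)) (\<lambda>t. of_real (f' t))"
proof (rule primitive_onI)
  have "continuous_on {0..T} (\<lambda>t. complex_of_real (f' t))"
    using f' by (intro continuous_intros)
  then show "(\<lambda>t. complex_of_real (f' t)) absolutely_integrable_on {0..T}"
    by (intro absolutely_integrable_continuous_real)
  fix t assume t: "0 \<le> t" "t \<le> T"
  have "((\<lambda>t. complex_of_real (f' t)) has_integral (of_real (f t) - of_real (f 0))) {0..t}"
  proof (rule fundamental_theorem_of_calculus)
    fix x assume "x \<in> {0..t}"
    then have "(f has_vector_derivative f' x) (at x within {0..t})"
      using f[of x] t by (auto simp: has_real_derivative_iff_has_vector_derivative
          intro: has_vector_derivative_at_within)
    then show "((\<lambda>t. complex_of_real (f t)) has_vector_derivative of_real (f' x)) (at x within {0..t})"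
      by (rule bounded_linear.has_vector_derivative[OF bounded_linear_of_real])
  qed (use t in auto)
  then show "complex_of_real (f t) = of_real (f 0) + integral {0..t} (\<lambda>t. of_real (f' t))"
    by (simp add: integral_unique)
qed

lemma primitive_on_bound:
  assumes f: "primitive_on T f f'" and T: "0 \<le> T"
    and B: "\<And>t. 0 \<le> t \<Longrightarrow> t \<le> T \<Longrightarrow> cmod (f' t) \<le> B"
  shows "cmod (f T - f 0) \<le> B * T"
proof -
  have "f' integrable_on {0..T}"
    using primitive_on_integrable[OF f] by (rule set_lebesgue_integral_eq_integral)
  then have "norm (integral {0..T} f') \<le> integral {0..T} (\<lambda>_. B)"
    using B by (intro integral_norm_bound_integral) auto
  then show ?thesis
    using primitive_on_eq[OF f, of T] T by (simp add: mult.commute)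
qed

text \<open>A one-sided bound is what transport needs: there the derivative has a large negative
  part that must not be estimated by its modulus.\<close>

lemma primitive_on_Re_bound:
  assumes f: "primitive_on T f f'" and T: "0 \<le> T"
    and B: "\<And>t. 0 \<le> t \<Longrightarrow> t \<le> T \<Longrightarrow> Re (f' t) \<le> B"
  shows "Re (f T) \<le> Re (f 0) + B * T"
proof -
  have i: "f' integrable_on {0..T}"
    using primitive_on_integrable[OF f] by (rule set_lebesgue_integral_eq_integral)
  have "(\<lambda>x. Re (f' x)) integrable_on {0..T}"
    using integrable_linear[OF i bounded_linear_Re] by (simp add: comp_def)
  then have "integral {0..T} (\<lambda>x. Re (f' x)) \<le> integral {0..T} (\<lambda>_. B)"
    using B by (intro integral_le) auto
  moreover have "integral {0..T} (\<lambda>x. Re (f' x)) = Re (integral {0..T} f')"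
    using integral_linear[OF i bounded_linear_Re] by (simp add: comp_def)
  ultimately show ?thesis
    using primitive_on_eq[OF f, of T] T by (simp add: mult.commute)
qed

text \<open>Compares \<open>f\<close> with a function of known growth, so that Dyson terms can be
  bounded without computing iterated integrals.\<close>

lemma primitive_on_dominated:
  assumes f: "primitive_on T f f'" and g: "primitive_on T g g'" and t: "0 \<le> t" "t \<le> T"
    and le: "\<And>s. 0 \<le> s \<Longrightarrow> s \<le> t \<Longrightarrow> cmod (f' s) \<le> Re (g' s)"
  shows "cmod (f t - f 0) \<le> Re (g t) - Re (g 0)"
proof -
  have "f' absolutely_integrable_on {0..t}" "g' absolutely_integrable_on {0..t}"
    using primitive_on_integrable[OF f] primitive_on_integrable[OF g] t
    by (auto intro: absolutely_integrable_on_subinterval)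
  then have i: "f' integrable_on {0..t}" "g' integrable_on {0..t}"
    by (auto intro: set_lebesgue_integral_eq_integral)
  have "(\<lambda>x. Re (g' x)) integrable_on {0..t}"
    using integrable_linear[OF i(2) bounded_linear_Re] by (simp add: comp_def)
  then have "norm (integral {0..t} f') \<le> integral {0..t} (\<lambda>x. Re (g' x))"
    using le i(1) by (intro integral_norm_bound_integral) auto
  moreover have "integral {0..t} (\<lambda>x. Re (g' x)) = Re (integral {0..t} g')"
    using integral_linear[OF i(2) bounded_linear_Re] by (simp add: comp_def)
  ultimately show ?thesis
    using primitive_on_eq[OF f t] primitive_on_eq[OF g t] by simp
qed

section \<open>The Dyson series of a finite linear system\<close>

text \<open>The recursion of \<open>dyson\<close> over an arbitrary index set. It is used twice:
  over configurations for the many-body state and over sites for the single mode.\<close>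

primrec dyson_vec ::
  "(real \<Rightarrow> 'a \<Rightarrow> 'a \<Rightarrow> complex) \<Rightarrow> 'a set \<Rightarrow> ('a \<Rightarrow> complex) \<Rightarrow> nat \<Rightarrow> real \<Rightarrow> 'a \<Rightarrow> complex" where
  "dyson_vec M S x 0 = (\<lambda>t. x)"
| "dyson_vec M S x (Suc k) =
     (\<lambda>t i. - \<i> * integral {0..t} (\<lambda>s. \<Sum>j\<in>S. M s i j * dyson_vec M S x k s j))"

definition dyson_sol ::
  "(real \<Rightarrow> 'a \<Rightarrow> 'a \<Rightarrow> complex) \<Rightarrow> 'a set \<Rightarrow> ('a \<Rightarrow> complex) \<Rightarrow> real \<Rightarrow> 'a \<Rightarrow> complex" where
  "dyson_sol M S x t i = (\<Sum>k. dyson_vec M S x k t i)"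

text \<open>The \<open>k\<close>-th term is at most \<open>B * (A t ^ k / fact k)\<close> with
  \<open>A\<close> the integrated matrix norm, so partial sums are dominated by an exponential.
  Dominated convergence then carries the integral equation from the partial sums to the
  series.\<close>

lemma dyson_sol_primitive:
  fixes M :: "real \<Rightarrow> 'a \<Rightarrow> 'a \<Rightarrow> complex"
  assumes fin: "finite S" and T: "0 \<le> T"
    and M: "\<And>i j. i \<in> S \<Longrightarrow> j \<in> S \<Longrightarrow> (\<lambda>t. M t i j) absolutely_integrable_on {0..T}"
    and i: "i \<in> S"
  shows "primitive_on T (\<lambda>t. dyson_sol M S x t i) (\<lambda>t. - \<i> * (\<Sum>j\<in>S. M t i j * dyson_sol M S x t j))"
    and "dyson_sol M S x 0 i = x i"
proof -
  let ?d = "dyson_vec M S x"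
  \<comment> \<open>Summing over all entries gives one scalar that dominates every row, so a single
    induction bounds all components.\<close>
  define m where "m = (\<lambda>t. \<Sum>i\<in>S. \<Sum>j\<in>S. cmod (M t i j))"
  define A where "A = (\<lambda>t. integral {0..t} m)"
  define B where "B = (\<Sum>i\<in>S. cmod (x i))"
  have m0: "0 \<le> m t" for t by (simp add: m_def sum_nonneg)
  have B0: "0 \<le> B" by (simp add: B_def sum_nonneg)
  have m_int: "m absolutely_integrable_on {0..T}"
    unfolding m_def using M fin by (intro absolutely_integrable_sum set_integrable_norm) auto
  have m_i: "m integrable_on {0..t}" if "t \<le> T" for t
    by (intro set_lebesgue_integral_eq_integral(1) absolutely_integrable_on_subinterval[OF m_int])
      (use that in auto)
  have mc: "(\<lambda>t. complex_of_real (m t)) absolutely_integrable_on {0..T}"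
    using absolutely_integrable_linear[OF m_int bounded_linear_of_real[where 'a = complex]]
    by (simp add: comp_def)
  have A: "primitive_on T (\<lambda>t. of_real (A t)) (\<lambda>t. of_real (m t))"
  proof (rule primitive_onI[OF mc])
    fix t assume "0 \<le> t" "t \<le> T"
    then show "complex_of_real (A t) = of_real (A 0) + integral {0..t} (\<lambda>t. of_real (m t))"
      using integral_linear[OF m_i bounded_linear_of_real[where 'a = complex], of t]
      by (simp add: A_def comp_def)
  qed
  have A0: "A 0 = 0" by (simp add: A_def)
  \<comment> \<open>Past \<open>T\<close> the function \<open>m\<close> may fail to be integrable;
    the integral then has the default value 0.\<close>
  have A_nn: "0 \<le> A t" for t
    unfolding A_def using m0 by (cases "m integrable_on {0..t}") (auto intro: integral_nonneg simp: not_integrable_integral)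
  have A_mono: "A t \<le> A T" if "0 \<le> t" "t \<le> T" for t
    unfolding A_def using that m0 m_i by (intro integral_subset_le) auto
  have row: "(\<Sum>j\<in>S. cmod (M t i j)) \<le> m t" if "i \<in> S" for t i
    unfolding m_def using fin that
    by (intro member_le_sum[of i S "\<lambda>i. \<Sum>j\<in>S. cmod (M t i j)"]) (auto intro: sum_nonneg)
  have d_cont: "\<forall>i\<in>S. continuous_on {0..T} (\<lambda>t. ?d k t i)"
    and d_prim: "\<forall>i\<in>S. primitive_on T (\<lambda>t. ?d (Suc k) t i) (\<lambda>t. - \<i> * (\<Sum>j\<in>S. M t i j * ?d k t j))" for k
  proof -
    have step: "\<forall>i\<in>S. primitive_on T (\<lambda>t. ?d (Suc k) t i) (\<lambda>t. - \<i> * (\<Sum>j\<in>S. M t i j * ?d k t j))"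
      if c: "\<forall>i\<in>S. continuous_on {0..T} (\<lambda>t. ?d k t i)" for k
    proof
      fix i assume i: "i \<in> S"
      have *: "(\<lambda>t. \<Sum>j\<in>S. M t i j * ?d k t j) absolutely_integrable_on {0..T}"
        using fin c i M by (intro absolutely_integrable_sum absolutely_integrable_mult_continuous) auto
      have "primitive_on T (\<lambda>t. integral {0..t} (\<lambda>s. \<Sum>j\<in>S. M s i j * ?d k s j)) (\<lambda>t. \<Sum>j\<in>S. M t i j * ?d k t j)"
        by (rule primitive_onI[OF *]) simp
      from primitive_on_cmult[OF this, of "-\<i>"]
      show "primitive_on T (\<lambda>t. ?d (Suc k) t i) (\<lambda>t. - \<i> * (\<Sum>j\<in>S. M t i j * ?d k t j))"
        by simp
    qed
    have c: "\<forall>i\<in>S. continuous_on {0..T} (\<lambda>t. ?d k t i)" for k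
    proof (induction k)
      case (Suc k)
      then show ?case using step[OF Suc] primitive_on_continuous by blast
    qed simp
    show "\<forall>i\<in>S. continuous_on {0..T} (\<lambda>t. ?d k t i)" by (rule c)
    show "\<forall>i\<in>S. primitive_on T (\<lambda>t. ?d (Suc k) t i) (\<lambda>t. - \<i> * (\<Sum>j\<in>S. M t i j * ?d k t j))"
      by (rule step[OF c])
  qed
  have bound: "\<forall>i\<in>S. \<forall>t. 0 \<le> t \<longrightarrow> t \<le> T \<longrightarrow> cmod (?d k t i) \<le> B * (A t ^ k / fact k)" for k
  proof (induction k)
    case 0
    show ?case
      using fin by (auto simp: B_def intro: member_le_sum)
  next
    case (Suc k)
    show ?case
    proof (intro ballI allI impI)
      fix i t assume i: "i \<in> S" and t: "0 \<le> t" "t \<le> T"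
      \<comment> \<open>The derivative of the comparison function is the induction hypothesis times
        \<open>m\<close>, which dominates the integrand of the next term.\<close>
      define c where "c = complex_of_real (B / fact (Suc k))"
      have g: "primitive_on T (\<lambda>t. c * of_real (A t) ^ Suc k) (\<lambda>t. c * (of_nat (Suc k) * of_real (A t) ^ k * of_real (m t)))"
        by (intro primitive_on_cmult primitive_on_power_Suc A)
      have "cmod (?d (Suc k) t i - ?d (Suc k) 0 i) \<le> Re (c * of_real (A t) ^ Suc k) - Re (c * of_real (A 0) ^ Suc k)"
      proof (rule primitive_on_dominated[OF bspec[OF d_prim i] g t])
        fix s assume s: "0 \<le> s" "s \<le> t"
        have "cmod (\<Sum>j\<in>S. M s i j * ?d k s j) \<le> (\<Sum>j\<in>S. cmod (M s i j) * (B * (A s ^ k / fact k)))"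
          using Suc s t by (intro sum_norm_le) (simp add: norm_mult mult_left_mono del: times_divide_eq_right)
        also have "\<dots> = (\<Sum>j\<in>S. cmod (M s i j)) * (B * (A s ^ k / fact k))"
          by (rule sum_distrib_right[symmetric])
        also have "\<dots> \<le> m s * (B * (A s ^ k / fact k))"
          using B0 A_nn row[OF i] by (intro mult_right_mono) auto
        also have "\<dots> = B / fact (Suc k) * (real (Suc k) * A s ^ k * m s)"
          by (simp only: fact_Suc of_nat_mult) (simp del: of_nat_Suc)
        also have "\<dots> = Re (complex_of_real (B / fact (Suc k) * (real (Suc k) * A s ^ k * m s)))"
          by (rule Re_complex_of_real[symmetric])
        also have "complex_of_real (B / fact (Suc k) * (real (Suc k) * A s ^ k * m s))
            = c * (of_nat (Suc k) * of_real (A s) ^ k * of_real (m s))"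
          by (simp only: c_def of_real_mult of_real_power of_real_of_nat_eq)
        finally show "cmod (- \<i> * (\<Sum>j\<in>S. M s i j * ?d k s j)) \<le> Re (c * (of_nat (Suc k) * of_real (A s) ^ k * of_real (m s)))"
          by (simp add: norm_mult)
      qed
      moreover have "Re (c * of_real (A t) ^ Suc k) = B * (A t ^ Suc k / fact (Suc k))"
        by (simp only: c_def Re_complex_of_real flip: of_real_power of_real_mult) simp
      ultimately show "cmod (?d (Suc k) t i) \<le> B * (A t ^ Suc k / fact (Suc k))"
        by (simp add: A0 del: fact_Suc)
    qed
  qed
  have exp_sums: "(\<lambda>k. B * (a ^ k / fact k)) sums (B * exp a)" for a :: real
    using sums_mult[OF exp_converges[of a], of B] by (simp add: divide_inverse mult_ac)
  have sums: "(\<lambda>k. ?d k t i) sums dyson_sol M S x t i" if "i \<in> S" "0 \<le> t" "t \<le> T" for i t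
    unfolding dyson_sol_def
    by (intro summable_sums summable_comparison_test'[where N = 0, OF sums_summable[OF exp_sums[of "A t"]]])
      (use bound that in auto)
  have part: "cmod (\<Sum>k<K. ?d k t i) \<le> B * exp (A T)" if "i \<in> S" "0 \<le> t" "t \<le> T" for i t K
  proof -
    have "cmod (\<Sum>k<K. ?d k t i) \<le> (\<Sum>k<K. B * (A t ^ k / fact k))"
      using bound that by (intro sum_norm_le) auto
    also have "\<dots> \<le> B * exp (A t)"
      using exp_sums[of "A t"] B0 A_nn by (intro sum_le_suminf[THEN order_trans])
        (auto simp: sums_iff)
    also have "\<dots> \<le> B * exp (A T)"
      using A_mono that B0 by (intro mult_left_mono) auto
    finally show ?thesis .
  qed
  define f where "f = (\<lambda>K t. \<Sum>j\<in>S. M t i j * (\<Sum>k<K. ?d k t j))"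
  define g where "g = (\<lambda>t. \<Sum>j\<in>S. M t i j * dyson_sol M S x t j)"
  have f_int: "f K absolutely_integrable_on {0..T}" for K
    unfolding f_def using M i fin d_cont
    by (intro absolutely_integrable_sum absolutely_integrable_mult_continuous continuous_intros) auto
  have f_le: "norm (f K t) \<le> m t * (B * exp (A T))" if "t \<in> {0..T}" for K t
  proof -
    have "norm (f K t) \<le> (\<Sum>j\<in>S. cmod (M t i j) * (B * exp (A T)))"
      unfolding f_def using part that by (intro sum_norm_le) (auto simp: norm_mult intro!: mult_left_mono)
    also have "\<dots> \<le> m t * (B * exp (A T))"
      using B0 row[OF i] by (simp add: mult_right_mono flip: sum_distrib_right)
    finally show ?thesis .
  qed
  have f_lim: "(\<lambda>K. f K t) \<longlonglongrightarrow> g t" if "t \<in> {0..T}" for t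
    unfolding f_def g_def using sums that
    by (intro tendsto_sum tendsto_mult tendsto_const) (auto simp: sums_def)
  have h_int: "(\<lambda>t. m t * (B * exp (A T))) integrable_on {0..t}" if "t \<le> T" for t
    using m_i[OF that] by (rule integrable_on_mult_left)
  have sub: "f K integrable_on {0..t}" if "t \<le> T" for K t
    using f_int[of K] that
    by (intro set_lebesgue_integral_eq_integral(1)) (auto intro: absolutely_integrable_on_subinterval)
  have g_int: "g absolutely_integrable_on {0..T}"
  proof (rule dominated_convergence_absolutely_integrable[OF f_int h_int _ f_lim])
    show "norm (g t) \<le> m t * (B * exp (A T))" if "t \<in> {0..T}" for t
      by (rule LIMSEQ_le_const2[OF tendsto_norm[OF f_lim[OF that]]]) (use f_le that in auto)
  qed simp_all
  have eq: "dyson_sol M S x t i = x i + - \<i> * integral {0..t} g" if t: "0 \<le> t" "t \<le> T" for t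
  proof -
    have "(\<lambda>K. integral {0..t} (f K)) \<longlonglongrightarrow> integral {0..t} g"
      by (rule dominated_convergence(2)[OF sub h_int]) (use f_le f_lim t in auto)
    then have "(\<lambda>K. x i + - \<i> * integral {0..t} (f K)) \<longlonglongrightarrow> x i + - \<i> * integral {0..t} g"
      by (intro tendsto_intros)
    \<comment> \<open>The recursion raises the index by one, so integrating \<open>K\<close> terms
      reproduces the partial sum with \<open>Suc K\<close> terms.\<close>
    moreover have "x i + - \<i> * integral {0..t} (f K) = (\<Sum>k<Suc K. ?d k t i)" for K
    proof -
      have "integral {0..t} (\<lambda>s. \<Sum>k<K. \<Sum>j\<in>S. M s i j * ?d k s j)
        = (\<Sum>k<K. integral {0..t} (\<lambda>s. \<Sum>j\<in>S. M s i j * ?d k s j))"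
      proof (rule Henstock_Kurzweil_Integration.integral_sum)
        fix k
        have "(\<lambda>t. \<Sum>j\<in>S. M t i j * ?d k t j) absolutely_integrable_on {0..T}"
          using fin d_cont i M
          by (intro absolutely_integrable_sum absolutely_integrable_mult_continuous) auto
        then show "(\<lambda>s. \<Sum>j\<in>S. M s i j * ?d k s j) integrable_on {0..t}"
          using t by (intro set_lebesgue_integral_eq_integral(1)) (auto intro: absolutely_integrable_on_subinterval)
      qed simp
      moreover have "f K = (\<lambda>s. \<Sum>k<K. \<Sum>j\<in>S. M s i j * ?d k s j)"
        unfolding f_def by (subst sum.swap) (simp add: sum_distrib_left)
      ultimately show ?thesis
        by (simp add: sum.lessThan_Suc_shift sum_distrib_left del: sum.lessThan_Suc)
    qed
    ultimately have "(\<lambda>K. \<Sum>k<Suc K. ?d k t i) \<longlonglongrightarrow> x i + - \<i> * integral {0..t} g"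
      by simp
    moreover have "(\<lambda>K. \<Sum>k<Suc K. ?d k t i) \<longlonglongrightarrow> dyson_sol M S x t i"
      using sums[OF i t] unfolding sums_def by (rule LIMSEQ_Suc)
    ultimately show ?thesis by (rule LIMSEQ_unique[symmetric])
  qed
  show init: "dyson_sol M S x 0 i = x i"
    using eq[of 0] T by simp
  have "primitive_on T (\<lambda>t. integral {0..t} g) g"
    by (rule primitive_onI[OF g_int]) simp
  then have "primitive_on T (\<lambda>t. x i + - \<i> * integral {0..t} g) (\<lambda>t. 0 + - \<i> * g t)"
    by (intro primitive_on_add primitive_on_cmult primitive_on_const)
  then show "primitive_on T (\<lambda>t. dyson_sol M S x t i) (\<lambda>t. - \<i> * (\<Sum>j\<in>S. M t i j * dyson_sol M S x t j))"
    by (rule primitive_on_cong) (auto simp: eq g_def)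
qed

section \<open>Lattice sums and Schur's test\<close>

text \<open>Dyadic shells: the ball of radius 2^(l+1) r holds O((2^l r)^D) sites, each contributing
  at most (2^l r)^(-s), which leaves a geometric series of ratio 2^(D-s).\<close>

lemma finite_lattice_tail:
  assumes lat: "finite_lattice D \<kappa> \<Lambda> d" and i: "i \<in> \<Lambda>" and r: "r > 0" and s: "s > real D"
  shows "(\<Sum>j | j \<in> \<Lambda> \<and> j \<noteq> i \<and> r < d i j. d i j powr (- s))
    \<le> \<kappa> * 2 ^ D / (1 - 2 powr (real D - s)) * r powr (real D - s)"
proof -
  let ?S = "{j \<in> \<Lambda>. j \<noteq> i \<and> r < d i j}"
  have fin: "finite \<Lambda>" and card: "\<And>r. r > 0 \<Longrightarrow> real (card {j \<in> \<Lambda>. j \<noteq> i \<and> d i j \<le> r}) \<le> \<kappa> * r ^ D"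
    using lat i by (auto simp: finite_lattice_def)
  have \<kappa>: "0 \<le> \<kappa>" using card[of 1] by simp
  define u where "u = 2 powr (real D - s)"
  have u: "0 < u" "u < 1"
    using s by (auto simp: u_def powr_less_one)
  have "\<exists>k. 2 ^ k * r < d i j \<and> d i j \<le> 2 ^ Suc k * r" if "j \<in> ?S" for j
  proof -
    obtain n where n: "d i j / r < 2 ^ n" using real_arch_pow[of 2 "d i j / r"] by auto
    define k where "k = (LEAST k. d i j \<le> 2 ^ Suc k * r)"
    have "d i j \<le> 2 ^ Suc n * r"
    proof -
      have "d i j < 2 ^ n * r" using n r by (simp add: field_simps)
      also have "\<dots> \<le> 2 ^ Suc n * r" using r by simp
      finally show ?thesis by simp
    qed
    then have k: "d i j \<le> 2 ^ Suc k * r" unfolding k_def by (rule LeastI)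
    have "2 ^ k * r < d i j"
    proof (cases k)
      case 0 then show ?thesis using that by simp
    next
      case (Suc l)
      then have "\<not> d i j \<le> 2 ^ Suc l * r" using not_less_Least[of l "\<lambda>k. d i j \<le> 2 ^ Suc k * r"]
        by (simp add: k_def)
      then show ?thesis using Suc by simp
    qed
    with k show ?thesis by blast
  qed
  then obtain k where k: "\<And>j. j \<in> ?S \<Longrightarrow> 2 ^ k j * r < d i j \<and> d i j \<le> 2 ^ Suc (k j) * r"
    by metis
  \<comment> \<open>Any number above all shell indices would do; it keeps the sum over shells
    finite.\<close>
  define K where "K = Suc (sum k ?S)"
  have kK: "k j < K" if "j \<in> ?S" for j
    unfolding K_def using fin that by (intro le_imp_less_Suc member_le_sum) auto
  \<comment> \<open>A site is charged to every dyadic ball that contains it, not just to its own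
    shell. The overcounting is harmless and lets the cardinality bound apply directly.\<close>
  define g where "g = (\<lambda>l j. if d i j \<le> 2 ^ Suc l * r then (2 ^ l * r) powr (- s) else 0)"
  have "(\<Sum>j\<in>?S. d i j powr (- s)) \<le> (\<Sum>j\<in>?S. \<Sum>l<K. g l j)"
  proof (rule sum_mono)
    fix j assume j: "j \<in> ?S"
    have "d i j powr (- s) \<le> (2 ^ k j * r) powr (- s)"
      using k[OF j] r s by (intro powr_mono2') auto
    also have "\<dots> = g (k j) j" using k[OF j] by (simp add: g_def)
    also have "\<dots> \<le> (\<Sum>l<K. g l j)"
      using kK[OF j] by (intro member_le_sum) (auto simp: g_def)
    finally show "d i j powr (- s) \<le> (\<Sum>l<K. g l j)" .
  qed
  also have "\<dots> = (\<Sum>l<K. \<Sum>j\<in>?S. g l j)" by (rule sum.swap)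
  also have "\<dots> \<le> (\<Sum>l<K. \<kappa> * 2 ^ D * r powr (real D - s) * u ^ l)"
  proof (rule sum_mono)
    fix l
    let ?B = "{j \<in> \<Lambda>. j \<noteq> i \<and> d i j \<le> 2 ^ Suc l * r}"
    have "(\<Sum>j\<in>?S. g l j) = (\<Sum>j\<in>?S \<inter> ?B. (2 ^ l * r) powr (- s))"
      using fin by (intro sum.mono_neutral_cong_right) (auto simp: g_def)
    also have "\<dots> \<le> real (card ?B) * (2 ^ l * r) powr (- s)"
      using fin by (simp add: mult_right_mono card_mono)
    also have "\<dots> \<le> (\<kappa> * (2 ^ Suc l * r) ^ D) * (2 ^ l * r) powr (- s)"
      using r by (intro mult_right_mono card) auto
    also have "\<dots> = \<kappa> * 2 ^ D * ((2 ^ l * r) ^ D * (2 ^ l * r) powr (- s))"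
      by (simp add: power_mult_distrib)
    also have "(2 ^ l * r) ^ D * (2 ^ l * r) powr (- s) = (2 ^ l * r) powr (real D - s)"
      using r by (simp add: powr_diff powr_minus_divide powr_realpow)
    also have "\<dots> = r powr (real D - s) * u ^ l"
      using r by (simp add: powr_mult u_def powr_powr mult.commute flip: powr_realpow)
    finally show "(\<Sum>j\<in>?S. g l j) \<le> \<kappa> * 2 ^ D * r powr (real D - s) * u ^ l" by (simp add: mult_ac)
  qed
  also have "\<dots> = \<kappa> * 2 ^ D * r powr (real D - s) * (\<Sum>l<K. u ^ l)"
    by (simp add: sum_distrib_left)
  also have "\<dots> \<le> \<kappa> * 2 ^ D * r powr (real D - s) * (1 / (1 - u))"
  proof (rule mult_left_mono)
    show "(\<Sum>l<K. u ^ l) \<le> 1 / (1 - u)"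
      using u by (simp add: sum_gp_strict divide_right_mono)
  qed (use \<kappa> in auto)
  finally show ?thesis by (simp add: u_def mult_ac)
qed

lemma finite_lattice_sum_bound:
  assumes "D \<ge> 1" "\<kappa> > 0" "s > real D"
  obtains c where "c > 0"
    and "\<And>\<Lambda> d i. finite_lattice D \<kappa> \<Lambda> d \<Longrightarrow> i \<in> \<Lambda> \<Longrightarrow> (\<Sum>j\<in>\<Lambda> - {i}. d i j powr (- s)) \<le> c"
proof
  \<comment> \<open>With \<kappa> r^D = 1/2 a ball of radius \<open>r\<close> holds at most half a
    site besides its centre, hence none. This uniform spacing turns the tail bound into a bound on
    the full sum.\<close>
  define r where "r = (1 / (2 * \<kappa>)) powr (1 / real D)"
  define c where "c = \<kappa> * 2 ^ D / (1 - 2 powr (real D - s)) * r powr (real D - s)"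
  have r: "r > 0" using assms by (simp add: r_def)
  have rD: "\<kappa> * r ^ D = 1 / 2"
    using assms by (simp add: r_def powr_powr flip: powr_realpow)
  have u: "2 powr (real D - s) < 1" using assms by (auto simp: powr_less_one)
  show "c > 0"
    using assms r u by (simp add: c_def)
  fix \<Lambda> d i assume lat: "finite_lattice D \<kappa> \<Lambda> d" and i: "i \<in> \<Lambda>"
  have fin: "finite \<Lambda>" using lat by (simp add: finite_lattice_def)
  have "real (card {j \<in> \<Lambda>. j \<noteq> i \<and> d i j \<le> r}) \<le> 1 / 2"
    using lat i r rD by (force simp: finite_lattice_def)
  then have "card {j \<in> \<Lambda>. j \<noteq> i \<and> d i j \<le> r} = 0" by linarith
  then have "\<Lambda> - {i} = {j \<in> \<Lambda>. j \<noteq> i \<and> r < d i j}"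
    using fin by (auto simp: not_le)
  then show "(\<Sum>j\<in>\<Lambda> - {i}. d i j powr (- s)) \<le> c"
    using finite_lattice_tail[OF lat i r assms(3)] by (simp add: c_def)
qed

text \<open>The inequality of the means separates the two sites, after which each half needs only a
  row sum or a column sum.\<close>

lemma schur_form:
  fixes K :: "'a \<Rightarrow> 'a \<Rightarrow> real"
  assumes "\<And>i j. i \<in> I \<Longrightarrow> j \<in> I \<Longrightarrow> 0 \<le> K i j"
    and row: "\<And>i. i \<in> I \<Longrightarrow> (\<Sum>j\<in>I. K i j) \<le> c" and col: "\<And>j. j \<in> I \<Longrightarrow> (\<Sum>i\<in>I. K i j) \<le> c"
  shows "(\<Sum>i\<in>I. \<Sum>j\<in>I. K i j * (a i * a j)) \<le> c * (\<Sum>i\<in>I. (a i)\<^sup>2)"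
proof -
  have "(\<Sum>i\<in>I. \<Sum>j\<in>I. K i j * (a i * a j)) \<le> (\<Sum>i\<in>I. \<Sum>j\<in>I. K i j * (((a i)\<^sup>2 + (a j)\<^sup>2) / 2))"
  proof (intro sum_mono mult_left_mono)
    fix i j show "a i * a j \<le> ((a i)\<^sup>2 + (a j)\<^sup>2) / 2"
      using sum_squares_bound[of "a i" "a j"] by simp
  qed (use assms in auto)
  also have "\<dots> = (\<Sum>i\<in>I. (\<Sum>j\<in>I. K i j) * (a i)\<^sup>2) / 2 + (\<Sum>j\<in>I. (\<Sum>i\<in>I. K i j) * (a j)\<^sup>2) / 2"
    unfolding sum_distrib_right
    by (subst (3) sum.swap) (simp add: add_divide_distrib distrib_left sum.distrib flip: sum_divide_distrib)
  also have "\<dots> \<le> (\<Sum>i\<in>I. c * (a i)\<^sup>2) / 2 + (\<Sum>j\<in>I. c * (a j)\<^sup>2) / 2"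
    by (intro add_mono divide_right_mono sum_mono mult_right_mono row col) auto
  finally show ?thesis by (simp add: sum_distrib_left)
qed

text \<open>Splitting \<open>K\<close> into two square roots before Cauchy-Schwarz spends one factor
  on a column sum; after exchanging the sums, the row sums take the other.\<close>

lemma schur_norm:
  fixes K :: "'a \<Rightarrow> 'a \<Rightarrow> real"
  assumes K: "\<And>i j. i \<in> I \<Longrightarrow> j \<in> I \<Longrightarrow> 0 \<le> K i j"
    and row: "\<And>i. i \<in> I \<Longrightarrow> (\<Sum>j\<in>I. K i j) \<le> c" and col: "\<And>j. j \<in> I \<Longrightarrow> (\<Sum>i\<in>I. K i j) \<le> c"
  shows "(\<Sum>j\<in>I. (\<Sum>i\<in>I. K i j * a i)\<^sup>2) \<le> c\<^sup>2 * (\<Sum>i\<in>I. (a i)\<^sup>2)"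
proof (cases "I = {}")
  case False
  have c: "0 \<le> c"
    using False K row by (metis all_not_in_conv order_trans sum_nonneg)
  have "(\<Sum>j\<in>I. (\<Sum>i\<in>I. K i j * a i)\<^sup>2) \<le> (\<Sum>j\<in>I. c * (\<Sum>i\<in>I. K i j * (a i)\<^sup>2))"
  proof (rule sum_mono)
    fix j assume j: "j \<in> I"
    have "(\<Sum>i\<in>I. K i j * a i)\<^sup>2 = (\<Sum>i\<in>I. sqrt (K i j) * (sqrt (K i j) * a i))\<^sup>2"
      using K j by (intro arg_cong[of _ _ "\<lambda>x. x\<^sup>2"] sum.cong) (auto simp flip: mult.assoc)
    also have "\<dots> \<le> (\<Sum>i\<in>I. (sqrt (K i j))\<^sup>2) * (\<Sum>i\<in>I. (sqrt (K i j) * a i)\<^sup>2)"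
      by (rule Cauchy_Schwarz_ineq_sum)
    also have "\<dots> = (\<Sum>i\<in>I. K i j) * (\<Sum>i\<in>I. K i j * (a i)\<^sup>2)"
      using K j by (simp add: power_mult_distrib)
    also have "\<dots> \<le> c * (\<Sum>i\<in>I. K i j * (a i)\<^sup>2)"
      using K j by (intro mult_right_mono col sum_nonneg) auto
    finally show "(\<Sum>i\<in>I. K i j * a i)\<^sup>2 \<le> c * (\<Sum>i\<in>I. K i j * (a i)\<^sup>2)" .
  qed
  also have "\<dots> = c * (\<Sum>i\<in>I. (\<Sum>j\<in>I. K i j) * (a i)\<^sup>2)"
    unfolding sum_distrib_right by (subst sum.swap) (simp add: sum_distrib_left)
  also have "\<dots> \<le> c * (\<Sum>i\<in>I. c * (a i)\<^sup>2)"
    using c by (intro mult_left_mono sum_mono mult_right_mono row) auto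
  finally show ?thesis by (simp add: power2_eq_square sum_distrib_left mult_ac)
qed simp

section \<open>Truncated powers\<close>

text \<open>If the points agree up to a factor two, the mean value theorem applies; otherwise their
  difference is comparable to the larger one. The first term carries the geometric mean of x^(p-1)
  and y^(p-1), because Schur's test takes a product with one factor per site.\<close>

lemma abs_powr_diff_le:
  fixes x y p :: real
  assumes p: "1 \<le> p" and x: "0 \<le> x" and y: "0 \<le> y"
  shows "\<bar>x powr p - y powr p\<bar> \<le>
    p * 2 powr p * (\<bar>x - y\<bar> * (x powr ((p - 1) / 2) * y powr ((p - 1) / 2))) + 2 powr p * \<bar>x - y\<bar> powr p"
  using x y
proof (induction x y rule: linorder_wlog)
  case (sym x y)
  then show ?case by (simp add: abs_minus_commute mult.commute)
next
  case (le y x)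
  then have yx: "0 \<le> y" "y \<le> x" by auto
  let ?s = "\<lambda>z :: real. z powr ((p - 1) / 2)"
  have mono: "y powr p \<le> x powr p" using yx p by (intro powr_mono2) auto
  have "x powr p - y powr p \<le> p * 2 powr p * ((x - y) * (?s x * ?s y)) + 2 powr p * (x - y) powr p"
  proof (cases "x \<le> 2 * y")
    case True
    have "x powr p - y powr p \<le> p * 2 powr p * ((x - y) * (?s x * ?s y))"
    proof (cases "y < x")
      case yx': True
      then have y0: "0 < y" using True yx by linarith
      have "\<exists>z. y < z \<and> z < x \<and> x powr p - y powr p = (x - y) * (p * z powr (p - 1))"
      proof (rule MVT2[OF yx'])
        fix z assume "y \<le> z" "z \<le> x"
        then show "((\<lambda>z. z powr p) has_real_derivative p * z powr (p - 1)) (at z)"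
          using y0 by (intro has_real_derivative_powr) auto
      qed
      then obtain z where z: "y < z" "z < x" "x powr p - y powr p = (x - y) * (p * z powr (p - 1))"
        by blast
      have "z powr (p - 1) \<le> x powr (p - 1)"
        using z y0 p by (intro powr_mono2) auto
      also have "\<dots> = ?s x * ?s x" by (simp flip: powr_add)
      also have "\<dots> \<le> ?s x * (2 powr p * ?s y)"
      proof (rule mult_left_mono)
        have "?s x \<le> ?s (2 * y)" using True yx p by (intro powr_mono2) auto
        also have "\<dots> = ?s 2 * ?s y" using y0 by (simp add: powr_mult)
        also have "\<dots> \<le> 2 powr p * ?s y" using p by (intro mult_right_mono powr_mono) auto
        finally show "?s x \<le> 2 powr p * ?s y" .
      qed simp
      finally have "(x - y) * (p * z powr (p - 1)) \<le> (x - y) * (p * (?s x * (2 powr p * ?s y)))"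
        using yx p by (intro mult_left_mono) auto
      then show ?thesis using z by (simp add: mult_ac)
    qed (use yx in auto)
    then show ?thesis
      by (smt (verit) mult_nonneg_nonneg powr_ge_zero)
  next
    case False
    have "x powr p - y powr p \<le> x powr p" by simp
    also have "\<dots> \<le> (2 * (x - y)) powr p"
      using False yx p by (intro powr_mono2) auto
    also have "\<dots> = 2 powr p * (x - y) powr p" by (rule powr_mult)
    also have "\<dots> \<le> p * 2 powr p * ((x - y) * (?s x * ?s y)) + 2 powr p * (x - y) powr p"
      using yx p by simp
    finally show ?thesis .
  qed
  moreover have "\<bar>y powr p - x powr p\<bar> = x powr p - y powr p" "\<bar>y - x\<bar> = x - y"
    using mono yx by auto
  ultimately show ?case by (simp only: mult.commute[of "?s y"])
qed

text \<open>Away from 0 the function agrees locally with 0 or with a power. At the kink the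
  difference quotient is at most |h|^(p-1), which tends to 0 because p > 1.\<close>

lemma has_derivative_pos_part_powr:
  fixes p :: real
  assumes p: "1 < p"
  shows "((\<lambda>x. max 0 x powr p) has_real_derivative p * max 0 x powr (p - 1)) (at x)"
proof (cases x "0 :: real" rule: linorder_cases)
  case less
  have "\<forall>\<^sub>F y in nhds x. max 0 y powr p = 0"
    by (rule eventually_mono[OF eventually_nhds_in_open[of "{..<0}" x]]) (use less in auto)
  moreover have "((\<lambda>x. 0) has_real_derivative p * max 0 x powr (p - 1)) (at x)"
    using less by simp
  ultimately show ?thesis
    using DERIV_cong_ev[OF refl _ refl, where x = x and f = "\<lambda>y. max 0 y powr p" and g = "\<lambda>y. 0"]
    by blast
next
  case greater
  have "\<forall>\<^sub>F y in nhds x. max 0 y powr p = y powr p"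
    by (rule eventually_mono[OF eventually_nhds_in_open[of "{0<..}" x]]) (use greater in auto)
  moreover have "((\<lambda>x. x powr p) has_real_derivative p * max 0 x powr (p - 1)) (at x)"
    using greater has_real_derivative_powr[of x p] by simp
  ultimately show ?thesis
    using DERIV_cong_ev[OF refl _ refl, where x = x and f = "\<lambda>y. max 0 y powr p"
        and g = "\<lambda>y. y powr p"]
    by blast
next
  case equal
  have "((\<lambda>h. max 0 h powr p / h) \<longlongrightarrow> 0) (at 0)"
  proof (rule Lim_null_comparison)
    show "\<forall>\<^sub>F h in at 0. norm (max 0 h powr p / h) \<le> \<bar>h\<bar> powr (p - 1)"
      using p by (intro always_eventually) (auto simp: max_def powr_diff intro: divide_nonneg_neg)
    have "((\<lambda>h :: real. \<bar>h\<bar> powr (p - 1)) \<longlongrightarrow> \<bar>0\<bar> powr (p - 1)) (at 0)"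
      using p by (intro tendsto_powr' tendsto_intros) auto
    then show "((\<lambda>h :: real. \<bar>h\<bar> powr (p - 1)) \<longlongrightarrow> 0) (at 0)" by simp
  qed
  then show ?thesis
    using equal p by (simp add: DERIV_def)
qed

section \<open>Transport of a single particle\<close>

text \<open>For Hermitian \<open>M\<close>, exchanging the site indices in one of the two conjugate
  terms turns the weight into the difference \<open>G t i - G t k\<close>. Constant weights are
  therefore conserved, on-site terms drop out, and only the variation of the weight along a hop
  matters.\<close>

lemma weighted_norm_primitive:
  fixes y :: "real \<Rightarrow> 'a \<Rightarrow> complex" and G G' :: "real \<Rightarrow> 'a \<Rightarrow> real"
  assumes y: "\<And>i. i \<in> I \<Longrightarrow> primitive_on T (\<lambda>t. y t i) (\<lambda>t. - \<i> * (\<Sum>k\<in>I. M t i k * y t k))"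
    and herm: "\<And>t i k. 0 \<le> t \<Longrightarrow> t \<le> T \<Longrightarrow> i \<in> I \<Longrightarrow> k \<in> I \<Longrightarrow> M t k i = cnj (M t i k)"
    and G: "\<And>i. i \<in> I \<Longrightarrow> primitive_on T (\<lambda>t. of_real (G t i)) (\<lambda>t. of_real (G' t i))"
  shows "primitive_on T (\<lambda>t. of_real (\<Sum>i\<in>I. G t i * (cmod (y t i))\<^sup>2))
    (\<lambda>t. \<Sum>i\<in>I. of_real (G' t i * (cmod (y t i))\<^sup>2) +
        (\<Sum>k\<in>I. of_real (G t i - G t k) * (- \<i> * cnj (y t i) * M t i k * y t k)))"
proof -
  let ?y' = "\<lambda>t i. - \<i> * (\<Sum>k\<in>I. M t i k * y t k)"
  have sq: "complex_of_real ((cmod z)\<^sup>2) = cnj z * z" for z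
    by (metis complex_norm_square mult.commute)
  have "primitive_on T (\<lambda>t. \<Sum>i\<in>I. of_real (G t i) * (cnj (y t i) * y t i))
    (\<lambda>t. \<Sum>i\<in>I. of_real (G' t i) * (cnj (y t i) * y t i)
        + of_real (G t i) * (cnj (?y' t i) * y t i + cnj (y t i) * ?y' t i))"
    by (intro primitive_on_sum primitive_on_mult primitive_on_cnj y G)
  then show ?thesis
  proof (rule primitive_on_cong)
    fix t assume t: "0 \<le> t" "t \<le> T"
    show "(\<Sum>i\<in>I. of_real (G t i) * (cnj (y t i) * y t i)) = of_real (\<Sum>i\<in>I. G t i * (cmod (y t i))\<^sup>2)"
      by (simp only: of_real_sum of_real_mult sq)
    have "(\<Sum>i\<in>I. of_real (G t i) * (cnj (?y' t i) * y t i))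
        = (\<Sum>i\<in>I. \<Sum>k\<in>I. of_real (G t i) * (\<i> * M t k i * cnj (y t k) * y t i))"
    proof (rule sum.cong[OF refl])
      fix i assume i: "i \<in> I"
      have "cnj (?y' t i) = (\<Sum>k\<in>I. \<i> * M t k i * cnj (y t k))"
        using t i by (simp add: sum_distrib_left herm[symmetric] mult.assoc)
      then show "of_real (G t i) * (cnj (?y' t i) * y t i)
          = (\<Sum>k\<in>I. of_real (G t i) * (\<i> * M t k i * cnj (y t k) * y t i))"
        by (simp only: sum_distrib_left sum_distrib_right)
    qed
    also have "\<dots> = (\<Sum>i\<in>I. \<Sum>k\<in>I. of_real (G t k) * (\<i> * M t i k * cnj (y t i) * y t k))"
      by (rule sum.swap)
    finally have 1: "(\<Sum>i\<in>I. of_real (G t i) * (cnj (?y' t i) * y t i)) = \<dots>" .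
    have 2: "(\<Sum>i\<in>I. of_real (G t i) * (cnj (y t i) * ?y' t i))
        = (\<Sum>i\<in>I. \<Sum>k\<in>I. of_real (G t i) * (- \<i> * cnj (y t i) * M t i k * y t k))"
      by (simp add: sum_distrib_left sum_negf mult_ac)
    have 3: "(\<Sum>i\<in>I. \<Sum>k\<in>I. of_real (G t i - G t k) * (- \<i> * cnj (y t i) * M t i k * y t k))
        = (\<Sum>i\<in>I. \<Sum>k\<in>I. of_real (G t k) * (\<i> * M t i k * cnj (y t i) * y t k))
        + (\<Sum>i\<in>I. \<Sum>k\<in>I. of_real (G t i) * (- \<i> * cnj (y t i) * M t i k * y t k))"
      unfolding sum.distrib[symmetric] by (intro sum.cong refl) (simp add: algebra_simps)
    show "(\<Sum>i\<in>I. of_real (G' t i) * (cnj (y t i) * y t i)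
          + of_real (G t i) * (cnj (?y' t i) * y t i + cnj (y t i) * ?y' t i))
        = (\<Sum>i\<in>I. of_real (G' t i * (cmod (y t i))\<^sup>2) +
        (\<Sum>k\<in>I. of_real (G t i - G t k) * (- \<i> * cnj (y t i) * M t i k * y t k)))"
      unfolding sum.distrib distrib_left 1 2 3 by (simp only: of_real_mult sq)
  qed
qed

locale hopping =
  fixes \<Lambda> :: "nat set" and d :: "nat \<Rightarrow> nat \<Rightarrow> real" and J :: real
  assumes finite_sites: "finite \<Lambda>" and metric: "Metric_space \<Lambda> d" and J: "0 \<le> J"
begin

lemma dist_commute: "d i j = d j i"
  using metric by (rule Metric_space.commute)

lemma dist_pos: "i \<in> \<Lambda> \<Longrightarrow> j \<in> \<Lambda> \<Longrightarrow> i \<noteq> j \<Longrightarrow> 0 < d i j"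
  using Metric_space.mdist_pos_less[OF metric] by blast

lemma dist_triangle: "i \<in> \<Lambda> \<Longrightarrow> j \<in> \<Lambda> \<Longrightarrow> k \<in> \<Lambda> \<Longrightarrow> d i k \<le> d i j + d j k"
  using metric by (rule Metric_space.triangle)

text \<open>The diagonal is zero because on-site matrix elements obey no decay bound; they cancel
  wherever the kernel is applied.\<close>

definition kernel :: "real \<Rightarrow> nat \<Rightarrow> nat \<Rightarrow> real" where
  "kernel s i j = (if i = j then 0 else d i j powr (- s))"

lemma kernel_nonneg: "0 \<le> kernel s i j"
  by (simp add: kernel_def)

lemma kernel_sym: "kernel s i j = kernel s j i"
  using dist_commute[of i j] by (auto simp: kernel_def)

lemma kernel_row: "i \<in> \<Lambda> \<Longrightarrow> (\<Sum>j\<in>\<Lambda>. kernel s i j) = (\<Sum>j\<in>\<Lambda> - {i}. d i j powr (- s))"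
  using finite_sites by (simp add: sum.remove[of \<Lambda> i] kernel_def)

lemma kernel_col: "j \<in> \<Lambda> \<Longrightarrow> (\<Sum>i\<in>\<Lambda>. kernel s i j) = (\<Sum>i\<in>\<Lambda> - {j}. d j i powr (- s))"
  by (subst kernel_sym) (rule kernel_row)

end

text \<open>\<open>M\<close> is kept abstract because it will be the truncated matrix, transposed
  and reversed in time, on an interval that ends at the observation time.\<close>

locale one_particle = hopping +
  fixes \<alpha> T :: real and M :: "real \<Rightarrow> nat \<Rightarrow> nat \<Rightarrow> complex" and y :: "real \<Rightarrow> nat \<Rightarrow> complex" and q :: nat
  assumes q: "q \<in> \<Lambda>"
    and y: "\<And>i. i \<in> \<Lambda> \<Longrightarrow> primitive_on T (\<lambda>t. y t i) (\<lambda>t. - \<i> * (\<Sum>k\<in>\<Lambda>. M t i k * y t k))"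
    and y0: "\<And>i. i \<in> \<Lambda> \<Longrightarrow> y 0 i = (if i = q then 1 else 0)"
    and herm: "\<And>t i k. 0 \<le> t \<Longrightarrow> t \<le> T \<Longrightarrow> i \<in> \<Lambda> \<Longrightarrow> k \<in> \<Lambda> \<Longrightarrow> M t k i = cnj (M t i k)"
    and M: "\<And>t i k. 0 \<le> t \<Longrightarrow> t \<le> T \<Longrightarrow> i \<in> \<Lambda> \<Longrightarrow> k \<in> \<Lambda> \<Longrightarrow> i \<noteq> k \<Longrightarrow> cmod (M t i k) \<le> J * d i k powr (- \<alpha>)"
begin

lemma norm_one:
  assumes t: "0 \<le> t" "t \<le> T"
  shows "(\<Sum>i\<in>\<Lambda>. (cmod (y t i))\<^sup>2) = 1"
proof -
  have "primitive_on T (\<lambda>t. of_real (\<Sum>i\<in>\<Lambda>. 1 * (cmod (y t i))\<^sup>2))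
    (\<lambda>t. \<Sum>i\<in>\<Lambda>. of_real (0 * (cmod (y t i))\<^sup>2) +
        (\<Sum>k\<in>\<Lambda>. of_real (1 - 1) * (- \<i> * cnj (y t i) * M t i k * y t k)))"
    by (rule weighted_norm_primitive[OF y herm]) simp_all
  from primitive_on_eq[OF this t]
  have "complex_of_real (\<Sum>i\<in>\<Lambda>. (cmod (y t i))\<^sup>2) = of_real (\<Sum>i\<in>\<Lambda>. (cmod (y 0 i))\<^sup>2)"
    by (simp del: of_real_sum)
  also have "(\<Sum>i\<in>\<Lambda>. (cmod (y 0 i))\<^sup>2) = (\<Sum>i\<in>\<Lambda>. if i = q then 1 else 0)"
    by (intro sum.cong) (auto simp: y0)
  also have "\<dots> = 1" using finite_sites q by simp
  finally show ?thesis by (simp only: of_real_eq_iff)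
qed

text \<open>The weight \<open>(d(i,q) - v t)\<^sub>+\<^sup>p\<close> recedes at speed \<open>v\<close>; for \<open>v\<close> large its decrease absorbs all of
  the short-range hopping, and only jumps of length comparable to the weight itself contribute.\<close>

lemma transport:
  fixes p v :: real
  assumes p: "1 < p"
    and K1: "\<And>i. i \<in> \<Lambda> \<Longrightarrow> (\<Sum>j\<in>\<Lambda> - {i}. d i j powr (- (\<alpha> - 1))) \<le> K1"
    and Kp: "\<And>i. i \<in> \<Lambda> \<Longrightarrow> (\<Sum>j\<in>\<Lambda> - {i}. d i j powr (- (\<alpha> - p))) \<le> Kp"
    and v: "2 powr p * J * K1 \<le> v" and t: "0 \<le> t" "t \<le> T"
  shows "(\<Sum>i\<in>\<Lambda>. max 0 (d i q - v * t) powr p * (cmod (y t i))\<^sup>2) \<le> 2 powr p * J * Kp * t"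
proof -
  let ?a = "\<lambda>t i. max 0 (d i q - v * t)"
  define G where "G = (\<lambda>t i. ?a t i powr p)"
  define G' where "G' = (\<lambda>t i. p * ?a t i powr (p - 1) * - v)"
  define g where "g = (\<lambda>t. \<Sum>i\<in>\<Lambda>. of_real (G' t i * (cmod (y t i))\<^sup>2) +
        (\<Sum>k\<in>\<Lambda>. of_real (G t i - G t k) * (- \<i> * cnj (y t i) * M t i k * y t k)))"
  have "primitive_on T (\<lambda>t. of_real (\<Sum>i\<in>\<Lambda>. G t i * (cmod (y t i))\<^sup>2)) g"
    unfolding g_def
  proof (rule weighted_norm_primitive[OF y herm])
    fix i assume "i \<in> \<Lambda>"
    show "primitive_on T (\<lambda>t. of_real (G t i)) (\<lambda>t. of_real (G' t i))"
    proof (rule primitive_on_of_real_C1)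
      fix t :: real
      have "((\<lambda>t. d i q - v * t) has_real_derivative - v) (at t)"
        by (auto intro!: derivative_eq_intros)
      from DERIV_chain2[OF has_derivative_pos_part_powr[OF p] this]
      show "((\<lambda>t. G t i) has_real_derivative G' t i) (at t)"
        by (simp add: G_def G'_def)
      show "continuous_on {0..T} (\<lambda>t. G' t i)"
        unfolding G'_def using p by (intro continuous_intros continuous_on_powr') auto
    qed
  qed
  then have prim: "primitive_on t (\<lambda>t. of_real (\<Sum>i\<in>\<Lambda>. G t i * (cmod (y t i))\<^sup>2)) g"
    using t(2) by (rule primitive_on_mono)
  have "Re (g s) \<le> 2 powr p * J * Kp" if s: "0 \<le> s" "s \<le> t" for s
  proof -
    define b where "b = (\<lambda>i. cmod (y s i))"
    \<comment> \<open>The square of \<open>w i\<close> is, up to the factor -p v, the derivative of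
      the weight at \<open>i\<close>. The Schur bound for the short-range part thus has the same
      form as the decrease that must absorb it.\<close>
    define w where "w = (\<lambda>i. ?a s i powr ((p - 1) / 2))"
    have sT: "0 \<le> s" "s \<le> T" using s t by auto
    have w2: "(w i)\<^sup>2 = ?a s i powr (p - 1)" for i
      by (simp add: w_def power2_eq_square flip: powr_add)
    \<comment> \<open>A hop changes the distance to \<open>q\<close> by at most its length. The two
      terms of \<open>abs_powr_diff_le\<close> gain one and p powers of that length, whence the
      exponents \<alpha> - 1 and \<alpha> - p.\<close>
    have hop: "\<bar>G s i - G s k\<bar> * cmod (M s i k)
        \<le> p * 2 powr p * J * (kernel (\<alpha> - 1) i k * (w i * w k)) + 2 powr p * J * kernel (\<alpha> - p) i k"
      if ik: "i \<in> \<Lambda>" "k \<in> \<Lambda>" for i k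
    proof (cases "i = k")
      case False
      have dd: "\<bar>?a s i - ?a s k\<bar> \<le> d i k"
        using dist_triangle[OF ik(1,2) q] dist_triangle[OF ik(2,1) q] dist_commute[of i k] by (auto simp: max_def)
      have pos: "0 < d i k" using dist_pos ik False by blast
      have "\<bar>G s i - G s k\<bar> \<le> p * 2 powr p * (\<bar>?a s i - ?a s k\<bar> * (w i * w k)) + 2 powr p * \<bar>?a s i - ?a s k\<bar> powr p"
        unfolding G_def w_def using p by (intro abs_powr_diff_le) auto
      also have "\<dots> \<le> p * 2 powr p * (d i k * (w i * w k)) + 2 powr p * d i k powr p"
        using p dd by (intro add_mono mult_left_mono mult_right_mono powr_mono2) (auto simp: w_def)
      finally have "\<bar>G s i - G s k\<bar> * cmod (M s i k)
          \<le> (p * 2 powr p * (d i k * (w i * w k)) + 2 powr p * d i k powr p) * (J * d i k powr (- \<alpha>))"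
        using M[OF sT ik False] by (intro mult_mono) auto
      also have "\<dots> = p * 2 powr p * J * ((d i k powr 1 * d i k powr (- \<alpha>)) * (w i * w k))
          + 2 powr p * J * (d i k powr p * d i k powr (- \<alpha>))"
        using pos by (simp add: algebra_simps)
      also have "\<dots> = p * 2 powr p * J * (kernel (\<alpha> - 1) i k * (w i * w k)) + 2 powr p * J * kernel (\<alpha> - p) i k"
        using False by (simp only: powr_add[symmetric]) (simp add: kernel_def)
      finally show ?thesis .
    qed (simp add: kernel_def)
    have "Re (g s) \<le> (\<Sum>i\<in>\<Lambda>. G' s i * (b i)\<^sup>2 + (\<Sum>k\<in>\<Lambda>. \<bar>G s i - G s k\<bar> * cmod (M s i k) * (b i * b k)))"
      unfolding g_def Re_sum plus_complex.sel Re_complex_of_real b_def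
    proof (intro sum_mono add_mono order_refl)
      fix i k
      have "Re (of_real (G s i - G s k) * (- \<i> * cnj (y s i) * M s i k * y s k))
         \<le> cmod (of_real (G s i - G s k) * (- \<i> * cnj (y s i) * M s i k * y s k))"
        by (rule complex_Re_le_cmod)
      also have "\<dots> = \<bar>G s i - G s k\<bar> * cmod (M s i k) * (cmod (y s i) * cmod (y s k))"
        by (simp add: norm_mult del: of_real_diff)
      finally show "Re (of_real (G s i - G s k) * (- \<i> * cnj (y s i) * M s i k * y s k)) \<le> \<dots>" .
    qed
    also have "\<dots> \<le> (\<Sum>i\<in>\<Lambda>. G' s i * (b i)\<^sup>2 + (\<Sum>k\<in>\<Lambda>.
        (p * 2 powr p * J * (kernel (\<alpha> - 1) i k * (w i * w k)) + 2 powr p * J * kernel (\<alpha> - p) i k) * (b i * b k)))"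
      by (intro sum_mono add_mono order_refl mult_right_mono hop) (auto simp: b_def)
    also have "\<dots> = (\<Sum>i\<in>\<Lambda>. G' s i * (b i)\<^sup>2)
        + p * 2 powr p * J * (\<Sum>i\<in>\<Lambda>. \<Sum>k\<in>\<Lambda>. kernel (\<alpha> - 1) i k * ((w i * b i) * (w k * b k)))
        + 2 powr p * J * (\<Sum>i\<in>\<Lambda>. \<Sum>k\<in>\<Lambda>. kernel (\<alpha> - p) i k * (b i * b k))"
      by (simp add: algebra_simps sum.distrib sum_distrib_left)
    also have "\<dots> \<le> (\<Sum>i\<in>\<Lambda>. G' s i * (b i)\<^sup>2)
        + p * 2 powr p * J * (K1 * (\<Sum>i\<in>\<Lambda>. (w i * b i)\<^sup>2)) + 2 powr p * J * (Kp * (\<Sum>i\<in>\<Lambda>. (b i)\<^sup>2))"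
      using p J K1 Kp
      by (intro add_mono mult_left_mono order_refl schur_form) (auto simp: kernel_nonneg kernel_row kernel_col)
    \<comment> \<open>The amplitudes have norm one, so long jumps contribute at a constant rate; the
      bracket is nonpositive by the choice of \<open>v\<close>.\<close>
    also have "\<dots> = (2 powr p * J * K1 - v) * p * (\<Sum>i\<in>\<Lambda>. (w i * b i)\<^sup>2) + 2 powr p * J * Kp"
    proof -
      have "(\<Sum>i\<in>\<Lambda>. G' s i * (b i)\<^sup>2) = (\<Sum>i\<in>\<Lambda>. - v * p * (w i * b i)\<^sup>2)"
        by (intro sum.cong) (auto simp: G'_def power_mult_distrib w2)
      also have "\<dots> = - v * p * (\<Sum>i\<in>\<Lambda>. (w i * b i)\<^sup>2)"
        by (rule sum_distrib_left[symmetric])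
      finally show ?thesis
        using norm_one[OF sT] by (simp add: b_def algebra_simps)
    qed
    also have "\<dots> \<le> 2 powr p * J * Kp"
      using v p by (simp add: mult_nonpos_nonneg sum_nonneg)
    finally show ?thesis .
  qed
  from primitive_on_Re_bound[OF prim t(1) this]
  have "(\<Sum>i\<in>\<Lambda>. G t i * (cmod (y t i))\<^sup>2) \<le> (\<Sum>i\<in>\<Lambda>. G 0 i * (cmod (y 0 i))\<^sup>2) + 2 powr p * J * Kp * t"
    by (simp del: of_real_sum)
  \<comment> \<open>At time zero the particle sits at \<open>q\<close>, where the weight
    vanishes.\<close>
  also have "(\<Sum>i\<in>\<Lambda>. G 0 i * (cmod (y 0 i))\<^sup>2) = 0"
    using Metric_space.mdist_zero[OF metric q] by (intro sum.neutral) (auto simp: y0 G_def)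
  finally show ?thesis by (simp add: G_def)
qed

text \<open>Markov's inequality: beyond R/2 the receded weight is still at least (R/4)^p, because
  its front has travelled at most R/4.\<close>

lemma far_probability:
  fixes p v R :: real
  assumes "1 < p"
    and "\<And>i. i \<in> \<Lambda> \<Longrightarrow> (\<Sum>j\<in>\<Lambda> - {i}. d i j powr (- (\<alpha> - 1))) \<le> K1"
    and "\<And>i. i \<in> \<Lambda> \<Longrightarrow> (\<Sum>j\<in>\<Lambda> - {i}. d i j powr (- (\<alpha> - p))) \<le> Kp"
    and "2 powr p * J * K1 \<le> v" and "0 \<le> t" "t \<le> T" and R: "0 < R" "v * t \<le> R / 4"
  shows "(\<Sum>i\<in>\<Lambda>. if R / 2 < d i q then (cmod (y t i))\<^sup>2 else 0) \<le> 2 powr p * J * Kp * t * (R / 4) powr (- p)"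
proof -
  have "(\<Sum>i\<in>\<Lambda>. if R / 2 < d i q then (cmod (y t i))\<^sup>2 else 0)
      \<le> (\<Sum>i\<in>\<Lambda>. (max 0 (d i q - v * t) powr p * (cmod (y t i))\<^sup>2) * (R / 4) powr (- p))"
  proof (rule sum_mono)
    fix i
    show "(if R / 2 < d i q then (cmod (y t i))\<^sup>2 else 0)
      \<le> (max 0 (d i q - v * t) powr p * (cmod (y t i))\<^sup>2) * (R / 4) powr (- p)"
    proof (cases "R / 2 < d i q")
      case True
      have "(R / 4) powr p \<le> max 0 (d i q - v * t) powr p"
        using True R assms(1) by (intro powr_mono2) auto
      then have "(R / 4) powr p * (cmod (y t i))\<^sup>2 * (R / 4) powr (- p)
          \<le> max 0 (d i q - v * t) powr p * (cmod (y t i))\<^sup>2 * (R / 4) powr (- p)"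
        by (intro mult_right_mono) auto
      moreover have "(R / 4) powr p * (R / 4) powr (- p) = 1"
        using R by (simp flip: powr_add)
      ultimately show ?thesis using True by (simp add: mult.commute mult.left_commute)
    qed simp
  qed
  also have "\<dots> \<le> (2 powr p * J * Kp * t) * (R / 4) powr (- p)"
    unfolding sum_distrib_right[symmetric]
    by (intro mult_right_mono transport[OF assms(1-6)]) auto
  finally show ?thesis .
qed

end

section \<open>Fock space with a particle-number cutoff\<close>

text \<open>Taking all sectors up to \<open>n\<close> together allows superpositions of different
  particle numbers. On a finite lattice the set is finite for both statistics, and vectors supported
  on it stay so under hopping and annihilation.\<close>

definition cutoff :: "statistics \<Rightarrow> nat set \<Rightarrow> nat \<Rightarrow> config set" where
  "cutoff st \<Lambda> n = {\<nu> \<in> configs st \<Lambda>. (\<Sum>i\<in>\<Lambda>. \<nu> i) \<le> n}"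

lemma finite_cutoff:
  assumes "finite \<Lambda>"
  shows "finite (cutoff st \<Lambda> n)"
proof (rule finite_subset)
  show "cutoff st \<Lambda> n \<subseteq> {\<nu>. \<forall>i. (i \<in> \<Lambda> \<longrightarrow> \<nu> i \<in> {..n}) \<and> (i \<notin> \<Lambda> \<longrightarrow> \<nu> i = 0)}"
  proof
    fix \<nu> assume \<nu>: "\<nu> \<in> cutoff st \<Lambda> n"
    have "\<nu> i \<le> n" if "i \<in> \<Lambda>" for i
      using member_le_sum[of i \<Lambda> \<nu>] that assms \<nu> by (simp add: cutoff_def)
    then show "\<nu> \<in> {\<nu>. \<forall>i. (i \<in> \<Lambda> \<longrightarrow> \<nu> i \<in> {..n}) \<and> (i \<notin> \<Lambda> \<longrightarrow> \<nu> i = 0)}"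
      using \<nu> by (simp add: cutoff_def configs_def)
  qed
  show "finite {\<nu>. \<forall>i. (i \<in> \<Lambda> \<longrightarrow> \<nu> i \<in> {..n}) \<and> (i \<notin> \<Lambda> \<longrightarrow> \<nu> i = 0)}"
    using assms by (intro finite_set_of_finite_funs) auto
qed

lemma fock_le_outside_cutoff:
  assumes "\<psi> \<in> fock_le st \<Lambda> n" and "\<nu> \<notin> cutoff st \<Lambda> n"
  shows "\<psi> \<nu> = 0"
proof -
  obtain \<phi> where \<psi>: "\<psi> = (\<lambda>\<nu>. \<Sum>m\<le>n. \<phi> m \<nu>)" and \<phi>: "\<forall>m\<le>n. \<phi> m \<in> fock_sector st \<Lambda> m"
    using assms(1) by (auto simp: fock_le_def)
  have "\<phi> m \<nu> = 0" if "m \<le> n" for m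
    using \<phi> that assms(2) by (force simp: fock_sector_def cutoff_def)
  then show ?thesis by (simp add: \<psi>)
qed

lemma braket_cutoff:
  assumes "finite \<Lambda>" and "\<And>\<nu>. \<nu> \<notin> cutoff st \<Lambda> n \<Longrightarrow> \<phi> \<nu> = 0 \<or> \<psi> \<nu> = 0"
  shows "braket st \<Lambda> \<phi> \<psi> = (\<Sum>\<nu>\<in>cutoff st \<Lambda> n. cnj (\<phi> \<nu>) * \<psi> \<nu>)"
proof -
  have "braket st \<Lambda> \<phi> \<psi> = (\<Sum>\<^sub>\<infinity>\<nu>\<in>cutoff st \<Lambda> n. cnj (\<phi> \<nu>) * \<psi> \<nu>)"
    unfolding braket_def using assms(2) by (intro infsum_cong_neutral) (auto simp: cutoff_def)
  then show ?thesis
    using finite_cutoff[OF assms(1)] by simp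
qed

lemma braket_commute: "braket st \<Lambda> \<phi> \<psi> = cnj (braket st \<Lambda> \<psi> \<phi>)"
  unfolding braket_def infsum_cnj[symmetric] by (simp add: mult.commute)

text \<open>The multiplier and the configuration do not depend on the vector. Linearity and
  compatibility with time integrals thus become scalar facts, for both statistics at once.\<close>

lemma annihilate_coefficient:
  obtains c \<mu> where "\<And>\<phi>. annihilate st j \<phi> \<nu> = c * \<phi> \<mu>"
  by (cases st) (auto intro: that[of _ "\<nu>(j := \<nu> j + 1)"] that[of "if \<nu> j = 0 then jw_sign j \<nu> else 0" "\<nu>(j := 1)"])

lemma create_coefficient:
  obtains c \<mu> where "\<And>\<phi>. create st j \<phi> \<nu> = c * \<phi> \<mu>"
  by (cases st)
    (auto intro: that[of "if \<nu> j = 0 then 0 else of_real (sqrt (real (\<nu> j)))" "\<nu>(j := \<nu> j - 1)"]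
      that[of "if \<nu> j = 1 then jw_sign j \<nu> else 0" "\<nu>(j := 0)"])

lemma create_annihilate_coefficient:
  obtains c \<mu> where "\<And>\<phi>. create st i (annihilate st j \<phi>) \<nu> = c * \<phi> \<mu>"
proof -
  obtain c \<mu> where "\<And>\<phi>. create st i \<phi> \<nu> = c * \<phi> \<mu>" using create_coefficient[of st i \<nu>] by blast
  moreover obtain c' \<mu>' where "\<And>\<phi>. annihilate st j \<phi> \<mu> = c' * \<phi> \<mu>'"
    using annihilate_coefficient[of st j \<mu>] by blast
  ultimately show thesis by (intro that[of "c * c'" \<mu>']) simp
qed

lemma annihilate_sum:
  "annihilate st j (\<lambda>\<nu>. \<Sum>k\<in>K. c k * f k \<nu>) \<nu> = (\<Sum>k\<in>K. c k * annihilate st j (f k) \<nu>)"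
proof -
  obtain a \<mu> where "\<And>\<phi>. annihilate st j \<phi> \<nu> = a * \<phi> \<mu>" using annihilate_coefficient[of st j \<nu>] by blast
  then show ?thesis by (simp add: sum_distrib_left mult.left_commute)
qed

lemma annihilate_primitive:
  assumes "\<And>\<nu>. primitive_on T (\<lambda>t. \<psi> t \<nu>) (\<lambda>t. \<psi>' t \<nu>)"
  shows "primitive_on T (\<lambda>t. annihilate st j (\<psi> t) \<nu>) (\<lambda>t. annihilate st j (\<psi>' t) \<nu>)"
proof -
  obtain a \<mu> where "\<And>\<phi>. annihilate st j \<phi> \<nu> = a * \<phi> \<mu>" using annihilate_coefficient[of st j \<nu>] by blast
  then show ?thesis using primitive_on_cmult[OF assms, of a \<mu>] by simp
qed

text \<open>Stated with sums on both sides to stay clear of truncated subtraction.\<close>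

lemma sum_fun_upd:
  fixes \<nu> :: config
  assumes "finite \<Lambda>" "i \<in> \<Lambda>"
  shows "(\<Sum>l\<in>\<Lambda>. (\<nu>(i := k)) l) + \<nu> i = (\<Sum>l\<in>\<Lambda>. \<nu> l) + k"
proof -
  have "(\<Sum>l\<in>\<Lambda> - {i}. (\<nu>(i := k)) l) = (\<Sum>l\<in>\<Lambda> - {i}. \<nu> l)" by (rule sum.cong) auto
  then show ?thesis using assms by (simp add: sum.remove[of \<Lambda> i])
qed

text \<open>A nonzero coefficient at \<nu> would be read off a configuration with one more particle,
  which is outside the cutoff too.\<close>

lemma annihilate_outside_cutoff:
  assumes "finite \<Lambda>" "j \<in> \<Lambda>" and \<phi>: "\<And>\<nu>. \<nu> \<notin> cutoff st \<Lambda> n \<Longrightarrow> \<phi> \<nu> = 0"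
    and \<nu>: "\<nu> \<notin> cutoff st \<Lambda> n"
  shows "annihilate st j \<phi> \<nu> = 0"
proof -
  have *: "\<nu>(j := k) \<notin> cutoff st \<Lambda> n" if "\<nu> j \<le> k" for k
  proof
    assume "\<nu>(j := k) \<in> cutoff st \<Lambda> n"
    then have c: "\<nu>(j := k) \<in> configs st \<Lambda>" "(\<Sum>i\<in>\<Lambda>. (\<nu>(j := k)) i) \<le> n" by (auto simp: cutoff_def)
    have "\<nu> \<in> configs st \<Lambda>"
      using c(1) that assms(2) unfolding configs_def by (auto simp: fun_upd_apply split: if_splits intro: order_trans)
    moreover have "(\<Sum>i\<in>\<Lambda>. \<nu> i) \<le> n"
      using c(2) that sum_fun_upd[OF assms(1,2), of \<nu> k] by linarith
    ultimately show False using \<nu> by (simp add: cutoff_def)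
  qed
  show ?thesis
    by (cases st) (auto simp: \<phi>[OF *])
qed

text \<open>Hopping conserves the particle number, and undoing a hop cannot make an inadmissible
  configuration admissible.\<close>

lemma create_annihilate_outside_cutoff:
  assumes fin: "finite \<Lambda>" and ij: "i \<in> \<Lambda>" "j \<in> \<Lambda>" and \<phi>: "\<And>\<nu>. \<nu> \<notin> cutoff st \<Lambda> n \<Longrightarrow> \<phi> \<nu> = 0"
    and \<nu>: "\<nu> \<notin> cutoff st \<Lambda> n"
  shows "create st i (annihilate st j \<phi>) \<nu> = 0"
proof (cases st)
  case Boson
  show ?thesis
  proof (cases "\<nu> i = 0")
    case False
    let ?\<mu> = "\<nu>(i := \<nu> i - 1)"
    have "?\<mu>(j := ?\<mu> j + 1) \<notin> cutoff st \<Lambda> n"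
    proof
      assume "?\<mu>(j := ?\<mu> j + 1) \<in> cutoff st \<Lambda> n"
      moreover have "(\<Sum>l\<in>\<Lambda>. (?\<mu>(j := ?\<mu> j + 1)) l) = (\<Sum>l\<in>\<Lambda>. \<nu> l)"
        using sum_fun_upd[OF fin ij(1), of \<nu> "\<nu> i - 1"] sum_fun_upd[OF fin ij(2), of ?\<mu> "?\<mu> j + 1"] False
        by linarith
      moreover have "\<nu> \<in> configs st \<Lambda>" if "?\<mu>(j := ?\<mu> j + 1) \<in> configs st \<Lambda>"
        using that ij Boson unfolding configs_def by (auto simp: fun_upd_apply split: if_splits)
      ultimately show False using \<nu> by (simp add: cutoff_def)
    qed
    then show ?thesis using \<phi> Boson False by simp
  qed (simp add: Boson)
next
  case Fermion
  show ?thesis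
  \<comment> \<open>The only fermionic case with a nonzero multiplier: \<open>i\<close> is occupied
    and \<open>j\<close> is empty once \<open>i\<close> has been cleared, which includes i =
    j.\<close>
  proof (cases "\<nu> i = 1 \<and> (\<nu>(i := 0)) j = 0")
    case True
    let ?\<mu> = "\<nu>(i := 0)"
    have "?\<mu>(j := 1) \<notin> cutoff st \<Lambda> n"
    proof
      assume a: "?\<mu>(j := 1) \<in> cutoff st \<Lambda> n"
      moreover have "(\<Sum>l\<in>\<Lambda>. (?\<mu>(j := 1)) l) = (\<Sum>l\<in>\<Lambda>. \<nu> l)"
        using sum_fun_upd[OF fin ij(1), of \<nu> 0] sum_fun_upd[OF fin ij(2), of ?\<mu> 1] True
        by linarith
      moreover have "\<nu> \<in> configs st \<Lambda>" if "?\<mu>(j := 1) \<in> configs st \<Lambda>"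
      proof -
        have "\<nu> l = 0" if "l \<notin> \<Lambda>" for l
          using \<open>?\<mu>(j := 1) \<in> configs st \<Lambda>\<close> that ij by (auto simp: configs_def fun_upd_apply split: if_splits)
        moreover have "\<nu> l \<le> 1" for l
          using \<open>?\<mu>(j := 1) \<in> configs st \<Lambda>\<close> True Fermion
          by (cases "l = i"; cases "l = j") (auto simp: configs_def fun_upd_apply split: if_splits)
        ultimately show ?thesis by (simp add: configs_def)
      qed
      ultimately show False using \<nu> by (simp add: cutoff_def)
    qed
    then show ?thesis using \<phi> Fermion True by simp
  qed (auto simp: Fermion)
qed

lemma hamiltonian_outside_cutoff:
  assumes "finite \<Lambda>" and "\<And>\<nu>. \<nu> \<notin> cutoff st \<Lambda> n \<Longrightarrow> \<phi> \<nu> = 0" and "\<nu> \<notin> cutoff st \<Lambda> n"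
  shows "hamiltonian st \<Lambda> h \<phi> \<nu> = 0"
  unfolding hamiltonian_def using create_annihilate_outside_cutoff[OF assms(1) _ _ assms(2,3)]
  by (intro sum.neutral ballI) simp

section \<open>Adjoints and the number operator\<close>

lemma hopping_adjoint:
  assumes "i \<in> \<Lambda>" "j \<in> \<Lambda>"
  shows "braket st \<Lambda> \<xi> (create st i (annihilate st j \<phi>)) = braket st \<Lambda> (create st j (annihilate st i \<xi>)) \<phi>"
proof -
  have "braket st \<Lambda> \<xi> (create st i (annihilate st j \<phi>)) = cnj (braket st \<Lambda> (annihilate st j \<phi>) (annihilate st i \<xi>))"
    using assms by (subst braket_commute) (simp add: create_adjoint)
  also have "\<dots> = braket st \<Lambda> (annihilate st i \<xi>) (annihilate st j \<phi>)"
    by (rule braket_commute[symmetric])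
  finally show ?thesis using assms by (simp add: create_adjoint)
qed

text \<open>Taking the adjoint exchanges \<open>i\<close> and \<open>j\<close> in each hopping term,
  and Hermiticity of \<open>h\<close> exchanges them back.\<close>

lemma hamiltonian_symmetric:
  assumes fin: "finite \<Lambda>" and herm: "\<And>i j. i \<in> \<Lambda> \<Longrightarrow> j \<in> \<Lambda> \<Longrightarrow> h j i = cnj (h i j)"
    and \<xi>: "\<And>\<nu>. \<nu> \<notin> cutoff st \<Lambda> n \<Longrightarrow> \<xi> \<nu> = 0" and \<phi>: "\<And>\<nu>. \<nu> \<notin> cutoff st \<Lambda> n \<Longrightarrow> \<phi> \<nu> = 0"
  shows "(\<Sum>\<nu>\<in>cutoff st \<Lambda> n. cnj (\<xi> \<nu>) * hamiltonian st \<Lambda> h \<phi> \<nu>)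
    = (\<Sum>\<nu>\<in>cutoff st \<Lambda> n. cnj (hamiltonian st \<Lambda> h \<xi> \<nu>) * \<phi> \<nu>)"
proof -
  let ?S = "cutoff st \<Lambda> n"
  have adj: "(\<Sum>\<nu>\<in>?S. cnj (\<xi> \<nu>) * create st i (annihilate st j \<phi>) \<nu>)
      = (\<Sum>\<nu>\<in>?S. cnj (create st j (annihilate st i \<xi>) \<nu>) * \<phi> \<nu>)" if "i \<in> \<Lambda>" "j \<in> \<Lambda>" for i j
    using hopping_adjoint[OF that, of st \<xi> \<phi>] \<xi> \<phi> by (simp add: braket_cutoff[OF fin, of st n])
  have "(\<Sum>\<nu>\<in>?S. cnj (\<xi> \<nu>) * hamiltonian st \<Lambda> h \<phi> \<nu>)
      = (\<Sum>i\<in>\<Lambda>. \<Sum>j\<in>\<Lambda>. h i j * (\<Sum>\<nu>\<in>?S. cnj (\<xi> \<nu>) * create st i (annihilate st j \<phi>) \<nu>))"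
    unfolding hamiltonian_def sum_distrib_left
    by (subst sum.swap, rule sum.cong[OF refl], subst sum.swap) (simp add: mult.left_commute)
  also have "\<dots> = (\<Sum>i\<in>\<Lambda>. \<Sum>j\<in>\<Lambda>. cnj (h j i) * (\<Sum>\<nu>\<in>?S. cnj (create st j (annihilate st i \<xi>) \<nu>) * \<phi> \<nu>))"
    by (intro sum.cong refl) (simp only: adj herm[symmetric])
  also have "\<dots> = (\<Sum>j\<in>\<Lambda>. \<Sum>i\<in>\<Lambda>. cnj (h j i) * (\<Sum>\<nu>\<in>?S. cnj (create st j (annihilate st i \<xi>) \<nu>) * \<phi> \<nu>))"
    by (rule sum.swap)
  also have "\<dots> = (\<Sum>\<nu>\<in>?S. cnj (hamiltonian st \<Lambda> h \<xi> \<nu>) * \<phi> \<nu>)"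
    unfolding hamiltonian_def sum_distrib_left sum_distrib_right cnj_sum
    by (subst (2) sum.swap, rule sum.cong[OF refl], subst (2) sum.swap) (simp add: mult.assoc)
  finally show ?thesis .
qed

lemma number_operator:
  assumes "\<nu> \<in> configs st \<Lambda>"
  shows "create st j (annihilate st j \<phi>) \<nu> = of_nat (\<nu> j) * \<phi> \<nu>"
proof (cases st)
  case Boson
  have sq: "complex_of_real (sqrt x) * (complex_of_real (sqrt x) * z) = complex_of_real x * z"
    if "x \<ge> 0" for x z
    using that by (metis mult.assoc of_real_mult real_sqrt_mult_self abs_of_nonneg)
  show ?thesis
    using sq[of "real (\<nu> j)" "\<phi> \<nu>"] by (simp add: Boson)
next
  case Fermion
  then have "\<nu> j = 0 \<or> \<nu> j = 1" using assms by (auto simp: configs_def le_Suc_eq)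
  moreover have "\<nu>(j := 1) = \<nu>" if "\<nu> j = 1" using that by auto
  ultimately show ?thesis
    using Fermion by (auto simp: jw_sign_upd jw_sign_square)
qed

text \<open>The sum of \<open>create st j\<close> after \<open>annihilate st j\<close> over all
  sites counts particles, which are at most \<open>n\<close> below the cutoff. This takes the place
  of operator norms, since bosonic annihilators are unbounded on the full Fock space.\<close>

lemma sum_norm_annihilate_le:
  assumes fin: "finite \<Lambda>" and \<phi>: "\<And>\<nu>. \<nu> \<notin> cutoff st \<Lambda> n \<Longrightarrow> \<phi> \<nu> = 0"
  shows "(\<Sum>\<nu>\<in>cutoff st \<Lambda> n. \<Sum>j\<in>\<Lambda>. (cmod (annihilate st j \<phi> \<nu>))\<^sup>2)
    \<le> real n * (\<Sum>\<nu>\<in>cutoff st \<Lambda> n. (cmod (\<phi> \<nu>))\<^sup>2)"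
proof -
  let ?S = "cutoff st \<Lambda> n"
  have sq: "complex_of_real ((cmod z)\<^sup>2) = cnj z * z" for z
    by (metis complex_norm_square mult.commute)
  have j: "(\<Sum>\<nu>\<in>?S. (cmod (annihilate st j \<phi> \<nu>))\<^sup>2) = (\<Sum>\<nu>\<in>?S. real (\<nu> j) * (cmod (\<phi> \<nu>))\<^sup>2)"
    if "j \<in> \<Lambda>" for j
  proof -
    have "complex_of_real (\<Sum>\<nu>\<in>?S. (cmod (annihilate st j \<phi> \<nu>))\<^sup>2)
        = (\<Sum>\<nu>\<in>?S. cnj (annihilate st j \<phi> \<nu>) * annihilate st j \<phi> \<nu>)"
      by (simp only: of_real_sum sq)
    also have "\<dots> = braket st \<Lambda> (annihilate st j \<phi>) (annihilate st j \<phi>)"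
      by (intro braket_cutoff[OF fin, symmetric] disjI1) (rule annihilate_outside_cutoff[OF fin that \<phi>])
    also have "\<dots> = braket st \<Lambda> (create st j (annihilate st j \<phi>)) \<phi>"
      using that by (simp add: create_adjoint)
    also have "\<dots> = (\<Sum>\<nu>\<in>?S. cnj (create st j (annihilate st j \<phi>) \<nu>) * \<phi> \<nu>)"
      using \<phi> by (intro braket_cutoff[OF fin]) blast
    also have "\<dots> = (\<Sum>\<nu>\<in>?S. of_real (real (\<nu> j) * (cmod (\<phi> \<nu>))\<^sup>2))"
      by (intro sum.cong refl) (simp add: number_operator[of _ st \<Lambda>] cutoff_def sq del: of_real_power)
    finally show ?thesis by (simp only: of_real_sum[symmetric] of_real_eq_iff)
  qed
  have "(\<Sum>\<nu>\<in>?S. \<Sum>j\<in>\<Lambda>. (cmod (annihilate st j \<phi> \<nu>))\<^sup>2)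
      = (\<Sum>j\<in>\<Lambda>. \<Sum>\<nu>\<in>?S. real (\<nu> j) * (cmod (\<phi> \<nu>))\<^sup>2)"
    by (subst sum.swap) (simp add: j)
  also have "\<dots> = (\<Sum>\<nu>\<in>?S. real (\<Sum>j\<in>\<Lambda>. \<nu> j) * (cmod (\<phi> \<nu>))\<^sup>2)"
    by (subst sum.swap) (simp add: sum_distrib_right)
  also have "\<dots> \<le> (\<Sum>\<nu>\<in>?S. real n * (cmod (\<phi> \<nu>))\<^sup>2)"
    by (intro sum_mono mult_right_mono of_nat_mono) (auto simp: cutoff_def)
  finally show ?thesis by (simp only: sum_distrib_left)
qed

section \<open>Smeared annihilation operators and commutators\<close>

definition field :: "statistics \<Rightarrow> nat set \<Rightarrow> (nat \<Rightarrow> complex) \<Rightarrow> fock_vec \<Rightarrow> fock_vec" where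
  "field st \<Lambda> w \<phi> = (\<lambda>\<nu>. \<Sum>j\<in>\<Lambda>. w j * annihilate st j \<phi> \<nu>)"

lemma field_outside_cutoff:
  assumes "finite \<Lambda>" and "\<And>\<nu>. \<nu> \<notin> cutoff st \<Lambda> n \<Longrightarrow> \<phi> \<nu> = 0" and "\<nu> \<notin> cutoff st \<Lambda> n"
  shows "field st \<Lambda> w \<phi> \<nu> = 0"
  unfolding field_def using annihilate_outside_cutoff[OF assms(1) _ assms(2,3)]
  by (intro sum.neutral ballI) simp

text \<open>Cauchy-Schwarz over the sites followed by the particle count: the price is a factor
  \<open>n\<close>, not the number of sites.\<close>

lemma field_norm_le:
  assumes "finite \<Lambda>" and "\<And>\<nu>. \<nu> \<notin> cutoff st \<Lambda> n \<Longrightarrow> \<phi> \<nu> = 0"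
  shows "(\<Sum>\<nu>\<in>cutoff st \<Lambda> n. (cmod (field st \<Lambda> w \<phi> \<nu>))\<^sup>2)
    \<le> real n * (\<Sum>j\<in>\<Lambda>. (cmod (w j))\<^sup>2) * (\<Sum>\<nu>\<in>cutoff st \<Lambda> n. (cmod (\<phi> \<nu>))\<^sup>2)"
proof -
  let ?S = "cutoff st \<Lambda> n" and ?W = "\<Sum>j\<in>\<Lambda>. (cmod (w j))\<^sup>2"
  have "(\<Sum>\<nu>\<in>?S. (cmod (field st \<Lambda> w \<phi> \<nu>))\<^sup>2) \<le> (\<Sum>\<nu>\<in>?S. ?W * (\<Sum>j\<in>\<Lambda>. (cmod (annihilate st j \<phi> \<nu>))\<^sup>2))"
  proof (rule sum_mono)
    fix \<nu>
    have "cmod (field st \<Lambda> w \<phi> \<nu>) \<le> (\<Sum>j\<in>\<Lambda>. cmod (w j) * cmod (annihilate st j \<phi> \<nu>))"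
      unfolding field_def by (rule sum_norm_le) (simp add: norm_mult)
    then have "(cmod (field st \<Lambda> w \<phi> \<nu>))\<^sup>2 \<le> (\<Sum>j\<in>\<Lambda>. cmod (w j) * cmod (annihilate st j \<phi> \<nu>))\<^sup>2"
      by (intro power_mono) auto
    also have "\<dots> \<le> ?W * (\<Sum>j\<in>\<Lambda>. (cmod (annihilate st j \<phi> \<nu>))\<^sup>2)"
      by (rule Cauchy_Schwarz_ineq_sum)
    finally show "(cmod (field st \<Lambda> w \<phi> \<nu>))\<^sup>2 \<le> \<dots>" .
  qed
  also have "\<dots> = ?W * (\<Sum>\<nu>\<in>?S. \<Sum>j\<in>\<Lambda>. (cmod (annihilate st j \<phi> \<nu>))\<^sup>2)"
    by (simp only: sum_distrib_left)
  also have "\<dots> \<le> ?W * (real n * (\<Sum>\<nu>\<in>?S. (cmod (\<phi> \<nu>))\<^sup>2))"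
    by (intro mult_left_mono sum_norm_annihilate_le assms sum_nonneg) auto
  finally show ?thesis by (simp add: mult_ac)
qed

text \<open>Moving an annihilator past two operators costs two signs for fermions. They cancel, so
  both statistics have the same commutator with a hopping term.\<close>

lemma annihilate_create_annihilate:
  assumes "\<nu> \<in> configs st \<Lambda>"
  shows "annihilate st j (create st i (annihilate st l \<phi>)) \<nu> =
    create st i (annihilate st l (annihilate st j \<phi>)) \<nu> + (if j = i then annihilate st l \<phi> \<nu> else 0)"
proof (cases st)
  case Boson
  have "annihilate Boson l (annihilate Boson j \<phi>) = annihilate Boson j (annihilate Boson l \<phi>)"
    using boson_ccr(2)[of l j \<phi>] by auto
  then show ?thesis
    using boson_ccr(1)[of j i "annihilate Boson l \<phi>" \<nu>] Boson by (auto simp: algebra_simps)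
next
  case Fermion
  have "create Fermion i (annihilate Fermion l (annihilate Fermion j \<phi>)) \<nu>
      = - create Fermion i (annihilate Fermion j (annihilate Fermion l \<phi>)) \<nu>"
  proof -
    \<comment> \<open>\<open>fermion_car\<close> speaks about admissible configurations, so the
      configuration obtained by clearing \<open>i\<close> is checked to be one.\<close>
    have "\<nu>(i := 0) \<in> configs Fermion \<Lambda>" if "\<nu> i = 1"
      using assms that Fermion by (auto simp: configs_def)
    from fermion_car(2)[OF this, of l j \<phi>] show ?thesis
      by (auto simp: eq_neg_iff_add_eq_0 simp flip: distrib_left simp del: annihilate.simps)
  qed
  then show ?thesis
    using fermion_car(1)[of \<nu> \<Lambda> j i "annihilate Fermion l \<phi>"] assms Fermion
    by (auto simp: algebra_simps simp del: annihilate.simps create.simps)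
qed

text \<open>The commutator of an annihilator with a quadratic Hamiltonian is again linear in the
  annihilators. This closes the equations for the modes and reduces locality to one-particle
  matrices.\<close>

lemma annihilate_hamiltonian:
  assumes "\<nu> \<in> configs st \<Lambda>" "finite \<Lambda>" "j \<in> \<Lambda>"
  shows "annihilate st j (hamiltonian st \<Lambda> h \<phi>) \<nu> =
    hamiltonian st \<Lambda> h (annihilate st j \<phi>) \<nu> + (\<Sum>l\<in>\<Lambda>. h j l * annihilate st l \<phi> \<nu>)"
proof -
  have "annihilate st j (hamiltonian st \<Lambda> h \<phi>) \<nu>
      = (\<Sum>i\<in>\<Lambda>. annihilate st j (\<lambda>\<nu>. \<Sum>l\<in>\<Lambda>. h i l * create st i (annihilate st l \<phi>) \<nu>) \<nu>)"
    unfolding hamiltonian_def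
    using annihilate_sum[where c = "\<lambda>_. 1" and K = \<Lambda> and st = st and j = j and \<nu> = \<nu>
        and f = "\<lambda>i \<nu>. \<Sum>l\<in>\<Lambda>. h i l * create st i (annihilate st l \<phi>) \<nu>"]
    by simp
  also have "\<dots> = (\<Sum>i\<in>\<Lambda>. \<Sum>l\<in>\<Lambda>. h i l * annihilate st j (create st i (annihilate st l \<phi>)) \<nu>)"
    by (simp only: annihilate_sum)
  also have "\<dots> = (\<Sum>i\<in>\<Lambda>. \<Sum>l\<in>\<Lambda>. h i l * create st i (annihilate st l (annihilate st j \<phi>)) \<nu>)
      + (\<Sum>i\<in>\<Lambda>. \<Sum>l\<in>\<Lambda>. if j = i then h i l * annihilate st l \<phi> \<nu> else 0)"
    unfolding sum.distrib[symmetric]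
    by (intro sum.cong refl) (simp add: annihilate_create_annihilate[OF assms(1)] distrib_left)
  also have "(\<Sum>i\<in>\<Lambda>. \<Sum>l\<in>\<Lambda>. if j = i then h i l * annihilate st l \<phi> \<nu> else 0)
      = (\<Sum>i\<in>\<Lambda>. if j = i then (\<Sum>l\<in>\<Lambda>. h i l * annihilate st l \<phi> \<nu>) else 0)"
    by (intro sum.cong refl) auto
  also have "\<dots> = (\<Sum>l\<in>\<Lambda>. h j l * annihilate st l \<phi> \<nu>)"
    using assms by simp
  finally show ?thesis by (simp only: hamiltonian_def)
qed

lemma hamiltonian_field:
  "hamiltonian st \<Lambda> h (field st \<Lambda> w \<phi>) \<nu> = (\<Sum>j\<in>\<Lambda>. w j * hamiltonian st \<Lambda> h (annihilate st j \<phi>) \<nu>)"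
proof -
  have "create st i (annihilate st l (field st \<Lambda> w \<phi>)) \<nu>
      = (\<Sum>j\<in>\<Lambda>. w j * create st i (annihilate st l (annihilate st j \<phi>)) \<nu>)" for i l
  proof -
    obtain c \<mu> where "\<And>\<phi>. create st i (annihilate st l \<phi>) \<nu> = c * \<phi> \<mu>"
      using create_annihilate_coefficient[of st i l \<nu>] by blast
    then show ?thesis by (simp add: field_def sum_distrib_left mult.left_commute)
  qed
  then have "hamiltonian st \<Lambda> h (field st \<Lambda> w \<phi>) \<nu>
      = (\<Sum>i\<in>\<Lambda>. \<Sum>l\<in>\<Lambda>. \<Sum>j\<in>\<Lambda>. w j * (h i l * create st i (annihilate st l (annihilate st j \<phi>)) \<nu>))"
    by (simp add: hamiltonian_def sum_distrib_left mult.left_commute)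
  also have "\<dots> = (\<Sum>j\<in>\<Lambda>. \<Sum>i\<in>\<Lambda>. \<Sum>l\<in>\<Lambda>. w j * (h i l * create st i (annihilate st l (annihilate st j \<phi>)) \<nu>))"
    by (subst (2) sum.swap, subst sum.swap) (rule refl)
  finally show ?thesis by (simp only: hamiltonian_def sum_distrib_left)
qed

section \<open>Heisenberg evolution of a mode\<close>

lemma create_annihilate_expand:
  assumes "finite S" and \<phi>: "\<And>\<nu>. \<nu> \<notin> S \<Longrightarrow> \<phi> \<nu> = 0"
  shows "create st i (annihilate st j \<phi>) \<nu>
    = (\<Sum>\<mu>\<in>S. create st i (annihilate st j (\<lambda>\<nu>. if \<nu> = \<mu> then 1 else 0)) \<nu> * \<phi> \<mu>)"
proof -
  obtain c \<mu> where c: "\<And>\<phi>. create st i (annihilate st j \<phi>) \<nu> = c * \<phi> \<mu>"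
    using create_annihilate_coefficient[of st i j \<nu>] by blast
  have "(\<Sum>\<mu>'\<in>S. c * (if \<mu> = \<mu>' then 1 else 0) * \<phi> \<mu>') = (\<Sum>\<mu>'\<in>S. if \<mu> = \<mu>' then c * \<phi> \<mu> else 0)"
    by (intro sum.cong) auto
  also have "\<dots> = c * \<phi> \<mu>" using assms by auto
  finally show ?thesis by (simp only: c)
qed

text \<open>Matrix elements in the occupation basis; on the finite cutoff they make the many-body
  equation an instance of \<open>dyson_sol\<close>.\<close>

definition hamiltonian_matrix ::
  "statistics \<Rightarrow> nat set \<Rightarrow> (nat \<Rightarrow> nat \<Rightarrow> complex) \<Rightarrow> config \<Rightarrow> config \<Rightarrow> complex" where
  "hamiltonian_matrix st \<Lambda> h \<nu> \<mu> = hamiltonian st \<Lambda> h (\<lambda>\<nu>. if \<nu> = \<mu> then 1 else 0) \<nu>"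

lemma hamiltonian_eq_matrix:
  assumes "finite S" and \<phi>: "\<And>\<nu>. \<nu> \<notin> S \<Longrightarrow> \<phi> \<nu> = 0"
  shows "hamiltonian st \<Lambda> h \<phi> \<nu> = (\<Sum>\<mu>\<in>S. hamiltonian_matrix st \<Lambda> h \<nu> \<mu> * \<phi> \<mu>)"
  unfolding hamiltonian_matrix_def hamiltonian_def sum_distrib_right
  by (subst (2) sum.swap, rule sum.cong[OF refl], subst sum.swap, rule sum.cong[OF refl],
      subst create_annihilate_expand[OF assms]) (simp_all add: sum_distrib_left mult.assoc)

context
  fixes st :: statistics and \<Lambda> :: "nat set" and n :: nat and T :: real
    and h :: "real \<Rightarrow> nat \<Rightarrow> nat \<Rightarrow> complex" and \<psi>\<^sub>0 :: fock_vec
  assumes fin: "finite \<Lambda>" and T: "0 \<le> T"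
    and h: "\<And>i j. i \<in> \<Lambda> \<Longrightarrow> j \<in> \<Lambda> \<Longrightarrow> (\<lambda>t. h t i j) absolutely_integrable_on {0..T}"
    and \<psi>\<^sub>0: "\<And>\<nu>. \<nu> \<notin> cutoff st \<Lambda> n \<Longrightarrow> \<psi>\<^sub>0 \<nu> = 0"
begin

text \<open>By induction no Dyson term leaves the cutoff, so a finite matrix governs the whole
  family of coefficients.\<close>

lemma dyson_eq_dyson_vec:
  "dyson (\<lambda>t. hamiltonian st \<Lambda> (h t)) \<psi>\<^sub>0 k t \<nu> =
    (if \<nu> \<in> cutoff st \<Lambda> n
     then dyson_vec (\<lambda>t. hamiltonian_matrix st \<Lambda> (h t)) (cutoff st \<Lambda> n) \<psi>\<^sub>0 k t \<nu> else 0)"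
proof (induction k arbitrary: t \<nu>)
  case (Suc k)
  let ?\<phi> = "dyson (\<lambda>t. hamiltonian st \<Lambda> (h t)) \<psi>\<^sub>0 k"
  have out: "?\<phi> s \<nu> = 0" if "\<nu> \<notin> cutoff st \<Lambda> n" for s \<nu>
    using Suc that by simp
  show ?case
  proof (cases "\<nu> \<in> cutoff st \<Lambda> n")
    case True
    have "hamiltonian st \<Lambda> (h s) (?\<phi> s) \<nu> = (\<Sum>\<mu>\<in>cutoff st \<Lambda> n. hamiltonian_matrix st \<Lambda> (h s) \<nu> \<mu> *
        dyson_vec (\<lambda>t. hamiltonian_matrix st \<Lambda> (h t)) (cutoff st \<Lambda> n) \<psi>\<^sub>0 k s \<mu>)" for s
      by (subst hamiltonian_eq_matrix[OF finite_cutoff[OF fin] out]) (auto simp: Suc)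
    then show ?thesis using True by simp
  next
    case False
    have "hamiltonian st \<Lambda> (h s) (?\<phi> s) \<nu> = 0" for s
      by (rule hamiltonian_outside_cutoff[OF fin out False])
    then show ?thesis using False by simp
  qed
qed (use \<psi>\<^sub>0 in auto)

abbreviation "evolved t \<equiv> propagator (\<lambda>t. hamiltonian st \<Lambda> (h t)) t \<psi>\<^sub>0"

lemma propagator_outside_cutoff: "\<nu> \<notin> cutoff st \<Lambda> n \<Longrightarrow> evolved t \<nu> = 0"
  by (simp add: propagator_def dyson_eq_dyson_vec)

lemma propagator_cutoff:
  "\<nu> \<in> cutoff st \<Lambda> n \<Longrightarrow>
    evolved t \<nu> = dyson_sol (\<lambda>t. hamiltonian_matrix st \<Lambda> (h t)) (cutoff st \<Lambda> n) \<psi>\<^sub>0 t \<nu>"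
  by (simp add: propagator_def dyson_eq_dyson_vec dyson_sol_def)

lemma hamiltonian_matrix_integrable:
  "(\<lambda>t. hamiltonian_matrix st \<Lambda> (h t) \<nu> \<mu>) absolutely_integrable_on {0..T}"
  unfolding hamiltonian_matrix_def hamiltonian_def
  using fin h by (intro absolutely_integrable_sum set_integrable_mult_left) auto

lemma propagator_primitive:
  "primitive_on T (\<lambda>t. evolved t \<nu>) (\<lambda>t. - \<i> * hamiltonian st \<Lambda> (h t) (evolved t) \<nu>)"
proof (cases "\<nu> \<in> cutoff st \<Lambda> n")
  case True
  show ?thesis
    by (rule primitive_on_cong[OF dyson_sol_primitive(1)[OF finite_cutoff[OF fin] T hamiltonian_matrix_integrable True]])
      (simp_all add: propagator_cutoff[OF True] hamiltonian_eq_matrix[OF finite_cutoff[OF fin] propagator_outside_cutoff]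
        propagator_cutoff)
next
  case False
  show ?thesis
    by (rule primitive_on_cong[OF primitive_on_const[of T 0]])
      (simp_all add: propagator_outside_cutoff False
        hamiltonian_outside_cutoff[OF fin propagator_outside_cutoff False])
qed

lemma propagator_0: "evolved 0 = \<psi>\<^sub>0"
proof
  fix \<nu>
  show "evolved 0 \<nu> = \<psi>\<^sub>0 \<nu>"
    using dyson_sol_primitive(2)[OF finite_cutoff[OF fin] T hamiltonian_matrix_integrable]
    by (cases "\<nu> \<in> cutoff st \<Lambda> n") (simp_all add: propagator_cutoff propagator_outside_cutoff \<psi>\<^sub>0)
qed

end

section \<open>Conservation and drift of norms\<close>

lemma sum_cmod_square_primitive:
  assumes "\<And>\<nu>. \<nu> \<in> S \<Longrightarrow> primitive_on T (\<lambda>t. f t \<nu>) (\<lambda>t. f' t \<nu>)"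
  shows "primitive_on T (\<lambda>t. of_real (\<Sum>\<nu>\<in>S. (cmod (f t \<nu>))\<^sup>2))
    (\<lambda>t. \<Sum>\<nu>\<in>S. cnj (f' t \<nu>) * f t \<nu> + cnj (f t \<nu>) * f' t \<nu>)"
proof -
  have sq: "complex_of_real ((cmod z)\<^sup>2) = cnj z * z" for z
    by (metis complex_norm_square mult.commute)
  have "primitive_on T (\<lambda>t. \<Sum>\<nu>\<in>S. cnj (f t \<nu>) * f t \<nu>)
    (\<lambda>t. \<Sum>\<nu>\<in>S. cnj (f' t \<nu>) * f t \<nu> + cnj (f t \<nu>) * f' t \<nu>)"
    by (intro primitive_on_sum primitive_on_mult primitive_on_cnj assms)
  then show ?thesis by (simp only: of_real_sum sq)
qed

text \<open>The Hamiltonian part cancels by symmetry, so a norm changes only through the overlap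
  with the source \<open>F\<close>. With F = 0 this is conservation of probability; the drift bound
  takes the defect of the mode as source.\<close>

lemma schroedinger_norm_derivative:
  assumes "finite \<Lambda>" and "\<And>i j. i \<in> \<Lambda> \<Longrightarrow> j \<in> \<Lambda> \<Longrightarrow> h j i = cnj (h i j)"
    and "\<And>\<nu>. \<nu> \<notin> cutoff st \<Lambda> n \<Longrightarrow> \<xi> \<nu> = 0"
    and "\<And>\<nu>. \<nu> \<in> cutoff st \<Lambda> n \<Longrightarrow> \<xi>' \<nu> = - \<i> * hamiltonian st \<Lambda> h \<xi> \<nu> + \<i> * F \<nu>"
  shows "(\<Sum>\<nu>\<in>cutoff st \<Lambda> n. cnj (\<xi>' \<nu>) * \<xi> \<nu> + cnj (\<xi> \<nu>) * \<xi>' \<nu>)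
    = (\<Sum>\<nu>\<in>cutoff st \<Lambda> n. cnj (\<i> * F \<nu>) * \<xi> \<nu> + cnj (\<xi> \<nu>) * (\<i> * F \<nu>))"
proof -
  let ?S = "cutoff st \<Lambda> n"
  have "(\<Sum>\<nu>\<in>?S. cnj (\<xi>' \<nu>) * \<xi> \<nu> + cnj (\<xi> \<nu>) * \<xi>' \<nu>)
      = (\<Sum>\<nu>\<in>?S. (cnj (\<i> * F \<nu>) * \<xi> \<nu> + cnj (\<xi> \<nu>) * (\<i> * F \<nu>))
          + \<i> * (cnj (hamiltonian st \<Lambda> h \<xi> \<nu>) * \<xi> \<nu>) + (- \<i>) * (cnj (\<xi> \<nu>) * hamiltonian st \<Lambda> h \<xi> \<nu>))"
    by (intro sum.cong refl) (simp add: assms(4) algebra_simps)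
  also have "\<dots> = (\<Sum>\<nu>\<in>?S. cnj (\<i> * F \<nu>) * \<xi> \<nu> + cnj (\<xi> \<nu>) * (\<i> * F \<nu>))
      + \<i> * (\<Sum>\<nu>\<in>?S. cnj (hamiltonian st \<Lambda> h \<xi> \<nu>) * \<xi> \<nu>) + (- \<i>) * (\<Sum>\<nu>\<in>?S. cnj (\<xi> \<nu>) * hamiltonian st \<Lambda> h \<xi> \<nu>)"
    by (simp only: sum.distrib sum_distrib_left)
  also have "(\<Sum>\<nu>\<in>?S. cnj (\<xi> \<nu>) * hamiltonian st \<Lambda> h \<xi> \<nu>) = (\<Sum>\<nu>\<in>?S. cnj (hamiltonian st \<Lambda> h \<xi> \<nu>) * \<xi> \<nu>)"
    by (rule hamiltonian_symmetric[OF assms(1-3,3)])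
  finally show ?thesis by simp
qed

text \<open>Interpreted for the full and for the truncated Hamiltonian, with the same initial
  state.\<close>

locale fock_evolution =
  fixes st :: statistics and \<Lambda> :: "nat set" and n :: nat and T :: real
    and h :: "real \<Rightarrow> nat \<Rightarrow> nat \<Rightarrow> complex" and \<psi> :: "real \<Rightarrow> fock_vec"
  assumes fin: "finite \<Lambda>" and T: "0 \<le> T"
    and herm: "\<And>t i j. 0 \<le> t \<Longrightarrow> t \<le> T \<Longrightarrow> i \<in> \<Lambda> \<Longrightarrow> j \<in> \<Lambda> \<Longrightarrow> h t j i = cnj (h t i j)"
    and \<psi>: "\<And>\<nu>. primitive_on T (\<lambda>t. \<psi> t \<nu>) (\<lambda>t. - \<i> * hamiltonian st \<Lambda> (h t) (\<psi> t) \<nu>)"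
    and outside: "\<And>t \<nu>. \<nu> \<notin> cutoff st \<Lambda> n \<Longrightarrow> \<psi> t \<nu> = 0"
    and norm_0: "(\<Sum>\<nu>\<in>cutoff st \<Lambda> n. (cmod (\<psi> 0 \<nu>))\<^sup>2) = 1"
begin

lemma norm_one:
  assumes t: "0 \<le> t" "t \<le> T"
  shows "(\<Sum>\<nu>\<in>cutoff st \<Lambda> n. (cmod (\<psi> t \<nu>))\<^sup>2) = 1"
proof -
  let ?S = "cutoff st \<Lambda> n"
  have "primitive_on T (\<lambda>t. of_real (\<Sum>\<nu>\<in>?S. (cmod (\<psi> t \<nu>))\<^sup>2)) (\<lambda>_. 0)"
  proof (rule primitive_on_cong[OF sum_cmod_square_primitive[OF \<psi>] refl])
    fix s assume s: "0 \<le> s" "s \<le> T"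
    show "(\<Sum>\<nu>\<in>?S. cnj (- \<i> * hamiltonian st \<Lambda> (h s) (\<psi> s) \<nu>) * \<psi> s \<nu>
        + cnj (\<psi> s \<nu>) * (- \<i> * hamiltonian st \<Lambda> (h s) (\<psi> s) \<nu>)) = 0"
      by (subst schroedinger_norm_derivative[OF fin herm[OF s] outside, where F = "\<lambda>_. 0"]) simp_all
  qed
  from primitive_on_eq[OF this t]
  have "complex_of_real (\<Sum>\<nu>\<in>?S. (cmod (\<psi> t \<nu>))\<^sup>2) = of_real (\<Sum>\<nu>\<in>?S. (cmod (\<psi> 0 \<nu>))\<^sup>2)"
    by (simp del: of_real_sum)
  then show ?thesis using norm_0 by (simp only: of_real_eq_iff)
qed

text \<open>If \<open>w\<close> were transported backwards by \<open>h\<close> itself, \<open>field w \<psi>\<close> would solve the Schroedinger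
  equation and keep its norm; the defect is governed by \<open>w (g - h)\<close>.\<close>

lemma field_norm_drift:
  assumes t: "0 \<le> t" "t \<le> T"
    and w: "\<And>j. j \<in> \<Lambda> \<Longrightarrow> primitive_on t (\<lambda>s. w s j) (\<lambda>s. \<i> * (\<Sum>k\<in>\<Lambda>. w s k * g s k j))"
    and w1: "\<And>s. 0 \<le> s \<Longrightarrow> s \<le> t \<Longrightarrow> (\<Sum>j\<in>\<Lambda>. (cmod (w s j))\<^sup>2) = 1"
    and B: "0 \<le> B" "\<And>s. 0 \<le> s \<Longrightarrow> s \<le> t \<Longrightarrow> (\<Sum>l\<in>\<Lambda>. (cmod (\<Sum>k\<in>\<Lambda>. w s k * (g s k l - h s k l)))\<^sup>2) \<le> B\<^sup>2"
  shows "\<bar>(\<Sum>\<nu>\<in>cutoff st \<Lambda> n. (cmod (field st \<Lambda> (w t) (\<psi> t) \<nu>))\<^sup>2)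
    - (\<Sum>\<nu>\<in>cutoff st \<Lambda> n. (cmod (field st \<Lambda> (w 0) (\<psi> 0) \<nu>))\<^sup>2)\<bar> \<le> 2 * real n * B * t"
proof -
  let ?S = "cutoff st \<Lambda> n"
  define \<xi> where "\<xi> = (\<lambda>s. field st \<Lambda> (w s) (\<psi> s))"
  define v where "v = (\<lambda>s l. \<Sum>k\<in>\<Lambda>. w s k * (g s k l - h s k l))"
  define \<xi>' where "\<xi>' = (\<lambda>s \<nu>. \<Sum>j\<in>\<Lambda>. (\<i> * (\<Sum>k\<in>\<Lambda>. w s k * g s k j)) * annihilate st j (\<psi> s) \<nu>
      + w s j * annihilate st j (\<lambda>\<nu>. - \<i> * hamiltonian st \<Lambda> (h s) (\<psi> s) \<nu>) \<nu>)"
  have prim: "primitive_on t (\<lambda>s. \<xi> s \<nu>) (\<lambda>s. \<xi>' s \<nu>)" for \<nu>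
    unfolding \<xi>_def \<xi>'_def field_def
    by (intro primitive_on_sum primitive_on_mult w annihilate_primitive primitive_on_mono[OF \<psi> t(2)])
  have out: "\<xi> s \<nu> = 0" if "\<nu> \<notin> ?S" for s \<nu>
    unfolding \<xi>_def by (rule field_outside_cutoff[OF fin outside that])
  \<comment> \<open>The commutator with the Hamiltonian produces the coefficients w h, the motion of
    \<open>w\<close> produces w g; their difference \<open>v\<close> acts as a source.\<close>
  have \<xi>': "\<xi>' s \<nu> = - \<i> * hamiltonian st \<Lambda> (h s) (\<xi> s) \<nu> + \<i> * field st \<Lambda> (v s) (\<psi> s) \<nu>"
    if "\<nu> \<in> ?S" for s \<nu>
  proof -
    have c: "\<nu> \<in> configs st \<Lambda>" using that by (simp add: cutoff_def)
    have ann: "annihilate st j (\<lambda>\<nu>. - \<i> * hamiltonian st \<Lambda> (h s) (\<psi> s) \<nu>) \<nu>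
        = - \<i> * (hamiltonian st \<Lambda> (h s) (annihilate st j (\<psi> s)) \<nu>
            + (\<Sum>l\<in>\<Lambda>. h s j l * annihilate st l (\<psi> s) \<nu>))" if "j \<in> \<Lambda>" for j
      using annihilate_sum[where K = "{()}" and c = "\<lambda>_. - \<i>" and f = "\<lambda>_. hamiltonian st \<Lambda> (h s) (\<psi> s)"
          and st = st and j = j and \<nu> = \<nu>] annihilate_hamiltonian[OF c fin that]
      by simp
    have "\<xi>' s \<nu> = (\<Sum>j\<in>\<Lambda>. - \<i> * (w s j * hamiltonian st \<Lambda> (h s) (annihilate st j (\<psi> s)) \<nu>)
        + \<i> * ((\<Sum>k\<in>\<Lambda>. w s k * g s k j) * annihilate st j (\<psi> s) \<nu>)
        + - \<i> * (\<Sum>l\<in>\<Lambda>. w s j * h s j l * annihilate st l (\<psi> s) \<nu>))"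
      unfolding \<xi>'_def by (intro sum.cong refl) (simp only: ann, simp add: algebra_simps sum_distrib_left sum_negf)
    also have "\<dots> = - \<i> * hamiltonian st \<Lambda> (h s) (\<xi> s) \<nu>
        + \<i> * (\<Sum>j\<in>\<Lambda>. (\<Sum>k\<in>\<Lambda>. w s k * g s k j) * annihilate st j (\<psi> s) \<nu>)
        + - \<i> * (\<Sum>j\<in>\<Lambda>. \<Sum>l\<in>\<Lambda>. w s j * h s j l * annihilate st l (\<psi> s) \<nu>)"
      unfolding \<xi>_def hamiltonian_field by (simp only: sum.distrib sum_distrib_left)
    also have "(\<Sum>j\<in>\<Lambda>. \<Sum>l\<in>\<Lambda>. w s j * h s j l * annihilate st l (\<psi> s) \<nu>)
        = (\<Sum>l\<in>\<Lambda>. (\<Sum>j\<in>\<Lambda>. w s j * h s j l) * annihilate st l (\<psi> s) \<nu>)"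
      unfolding sum_distrib_right by (rule sum.swap)
    finally show ?thesis
      by (simp add: field_def v_def right_diff_distrib left_diff_distrib sum_subtractf)
  qed
  define P where "P = (\<lambda>s. \<Sum>\<nu>\<in>?S. (cmod (\<xi> s \<nu>))\<^sup>2)"
  have P: "primitive_on t (\<lambda>s. of_real (P s)) (\<lambda>s. \<Sum>\<nu>\<in>?S. cnj (\<xi>' s \<nu>) * \<xi> s \<nu> + cnj (\<xi> s \<nu>) * \<xi>' s \<nu>)"
    unfolding P_def by (rule sum_cmod_square_primitive[OF prim])
  have "cmod (of_real (P t) - of_real (P 0)) \<le> (2 * real n * B) * t"
  proof (rule primitive_on_bound[OF P t(1)])
    fix s assume s: "0 \<le> s" "s \<le> t"
    let ?F = "field st \<Lambda> (v s) (\<psi> s)"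
    have sT: "0 \<le> s" "s \<le> T" using s t by auto
    have "cmod (\<Sum>\<nu>\<in>?S. cnj (\<xi>' s \<nu>) * \<xi> s \<nu> + cnj (\<xi> s \<nu>) * \<xi>' s \<nu>)
        = cmod (\<Sum>\<nu>\<in>?S. cnj (\<i> * ?F \<nu>) * \<xi> s \<nu> + cnj (\<xi> s \<nu>) * (\<i> * ?F \<nu>))"
      by (subst schroedinger_norm_derivative[OF fin herm[OF sT] out \<xi>']) simp_all
    also have "\<dots> \<le> (\<Sum>\<nu>\<in>?S. 2 * (cmod (\<xi> s \<nu>) * cmod (?F \<nu>)))"
    proof (rule sum_norm_le)
      fix \<nu>
      have "cmod (cnj (\<i> * ?F \<nu>) * \<xi> s \<nu> + cnj (\<xi> s \<nu>) * (\<i> * ?F \<nu>))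
          \<le> cmod (cnj (\<i> * ?F \<nu>) * \<xi> s \<nu>) + cmod (cnj (\<xi> s \<nu>) * (\<i> * ?F \<nu>))"
        by (rule norm_triangle_ineq)
      then show "cmod (cnj (\<i> * ?F \<nu>) * \<xi> s \<nu> + cnj (\<xi> s \<nu>) * (\<i> * ?F \<nu>)) \<le> 2 * (cmod (\<xi> s \<nu>) * cmod (?F \<nu>))"
        by (simp add: norm_mult mult.commute)
    qed
    also have "\<dots> = 2 * (\<Sum>\<nu>\<in>?S. cmod (\<xi> s \<nu>) * cmod (?F \<nu>))"
      by (simp only: sum_distrib_left)
    also have "(\<Sum>\<nu>\<in>?S. cmod (\<xi> s \<nu>) * cmod (?F \<nu>)) \<le> real n * B"
    proof (rule power2_le_imp_le)
      have "(\<Sum>\<nu>\<in>?S. cmod (\<xi> s \<nu>) * cmod (?F \<nu>))\<^sup>2 \<le> (\<Sum>\<nu>\<in>?S. (cmod (\<xi> s \<nu>))\<^sup>2) * (\<Sum>\<nu>\<in>?S. (cmod (?F \<nu>))\<^sup>2)"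
        by (rule Cauchy_Schwarz_ineq_sum)
      \<comment> \<open>Each of the two fields contributes a factor \<open>n\<close> to the squared
        overlap; the square root leaves a single \<open>n\<close> and the norm of the
        defect.\<close>
      also have "\<dots> \<le> (real n * (\<Sum>j\<in>\<Lambda>. (cmod (w s j))\<^sup>2) * (\<Sum>\<nu>\<in>?S. (cmod (\<psi> s \<nu>))\<^sup>2))
          * (real n * (\<Sum>j\<in>\<Lambda>. (cmod (v s j))\<^sup>2) * (\<Sum>\<nu>\<in>?S. (cmod (\<psi> s \<nu>))\<^sup>2))"
        unfolding \<xi>_def by (intro mult_mono field_norm_le fin outside mult_nonneg_nonneg sum_nonneg) auto
      also have "\<dots> = (real n)\<^sup>2 * (\<Sum>j\<in>\<Lambda>. (cmod (v s j))\<^sup>2)"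
        unfolding w1[OF s] norm_one[OF sT] by (simp add: power2_eq_square[of "real n"])
      also have "\<dots> \<le> (real n)\<^sup>2 * B\<^sup>2"
        using B(2)[OF s] unfolding v_def by (intro mult_left_mono) auto
      also have "\<dots> = (real n * B)\<^sup>2" by (rule power_mult_distrib[symmetric])
      finally show "(\<Sum>\<nu>\<in>?S. cmod (\<xi> s \<nu>) * cmod (?F \<nu>))\<^sup>2 \<le> (real n * B)\<^sup>2" .
      show "0 \<le> real n * B" using B(1) by simp
    qed
    finally show "cmod (\<Sum>\<nu>\<in>?S. cnj (\<xi>' s \<nu>) * \<xi> s \<nu> + cnj (\<xi> s \<nu>) * \<xi>' s \<nu>) \<le> 2 * real n * B"
      by simp
  qed
  then show ?thesis
    by (simp only: norm_of_real of_real_diff[symmetric] P_def \<xi>_def)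
qed

text \<open>Writes the density as the kind of norm that \<open>field_norm_drift\<close> controls,
  with coefficients concentrated at \<open>q\<close>.\<close>

lemma occupation:
  assumes "q \<in> \<Lambda>"
  shows "braket st \<Lambda> (\<psi> t) (create st q (annihilate st q (\<psi> t)))
    = of_real (\<Sum>\<nu>\<in>cutoff st \<Lambda> n. (cmod (annihilate st q (\<psi> t) \<nu>))\<^sup>2)"
proof -
  have sq: "complex_of_real ((cmod z)\<^sup>2) = cnj z * z" for z
    by (metis complex_norm_square mult.commute)
  have "braket st \<Lambda> (\<psi> t) (create st q (annihilate st q (\<psi> t)))
      = braket st \<Lambda> (annihilate st q (\<psi> t)) (annihilate st q (\<psi> t))"
    using assms by (simp add: hopping_adjoint create_adjoint)
  also have "\<dots> = (\<Sum>\<nu>\<in>cutoff st \<Lambda> n. cnj (annihilate st q (\<psi> t) \<nu>) * annihilate st q (\<psi> t) \<nu>)"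
    by (intro braket_cutoff[OF fin] disjI1) (rule annihilate_outside_cutoff[OF fin assms outside])
  finally show ?thesis by (simp only: of_real_sum sq)
qed

text \<open>The density is itself a primitive, hence continuous. Integrability is what allows the
  two outputs to be merged into one integral.\<close>

lemma occupation_integrable:
  assumes "q \<in> \<Lambda>"
  shows "(\<lambda>t. braket st \<Lambda> (\<psi> t) (create st q (annihilate st q (\<psi> t)))) integrable_on {0..T}"
proof -
  have "primitive_on T (\<lambda>t. of_real (\<Sum>\<nu>\<in>cutoff st \<Lambda> n. (cmod (annihilate st q (\<psi> t) \<nu>))\<^sup>2))
    (\<lambda>t. \<Sum>\<nu>\<in>cutoff st \<Lambda> n.
      cnj (annihilate st q (\<lambda>\<nu>. - \<i> * hamiltonian st \<Lambda> (h t) (\<psi> t) \<nu>) \<nu>) * annihilate st q (\<psi> t) \<nu>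
      + cnj (annihilate st q (\<psi> t) \<nu>) * annihilate st q (\<lambda>\<nu>. - \<i> * hamiltonian st \<Lambda> (h t) (\<psi> t) \<nu>) \<nu>)"
    by (intro sum_cmod_square_primitive annihilate_primitive \<psi>)
  from primitive_on_continuous[OF this] show ?thesis
    unfolding occupation[OF assms] by (rule integrable_continuous_real)
qed

end

section \<open>Truncation error\<close>

text \<open>Writing the truncation as zeroed matrix elements keeps both evolutions on the same sites
  and in the same Fock space.\<close>

lemma hamiltonian_restrict:
  assumes "finite \<Lambda>" "X \<subseteq> \<Lambda>"
  shows "hamiltonian st X h = hamiltonian st \<Lambda> (\<lambda>i j. if i \<in> X \<and> j \<in> X then h i j else 0)"
proof (intro ext)
  fix \<psi> \<nu>
  have "hamiltonian st \<Lambda> (\<lambda>i j. if i \<in> X \<and> j \<in> X then h i j else 0) \<psi> \<nu>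
      = (\<Sum>i\<in>X. \<Sum>j\<in>\<Lambda>. (if i \<in> X \<and> j \<in> X then h i j else 0) * create st i (annihilate st j \<psi>) \<nu>)"
    unfolding hamiltonian_def using assms by (intro sum.mono_neutral_right) auto
  also have "\<dots> = hamiltonian st X h \<psi> \<nu>"
    unfolding hamiltonian_def using assms by (intro sum.cong sum.mono_neutral_cong_right) auto
  finally show "hamiltonian st X h \<psi> \<nu> = hamiltonian st \<Lambda> (\<lambda>i j. if i \<in> X \<and> j \<in> X then h i j else 0) \<psi> \<nu>"
    by simp
qed

context hopping
begin

text \<open>Both bounds rest on Schur's test. The first treats all surviving hops alike and serves
  radii below 1, where no decay in \<open>R\<close> is needed; the second keeps the far amplitude as
  a separate factor for the transport bound.\<close>

lemma truncation_defect:
  fixes q :: nat and R :: real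
  defines "X \<equiv> {i \<in> \<Lambda>. d i q \<le> R}"
  assumes q: "q \<in> \<Lambda>"
    and c: "\<And>i. i \<in> \<Lambda> \<Longrightarrow> i \<notin> X \<Longrightarrow> c i = 0" "(\<Sum>i\<in>\<Lambda>. (cmod (c i))\<^sup>2) = 1"
    and g: "\<And>i k. i \<in> \<Lambda> \<Longrightarrow> k \<in> \<Lambda> \<Longrightarrow> i \<noteq> k \<Longrightarrow> cmod (g i k) \<le> J * d i k powr (- \<alpha>)"
    and K0: "\<And>i. i \<in> \<Lambda> \<Longrightarrow> (\<Sum>j\<in>\<Lambda> - {i}. d i j powr (- \<alpha>)) \<le> K0"
  defines "defect \<equiv> \<Sum>j\<in>\<Lambda>. (cmod (\<Sum>k\<in>\<Lambda>. c k * ((if k \<in> X \<and> j \<in> X then g k j else 0) - g k j)))\<^sup>2"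
  shows "defect \<le> (J * K0)\<^sup>2"
    and "(\<And>i. i \<in> \<Lambda> \<Longrightarrow> (\<Sum>j | j \<in> \<Lambda> \<and> j \<noteq> i \<and> R / 2 < d i j. d i j powr (- \<alpha>)) \<le> \<tau>) \<Longrightarrow>
      defect \<le> 2 * (J * \<tau>)\<^sup>2 + 2 * (J * K0)\<^sup>2 * (\<Sum>i\<in>\<Lambda>. if R / 2 < d i q then (cmod (c i))\<^sup>2 else 0)"
proof -
  let ?z = "\<lambda>j. \<Sum>k\<in>\<Lambda>. c k * ((if k \<in> X \<and> j \<in> X then g k j else 0) - g k j)"
  have hop: "cmod (c k * ((if k \<in> X \<and> j \<in> X then g k j else 0) - g k j)) \<le> J * (kernel \<alpha> k j * cmod (c k))"
    if "k \<in> \<Lambda>" "j \<in> \<Lambda>" for k j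
  \<comment> \<open>For every other pair the contribution is zero: either the matrix elements agree
    or \<open>c k\<close> vanishes.\<close>
  proof (cases "k \<in> X \<and> j \<notin> X")
    case True
    then have "k \<noteq> j" by auto
    then show ?thesis
      using mult_right_mono[OF g[OF that], of "cmod (c k)"] True by (simp add: norm_mult kernel_def mult_ac)
  next
    case False
    then have "c k * ((if k \<in> X \<and> j \<in> X then g k j else 0) - g k j) = 0"
      using c(1) that by auto
    then have "cmod (c k * ((if k \<in> X \<and> j \<in> X then g k j else 0) - g k j)) = 0"
      by (simp only: norm_zero)
    then show ?thesis using J by (simp only: kernel_nonneg mult_nonneg_nonneg norm_ge_zero)
  qed
  have z: "cmod (?z j) \<le> J * (\<Sum>k\<in>\<Lambda>. kernel \<alpha> k j * cmod (c k))" if "j \<in> \<Lambda>" for j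
    unfolding sum_distrib_left using hop that by (intro sum_norm_le) auto
  have "defect \<le> (\<Sum>j\<in>\<Lambda>. J\<^sup>2 * (\<Sum>k\<in>\<Lambda>. kernel \<alpha> k j * cmod (c k))\<^sup>2)"
    unfolding defect_def power_mult_distrib[symmetric] by (intro sum_mono power_mono z) auto
  also have "\<dots> \<le> J\<^sup>2 * (K0\<^sup>2 * (\<Sum>k\<in>\<Lambda>. (cmod (c k))\<^sup>2))"
    unfolding sum_distrib_left[symmetric]
    by (intro mult_left_mono schur_norm) (auto simp: kernel_nonneg kernel_row kernel_col K0)
  finally show "defect \<le> (J * K0)\<^sup>2"
    by (simp add: c(2) power_mult_distrib)
  assume \<tau>: "\<And>i. i \<in> \<Lambda> \<Longrightarrow> (\<Sum>j | j \<in> \<Lambda> \<and> j \<noteq> i \<and> R / 2 < d i j. d i j powr (- \<alpha>)) \<le> \<tau>"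
  define far where "far = (\<lambda>k j. if k \<noteq> j \<and> R / 2 < d k j then d k j powr (- \<alpha>) else 0)"
  define b where "b = (\<lambda>k. if R / 2 < d k q then cmod (c k) else 0)"
  have far_nonneg: "0 \<le> far k j" for k j by (simp add: far_def)
  have far_sym: "far k j = far j k" for k j using dist_commute[of k j] by (auto simp: far_def)
  have far_row: "(\<Sum>j\<in>\<Lambda>. far i j) \<le> \<tau>" if "i \<in> \<Lambda>" for i
  proof -
    have "(\<Sum>j\<in>\<Lambda>. far i j) = (\<Sum>j | j \<in> \<Lambda> \<and> j \<noteq> i \<and> R / 2 < d i j. d i j powr (- \<alpha>))"
      using finite_sites by (intro sum.mono_neutral_cong_right) (auto simp: far_def)
    then show ?thesis using \<tau>[OF that] by simp
  qed
  have far_col: "(\<Sum>i\<in>\<Lambda>. far i j) \<le> \<tau>" if "j \<in> \<Lambda>" for j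
    using far_row[OF that] by (subst far_sym)
  have hop2: "cmod (c k * ((if k \<in> X \<and> j \<in> X then g k j else 0) - g k j))
      \<le> J * (far k j * cmod (c k)) + J * (kernel \<alpha> k j * b k)"
    if kj: "k \<in> \<Lambda>" "j \<in> \<Lambda>" for k j
  proof (cases "k \<in> X \<and> j \<notin> X \<and> d k q \<le> R / 2")
    case True
    then have "k \<noteq> j" by auto
    \<comment> \<open>A start within R/2 of \<open>q\<close> and an end beyond R force a length
      above R/2.\<close>
    moreover have "R / 2 < d k j"
      using True dist_triangle[OF kj(2,1) q] dist_commute[of k j] kj by (auto simp: X_def)
    ultimately have "kernel \<alpha> k j = far k j" "b k = 0" using True by (auto simp: kernel_def far_def b_def)
    then show ?thesis using hop[OF kj] by simp
  next
    case False
    show ?thesis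
    proof (cases "k \<in> X \<and> j \<notin> X")
      case True
      then have "b k = cmod (c k)" using False by (auto simp: b_def)
      then show ?thesis using hop[OF kj] J far_nonneg[of k j] by (simp add: add_increasing)
    next
      case False
      then have "c k * ((if k \<in> X \<and> j \<in> X then g k j else 0) - g k j) = 0"
        using c(1) kj by auto
      then have "cmod (c k * ((if k \<in> X \<and> j \<in> X then g k j else 0) - g k j)) = 0"
        by (simp only: norm_zero)
      moreover have "0 \<le> b k" by (simp add: b_def)
      ultimately show ?thesis
        using J by (simp only: kernel_nonneg far_nonneg mult_nonneg_nonneg add_nonneg_nonneg norm_ge_zero)
    qed
  qed
  have z2: "cmod (?z j) \<le> J * (\<Sum>k\<in>\<Lambda>. far k j * cmod (c k)) + J * (\<Sum>k\<in>\<Lambda>. kernel \<alpha> k j * b k)"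
    if "j \<in> \<Lambda>" for j
    unfolding sum_distrib_left sum.distrib[symmetric] using hop2 that by (intro sum_norm_le) auto
  have "defect \<le> (\<Sum>j\<in>\<Lambda>. 2 * J\<^sup>2 * (\<Sum>k\<in>\<Lambda>. far k j * cmod (c k))\<^sup>2 + 2 * J\<^sup>2 * (\<Sum>k\<in>\<Lambda>. kernel \<alpha> k j * b k)\<^sup>2)"
    unfolding defect_def
  proof (rule sum_mono)
    fix j assume j: "j \<in> \<Lambda>"
    let ?x = "J * (\<Sum>k\<in>\<Lambda>. far k j * cmod (c k))" and ?y = "J * (\<Sum>k\<in>\<Lambda>. kernel \<alpha> k j * b k)"
    have "(cmod (?z j))\<^sup>2 \<le> (?x + ?y)\<^sup>2" using z2[OF j] by (intro power_mono) auto
    also have "\<dots> \<le> 2 * ?x\<^sup>2 + 2 * ?y\<^sup>2"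
      using sum_squares_bound[of ?x ?y] by (simp add: power2_sum)
    finally show "(cmod (?z j))\<^sup>2 \<le> 2 * J\<^sup>2 * (\<Sum>k\<in>\<Lambda>. far k j * cmod (c k))\<^sup>2 + 2 * J\<^sup>2 * (\<Sum>k\<in>\<Lambda>. kernel \<alpha> k j * b k)\<^sup>2"
      by (simp add: power_mult_distrib)
  qed
  also have "\<dots> \<le> 2 * J\<^sup>2 * (\<tau>\<^sup>2 * (\<Sum>k\<in>\<Lambda>. (cmod (c k))\<^sup>2)) + 2 * J\<^sup>2 * (K0\<^sup>2 * (\<Sum>k\<in>\<Lambda>. (b k)\<^sup>2))"
    unfolding sum.distrib sum_distrib_left[symmetric]
    by (intro add_mono mult_left_mono schur_norm)
      (auto simp: kernel_nonneg kernel_row kernel_col K0 far_nonneg far_row far_col)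
  also have "(\<Sum>k\<in>\<Lambda>. (b k)\<^sup>2) = (\<Sum>i\<in>\<Lambda>. if R / 2 < d i q then (cmod (c i))\<^sup>2 else 0)"
    by (intro sum.cong) (auto simp: b_def)
  finally show "defect \<le> 2 * (J * \<tau>)\<^sup>2 + 2 * (J * K0)\<^sup>2 * (\<Sum>i\<in>\<Lambda>. if R / 2 < d i q then (cmod (c i))\<^sup>2 else 0)"
    by (simp add: c(2) power_mult_distrib)
qed

end

text \<open>\<open>B\<close> stands for a bound on the norm of the mode defect. The disjunction
  lists the two ways of obtaining it, so that small and large radii share the many-body argument.
  One factor \<open>T\<close> comes from the drift up to the observation time, the other from
  integrating the output.\<close>

lemma dense_output_truncation:
  fixes st :: statistics and \<psi>\<^sub>0 :: fock_vec and h :: "real \<Rightarrow> nat \<Rightarrow> nat \<Rightarrow> complex"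
  assumes lat: "hopping \<Lambda> d J" and T: "0 \<le> T" and q: "q \<in> \<Lambda>" and R: "0 < R"
    and h_int: "\<forall>i\<in>\<Lambda>. \<forall>j\<in>\<Lambda>. (\<lambda>t. h t i j) absolutely_integrable_on {0..T}"
    and herm: "\<forall>t\<in>{0..T}. \<forall>i\<in>\<Lambda>. \<forall>j\<in>\<Lambda>. h t j i = cnj (h t i j)"
    and decay: "\<forall>t\<in>{0..T}. \<forall>i\<in>\<Lambda>. \<forall>j\<in>\<Lambda>. i \<noteq> j \<longrightarrow> cmod (h t i j) \<le> J * d i j powr (- \<alpha>)"
    and \<psi>\<^sub>0: "\<psi>\<^sub>0 \<in> fock_le st \<Lambda> n" "braket st \<Lambda> \<psi>\<^sub>0 \<psi>\<^sub>0 = 1"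
    and K0: "\<And>i. i \<in> \<Lambda> \<Longrightarrow> (\<Sum>j\<in>\<Lambda> - {i}. d i j powr (- \<alpha>)) \<le> K0" "0 \<le> K0"
    and B: "0 \<le> B" "J * K0 \<le> B \<or> (p > 1 \<and> v * T \<le> R / 4 \<and> 0 \<le> v \<and> 2 powr p * J * K1 \<le> v \<and>
      (\<forall>i\<in>\<Lambda>. (\<Sum>j\<in>\<Lambda> - {i}. d i j powr (- (\<alpha> - 1))) \<le> K1) \<and>
      (\<forall>i\<in>\<Lambda>. (\<Sum>j\<in>\<Lambda> - {i}. d i j powr (- (\<alpha> - p))) \<le> Kp) \<and> 0 \<le> Kp \<and>
      (\<forall>i\<in>\<Lambda>. (\<Sum>j | j \<in> \<Lambda> \<and> j \<noteq> i \<and> R / 2 < d i j. d i j powr (- \<alpha>)) \<le> \<tau>) \<and>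
      2 * (J * \<tau>)\<^sup>2 + 2 * (J * K0)\<^sup>2 * (2 powr p * J * Kp * T * (R / 4) powr (- p)) \<le> B\<^sup>2)"
  defines "X \<equiv> {i \<in> \<Lambda>. d i q \<le> R}"
    and "Obs \<equiv> \<lambda>\<psi>. create st q (annihilate st q \<psi>)"
  shows "cmod (dense_output st \<Lambda> T \<psi>\<^sub>0 (\<lambda>t. hamiltonian st \<Lambda> (h t)) Obs
    - dense_output st \<Lambda> T \<psi>\<^sub>0 (\<lambda>t. hamiltonian st X (h t)) Obs) \<le> 2 * real n * B * T * T"
proof -
  interpret hopping \<Lambda> d J by (rule lat)
  let ?S = "cutoff st \<Lambda> n"
  define g where "g = (\<lambda>t i j. if i \<in> X \<and> j \<in> X then h t i j else 0)"
  note out0 = fock_le_outside_cutoff[OF \<psi>\<^sub>0(1)]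
  have X: "X \<subseteq> \<Lambda>" by (auto simp: X_def)
  have qX: "q \<in> X" using q R Metric_space.mdist_zero[OF metric q] by (simp add: X_def)
  have g_int: "(\<lambda>t. g t i j) absolutely_integrable_on {0..T}" if "i \<in> \<Lambda>" "j \<in> \<Lambda>" for i j
    using h_int that by (cases "i \<in> X \<and> j \<in> X") (auto simp: g_def)
  have h_herm: "h t j i = cnj (h t i j)" if "0 \<le> t" "t \<le> T" "i \<in> \<Lambda>" "j \<in> \<Lambda>" for t i j
  proof -
    have "t \<in> {0..T}" using that by simp
    with herm that(3,4) show ?thesis by blast
  qed
  have g_herm: "g t j i = cnj (g t i j)" if "0 \<le> t" "t \<le> T" "i \<in> \<Lambda>" "j \<in> \<Lambda>" for t i j
    using h_herm[OF that] by (simp add: g_def)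
  have g_decay: "cmod (g t i j) \<le> J * d i j powr (- \<alpha>)"
    if "0 \<le> t" "t \<le> T" "i \<in> \<Lambda>" "j \<in> \<Lambda>" "i \<noteq> j" for t i j
    using decay J that by (auto simp: g_def)
  have HX: "(\<lambda>t. hamiltonian st X (h t)) = (\<lambda>t. hamiltonian st \<Lambda> (g t))"
    by (simp add: hamiltonian_restrict[OF finite_sites X] g_def)
  define \<psi> where "\<psi> = (\<lambda>t. propagator (\<lambda>t. hamiltonian st \<Lambda> (h t)) t \<psi>\<^sub>0)"
  define \<phi> where "\<phi> = (\<lambda>t. propagator (\<lambda>t. hamiltonian st \<Lambda> (g t)) t \<psi>\<^sub>0)"
  have norm_0: "(\<Sum>\<nu>\<in>?S. (cmod (\<psi>\<^sub>0 \<nu>))\<^sup>2) = 1"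
  proof -
    have sq: "complex_of_real ((cmod z)\<^sup>2) = cnj z * z" for z
      by (metis complex_norm_square mult.commute)
    have "complex_of_real (\<Sum>\<nu>\<in>?S. (cmod (\<psi>\<^sub>0 \<nu>))\<^sup>2) = braket st \<Lambda> \<psi>\<^sub>0 \<psi>\<^sub>0"
      using out0 by (subst braket_cutoff[OF finite_sites, of st n]) (auto simp only: of_real_sum sq)
    then show ?thesis using \<psi>\<^sub>0(2) by (simp only: of_real_eq_1_iff)
  qed
  have \<psi>_0: "\<psi> 0 = \<psi>\<^sub>0" and \<phi>_0: "\<phi> 0 = \<psi>\<^sub>0"
    unfolding \<psi>_def \<phi>_def using h_int g_int out0 T
    by (auto intro!: propagator_0[OF finite_sites])
  interpret \<psi>: fock_evolution st \<Lambda> n T h \<psi>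
  proof
    show "primitive_on T (\<lambda>t. \<psi> t \<nu>) (\<lambda>t. - \<i> * hamiltonian st \<Lambda> (h t) (\<psi> t) \<nu>)" for \<nu>
      unfolding \<psi>_def using h_int out0 by (intro propagator_primitive[OF finite_sites T]) auto
    show "\<psi> t \<nu> = 0" if "\<nu> \<notin> ?S" for t \<nu>
      unfolding \<psi>_def using h_int out0 that by (intro propagator_outside_cutoff[OF finite_sites T]) auto
    show "(\<Sum>\<nu>\<in>?S. (cmod (\<psi> 0 \<nu>))\<^sup>2) = 1"
      by (simp only: \<psi>_0 norm_0)
  qed (use h_herm T finite_sites in blast)+
  interpret \<phi>: fock_evolution st \<Lambda> n T g \<phi>
  proof
    show "primitive_on T (\<lambda>t. \<phi> t \<nu>) (\<lambda>t. - \<i> * hamiltonian st \<Lambda> (g t) (\<phi> t) \<nu>)" for \<nu>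
      unfolding \<phi>_def using g_int out0 by (intro propagator_primitive[OF finite_sites T]) auto
    show "\<phi> t \<nu> = 0" if "\<nu> \<notin> ?S" for t \<nu>
      unfolding \<phi>_def using g_int out0 that by (intro propagator_outside_cutoff[OF finite_sites T]) auto
    show "(\<Sum>\<nu>\<in>?S. (cmod (\<phi> 0 \<nu>))\<^sup>2) = 1"
      by (simp only: \<phi>_0 norm_0)
  qed (use g_herm T finite_sites in blast)+
  have bound: "cmod (braket st \<Lambda> (\<psi> t) (Obs (\<psi> t)) - braket st \<Lambda> (\<phi> t) (Obs (\<phi> t))) \<le> 2 * real n * B * t"
    if t: "0 \<le> t" "t \<le> T" for t
  proof -
    \<comment> \<open>The mode has to sit at \<open>q\<close> at the final time \<open>t\<close>, so
      the matrix is reversed in time; its coefficients multiply the matrix from the left, so it is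
      also transposed.\<close>
    define M where "M = (\<lambda>s j k. g (t - s) k j)"
    define e where "e = (\<lambda>i. if i = q then 1 else 0 :: complex)"
    define y where "y = dyson_sol M \<Lambda> e"
    have M_int: "(\<lambda>s. M s i k) absolutely_integrable_on {0..t}" if "i \<in> \<Lambda>" "k \<in> \<Lambda>" for i k
      unfolding M_def using t
      by (intro integral_reverse(1) absolutely_integrable_on_subinterval[OF g_int[OF that(2,1)]]) auto
    note y_sol = dyson_sol_primitive[OF finite_sites t(1) M_int]
    interpret one_particle \<Lambda> d J \<alpha> t M y q
    proof
      show "primitive_on t (\<lambda>s. y s i) (\<lambda>s. - \<i> * (\<Sum>k\<in>\<Lambda>. M s i k * y s k))" if "i \<in> \<Lambda>" for i
        unfolding y_def using that by (intro y_sol(1)) auto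
      show "y 0 i = (if i = q then 1 else 0)" if "i \<in> \<Lambda>" for i
        unfolding y_def using that by (subst y_sol(2)) (auto simp: e_def)
      show "M s k i = cnj (M s i k)" if "0 \<le> s" "s \<le> t" "i \<in> \<Lambda>" "k \<in> \<Lambda>" for s i k
        unfolding M_def using that t by (intro g_herm) auto
      show "cmod (M s i k) \<le> J * d i k powr (- \<alpha>)" if "0 \<le> s" "s \<le> t" "i \<in> \<Lambda>" "k \<in> \<Lambda>" "i \<noteq> k" for s i k
        unfolding M_def using g_decay[of "t - s" k i] that t dist_commute[of i k] by auto
    qed (rule q)
    \<comment> \<open>The rows of \<open>M\<close> outside the ball are zero and the mode starts
      inside, at \<open>q\<close>; its outer components therefore keep their initial value
      0.\<close>
    have y_out: "y s i = 0" if "0 \<le> s" "s \<le> t" "i \<in> \<Lambda>" "i \<notin> X" for s i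
    proof -
      have "(\<lambda>s. - \<i> * (\<Sum>k\<in>\<Lambda>. M s i k * y s k)) = (\<lambda>_. 0)"
        using that by (simp add: M_def g_def)
      then show ?thesis
        using primitive_on_eq[OF y[OF that(3)] that(1,2)] y0[OF that(3)] that(4) qX by auto
    qed
    define w where "w = (\<lambda>s. y (t - s))"
    have w: "primitive_on t (\<lambda>s. w s j) (\<lambda>s. \<i> * (\<Sum>k\<in>\<Lambda>. w s k * g s k j))" if "j \<in> \<Lambda>" for j
      using primitive_on_reverse[OF y[OF that]] by (simp add: w_def M_def mult.commute)
    have w1: "(\<Sum>j\<in>\<Lambda>. (cmod (w s j))\<^sup>2) = 1" if "0 \<le> s" "s \<le> t" for s
      unfolding w_def using that by (intro norm_one) auto
    have wt: "field st \<Lambda> (w t) \<xi> = annihilate st q \<xi>" for \<xi>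
    proof
      fix \<nu>
      have "field st \<Lambda> (w t) \<xi> \<nu> = (\<Sum>j\<in>\<Lambda>. if j = q then annihilate st q \<xi> \<nu> else 0)"
        unfolding field_def by (intro sum.cong) (auto simp: w_def y0)
      then show "field st \<Lambda> (w t) \<xi> \<nu> = annihilate st q \<xi> \<nu>"
        using finite_sites q by simp
    qed
    have defect: "(\<Sum>l\<in>\<Lambda>. (cmod (\<Sum>k\<in>\<Lambda>. w s k * (g s k l - h s k l)))\<^sup>2) \<le> B\<^sup>2" if s: "0 \<le> s" "s \<le> t" for s
    proof -
      have c: "w s i = 0" if "i \<in> \<Lambda>" "i \<notin> {i \<in> \<Lambda>. d i q \<le> R}" for i
        unfolding w_def using that s by (intro y_out) (auto simp: X_def)
      have h_decay: "cmod (h s i k) \<le> J * d i k powr (- \<alpha>)" if "i \<in> \<Lambda>" "k \<in> \<Lambda>" "i \<noteq> k" for i k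
        using decay that s t by auto
      note defect = truncation_defect[where q = q and R = R and c = "w s" and g = "h s",
          OF q c w1[OF s] h_decay K0(1)]
      from B(2) show ?thesis
      proof
        assume "J * K0 \<le> B"
        then have "(J * K0)\<^sup>2 \<le> B\<^sup>2" using J K0(2) by (intro power_mono) auto
        with defect(1) show ?thesis unfolding g_def X_def by (rule order_trans)
      next
        assume *: "p > 1 \<and> v * T \<le> R / 4 \<and> 0 \<le> v \<and> 2 powr p * J * K1 \<le> v \<and>
          (\<forall>i\<in>\<Lambda>. (\<Sum>j\<in>\<Lambda> - {i}. d i j powr (- (\<alpha> - 1))) \<le> K1) \<and>
          (\<forall>i\<in>\<Lambda>. (\<Sum>j\<in>\<Lambda> - {i}. d i j powr (- (\<alpha> - p))) \<le> Kp) \<and> 0 \<le> Kp \<and>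
          (\<forall>i\<in>\<Lambda>. (\<Sum>j | j \<in> \<Lambda> \<and> j \<noteq> i \<and> R / 2 < d i j. d i j powr (- \<alpha>)) \<le> \<tau>) \<and>
          2 * (J * \<tau>)\<^sup>2 + 2 * (J * K0)\<^sup>2 * (2 powr p * J * Kp * T * (R / 4) powr (- p)) \<le> B\<^sup>2"
        have "v * (t - s) \<le> v * T" using * s t by (intro mult_left_mono) auto
        then have "(\<Sum>i\<in>\<Lambda>. if R / 2 < d i q then (cmod (y (t - s) i))\<^sup>2 else 0)
            \<le> 2 powr p * J * Kp * (t - s) * (R / 4) powr (- p)"
          using * s R by (intro far_probability[of p K1]) auto
        also have "\<dots> \<le> 2 powr p * J * Kp * T * (R / 4) powr (- p)"
          using * s t J by (intro mult_right_mono mult_left_mono) auto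
        finally have "2 * (J * K0)\<^sup>2 * (\<Sum>i\<in>\<Lambda>. if R / 2 < d i q then (cmod (w s i))\<^sup>2 else 0)
            \<le> 2 * (J * K0)\<^sup>2 * (2 powr p * J * Kp * T * (R / 4) powr (- p))"
          unfolding w_def by (intro mult_left_mono) auto
        then have "2 * (J * \<tau>)\<^sup>2 + 2 * (J * K0)\<^sup>2 *
            (\<Sum>i\<in>\<Lambda>. if R / 2 < d i q then (cmod (w s i))\<^sup>2 else 0) \<le> B\<^sup>2"
          using * by linarith
        moreover have "(\<Sum>l\<in>\<Lambda>. (cmod (\<Sum>k\<in>\<Lambda>. w s k * (g s k l - h s k l)))\<^sup>2)
            \<le> 2 * (J * \<tau>)\<^sup>2 + 2 * (J * K0)\<^sup>2 *
              (\<Sum>i\<in>\<Lambda>. if R / 2 < d i q then (cmod (w s i))\<^sup>2 else 0)"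
          unfolding g_def X_def by (rule defect(2)) (use * in blast)+
        ultimately show ?thesis by linarith
      qed
    qed
    have "\<bar>(\<Sum>\<nu>\<in>?S. (cmod (field st \<Lambda> (w t) (\<psi> t) \<nu>))\<^sup>2) - (\<Sum>\<nu>\<in>?S. (cmod (field st \<Lambda> (w 0) (\<psi> 0) \<nu>))\<^sup>2)\<bar>
        \<le> 2 * real n * B * t"
      by (rule \<psi>.field_norm_drift[OF t w w1 B(1) defect])
    \<comment> \<open>Here the same \<open>g\<close> drives state and mode, so the defect is zero
      and the norm is conserved.\<close>
    moreover have "\<bar>(\<Sum>\<nu>\<in>?S. (cmod (field st \<Lambda> (w t) (\<phi> t) \<nu>))\<^sup>2) - (\<Sum>\<nu>\<in>?S. (cmod (field st \<Lambda> (w 0) (\<phi> 0) \<nu>))\<^sup>2)\<bar>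
        \<le> 2 * real n * 0 * t"
      by (rule \<phi>.field_norm_drift[OF t w w1]) simp_all
    \<comment> \<open>Both evolutions start from the same state and are tested with the same
      \<open>w 0\<close>, so the initial norms cancel in the difference.\<close>
    ultimately have "\<bar>(\<Sum>\<nu>\<in>?S. (cmod (annihilate st q (\<psi> t) \<nu>))\<^sup>2) - (\<Sum>\<nu>\<in>?S. (cmod (annihilate st q (\<phi> t) \<nu>))\<^sup>2)\<bar>
        \<le> 2 * real n * B * t"
      unfolding wt \<psi>_0 \<phi>_0 by linarith
    then show ?thesis
      unfolding Obs_def \<psi>.occupation[OF q] \<phi>.occupation[OF q] of_real_diff[symmetric] norm_of_real .
  qed
  have int: "(\<lambda>t. braket st \<Lambda> (\<psi> t) (Obs (\<psi> t))) integrable_on {0..T}"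
    "(\<lambda>t. braket st \<Lambda> (\<phi> t) (Obs (\<phi> t))) integrable_on {0..T}"
    unfolding Obs_def by (rule \<psi>.occupation_integrable[OF q], rule \<phi>.occupation_integrable[OF q])
  have "cmod (integral {0..T} (\<lambda>t. braket st \<Lambda> (\<psi> t) (Obs (\<psi> t)) - braket st \<Lambda> (\<phi> t) (Obs (\<phi> t))))
      \<le> integral {0..T} (\<lambda>_. 2 * real n * B * T)"
  proof (rule integral_norm_bound_integral)
    fix t assume "t \<in> {0..T}"
    then have "cmod (braket st \<Lambda> (\<psi> t) (Obs (\<psi> t)) - braket st \<Lambda> (\<phi> t) (Obs (\<phi> t))) \<le> 2 * real n * B * t"
      using bound[of t] by simp
    also have "\<dots> \<le> 2 * real n * B * T"
      using \<open>t \<in> {0..T}\<close> B(1) by (intro mult_left_mono) auto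
    finally show "cmod (braket st \<Lambda> (\<psi> t) (Obs (\<psi> t)) - braket st \<Lambda> (\<phi> t) (Obs (\<phi> t))) \<le> 2 * real n * B * T" .
  qed (use int in \<open>auto intro: integrable_diff\<close>)
  also have "\<dots> = 2 * real n * B * T * T" using T by simp
  also have "integral {0..T} (\<lambda>t. braket st \<Lambda> (\<psi> t) (Obs (\<psi> t)) - braket st \<Lambda> (\<phi> t) (Obs (\<phi> t)))
      = dense_output st \<Lambda> T \<psi>\<^sub>0 (\<lambda>t. hamiltonian st \<Lambda> (h t)) Obs
    - dense_output st \<Lambda> T \<psi>\<^sub>0 (\<lambda>t. hamiltonian st X (h t)) Obs"
    unfolding dense_output_def HX \<psi>_def[symmetric] \<phi>_def[symmetric] using int
    by (simp add: Henstock_Kurzweil_Integration.integral_diff \<psi>_def \<phi>_def)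
  finally show ?thesis .
qed

section \<open>Choice of the exponent and the constants\<close>

theorem theorem1:
  fixes D :: nat and \<kappa> J\<^sub>0 \<alpha> \<eta> :: real
  assumes "D \<ge> 1" and "\<kappa> > 0" and "J\<^sub>0 > 0" and "\<alpha> > real D + 1" and "\<eta> > 0"
  shows "\<exists>C C\<^sub>0 :: real. 0 < C \<and> 0 < C\<^sub>0 \<and>
    (\<forall>(\<Lambda> :: nat set) (d :: nat \<Rightarrow> nat \<Rightarrow> real) (st :: statistics) (n :: nat) (T :: real)
       (h :: real \<Rightarrow> nat \<Rightarrow> nat \<Rightarrow> complex) (q :: nat) (\<psi>\<^sub>0 :: fock_vec).
      finite_lattice D \<kappa> \<Lambda> d \<longrightarrow> n \<ge> 1 \<longrightarrow> T > 0 \<longrightarrow>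
      (\<forall>i\<in>\<Lambda>. \<forall>j\<in>\<Lambda>. (\<lambda>t. h t i j) absolutely_integrable_on {0..T}) \<longrightarrow>
      (\<forall>t\<in>{0..T}. \<forall>i\<in>\<Lambda>. \<forall>j\<in>\<Lambda>. h t j i = cnj (h t i j)) \<longrightarrow>
      (\<forall>t\<in>{0..T}. \<forall>i\<in>\<Lambda>. \<forall>j\<in>\<Lambda>. i \<noteq> j \<longrightarrow> cmod (h t i j) \<le> J\<^sub>0 * d i j powr (- \<alpha>)) \<longrightarrow>
      q \<in> \<Lambda> \<longrightarrow> \<psi>\<^sub>0 \<in> fock_le st \<Lambda> n \<longrightarrow> braket st \<Lambda> \<psi>\<^sub>0 \<psi>\<^sub>0 = 1 \<longrightarrow>
      (\<forall>R > 0. T < C\<^sub>0 / real n * R powr (min 1 ((\<alpha> - real D - \<eta>) / 3)) \<longrightarrow>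
        (let X = {i \<in> \<Lambda>. d i q \<le> R};
             Obs = (\<lambda>\<psi>. create st q (annihilate st q \<psi>));
             J = dense_output st \<Lambda> T \<psi>\<^sub>0 (\<lambda>t. hamiltonian st \<Lambda> (h t)) Obs;
             J\<^sub>R = dense_output st \<Lambda> T \<psi>\<^sub>0 (\<lambda>t. hamiltonian st X (h t)) Obs
         in cmod (J - J\<^sub>R) \<le> C * (real n)\<^sup>2 *
              (T\<^sup>2 / R powr (\<alpha> - real D)
               + 4 / 5 * (T powr (5 / 2) / R powr ((\<alpha> - real D - \<eta>) / 2))))))"
proof -
  define \<beta> where "\<beta> = \<alpha> - real D"
  have \<beta>: "1 < \<beta>" using assms by (simp add: \<beta>_def)
  \<comment> \<open>\<open>p\<close> must exceed 1 for the transport bound, stay below \<beta> for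
    convergent lattice sums and reach \<beta> - \<eta> for the claimed decay. The midpoint of 1 and
    \<beta> takes over when \<eta> is large.\<close>
  define p where "p = max ((1 + \<beta>) / 2) (\<beta> - \<eta>)"
  have p: "1 < p" "p < \<beta>" "\<beta> - \<eta> \<le> p"
    using \<beta> assms(5) by (auto simp: p_def max_def)
  have exponent: "real D < \<alpha>" "real D < \<alpha> - 1" "real D < \<alpha> - p"
    using assms(4) p(2) by (auto simp: \<beta>_def)
  obtain K0 where K0: "K0 > 0"
    "\<And>\<Lambda> d i. finite_lattice D \<kappa> \<Lambda> d \<Longrightarrow> i \<in> \<Lambda> \<Longrightarrow> (\<Sum>j\<in>\<Lambda> - {i}. d i j powr (- \<alpha>)) \<le> K0"
    by (rule finite_lattice_sum_bound[OF assms(1,2) exponent(1)]) (rule that)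
  obtain K1 where K1: "K1 > 0"
    "\<And>\<Lambda> d i. finite_lattice D \<kappa> \<Lambda> d \<Longrightarrow> i \<in> \<Lambda> \<Longrightarrow> (\<Sum>j\<in>\<Lambda> - {i}. d i j powr (- (\<alpha> - 1))) \<le> K1"
    by (rule finite_lattice_sum_bound[OF assms(1,2) exponent(2)]) (rule that)
  obtain Kp where Kp: "Kp > 0"
    "\<And>\<Lambda> d i. finite_lattice D \<kappa> \<Lambda> d \<Longrightarrow> i \<in> \<Lambda> \<Longrightarrow> (\<Sum>j\<in>\<Lambda> - {i}. d i j powr (- (\<alpha> - p))) \<le> Kp"
    by (rule finite_lattice_sum_bound[OF assms(1,2) exponent(3)]) (rule that)
  \<comment> \<open>The smallest speed that \<open>transport\<close> admits.\<close>
  define v where "v = 2 powr p * J\<^sub>0 * K1"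
  have v: "v > 0" using assms(3) K1(1) by (simp add: v_def)
  \<comment> \<open>The tail constant at radius R/2; the last factor converts R/2 into R.\<close>
  define c\<^sub>1 where "c\<^sub>1 = \<kappa> * 2 ^ D / (1 - 2 powr (- \<beta>)) * 2 powr \<beta>"
  have c\<^sub>1: "c\<^sub>1 > 0"
    using assms(2) \<beta> powr_less_one[of 2 "- \<beta>"] by (simp add: c\<^sub>1_def)
  \<comment> \<open>A square root, because the far probability bounds a squared norm; 4^p stems from
    the distance R/4 in Markov's inequality.\<close>
  define c\<^sub>2 where "c\<^sub>2 = sqrt (2 powr p * J\<^sub>0 * Kp * 4 powr p)"
  have c\<^sub>2: "c\<^sub>2 > 0" "c\<^sub>2\<^sup>2 = 2 powr p * J\<^sub>0 * Kp * 4 powr p"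
    using assms(3) Kp(1) by (auto simp: c\<^sub>2_def)
  \<comment> \<open>The three parts serve small radii, long hops and the far amplitude. The 5 makes
    up for the factor 4/5 in the claim: 4 is 5 times 4/5.\<close>
  define C where "C = 2 * J\<^sub>0 * K0 + 4 * J\<^sub>0 * c\<^sub>1 + 5 * J\<^sub>0 * K0 * c\<^sub>2"
  have C_pos: "0 < C"
    using assms(3) K0(1) c\<^sub>1 c\<^sub>2(1) by (simp add: C_def add_pos_pos)
  have "cmod (dense_output st \<Lambda> T \<psi>\<^sub>0 (\<lambda>t. hamiltonian st \<Lambda> (h t)) (\<lambda>\<psi>. create st q (annihilate st q \<psi>))
      - dense_output st \<Lambda> T \<psi>\<^sub>0 (\<lambda>t. hamiltonian st {i \<in> \<Lambda>. d i q \<le> R} (h t)) (\<lambda>\<psi>. create st q (annihilate st q \<psi>)))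
      \<le> C * (real n)\<^sup>2 * (T\<^sup>2 / R powr \<beta> + 4 / 5 * (T powr (5 / 2) / R powr ((\<beta> - \<eta>) / 2)))"
    (is "?lhs \<le> _")
    if lat: "finite_lattice D \<kappa> \<Lambda> d" and n: "n \<ge> 1" and T: "T > 0"
      and h: "\<forall>i\<in>\<Lambda>. \<forall>j\<in>\<Lambda>. (\<lambda>t. h t i j) absolutely_integrable_on {0..T}"
        "\<forall>t\<in>{0..T}. \<forall>i\<in>\<Lambda>. \<forall>j\<in>\<Lambda>. h t j i = cnj (h t i j)"
        "\<forall>t\<in>{0..T}. \<forall>i\<in>\<Lambda>. \<forall>j\<in>\<Lambda>. i \<noteq> j \<longrightarrow> cmod (h t i j) \<le> J\<^sub>0 * d i j powr (- \<alpha>)"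
      and q: "q \<in> \<Lambda>" and \<psi>\<^sub>0: "\<psi>\<^sub>0 \<in> fock_le st \<Lambda> n" "braket st \<Lambda> \<psi>\<^sub>0 \<psi>\<^sub>0 = 1"
      and R: "R > 0" and TR: "T < (1 / (4 * v)) / real n * R powr (min 1 ((\<beta> - \<eta>) / 3))"
    for \<Lambda> d st n T h q \<psi>\<^sub>0 R
  proof -
    have hop: "hopping \<Lambda> d J\<^sub>0"
      using lat assms(3) by (simp add: hopping_def finite_lattice_def)
    define A where "A = T\<^sup>2 / R powr \<beta>"
    define A' where "A' = T powr (5 / 2) / R powr ((\<beta> - \<eta>) / 2)"
    have A: "0 \<le> A" "0 \<le> A'" by (auto simp: A_def A'_def)
    note main = dense_output_truncation[OF hop less_imp_le[OF T] q R h \<psi>\<^sub>0 K0(2)[OF lat] less_imp_le[OF K0(1)]]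
    have n2: "real n \<le> (real n)\<^sup>2" using n by (simp add: power2_eq_square)
    have T2: "T * T = T\<^sup>2" by (simp add: power2_eq_square)
    have "?lhs \<le> real n * (C * (A + 4 / 5 * A'))"
    \<comment> \<open>Below radius 1 the power R^\<beta> is at most 1 and the uniform defect bound
      suffices. From 1 on, powers of \<open>R\<close> grow with the exponent, which the comparisons
      of exponents rely on.\<close>
    proof (cases "R < 1")
      case True
      have "?lhs \<le> 2 * real n * (J\<^sub>0 * K0) * T * T"
        by (rule main) (use assms(3) K0(1) in auto)
      also have "\<dots> = real n * (2 * J\<^sub>0 * K0 * T\<^sup>2)" by (simp add: T2[symmetric])
      also have "\<dots> \<le> real n * (C * (A + 4 / 5 * A'))"
      proof (intro mult_left_mono mult_mono)
        have "R powr \<beta> \<le> 1" using True R \<beta> by (intro powr_le1) auto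
        then have "T\<^sup>2 \<le> A" using R T by (simp add: A_def pos_le_divide_eq mult_left_le)
        then show "T\<^sup>2 \<le> A + 4 / 5 * A'" using A(2) by simp
        show "2 * J\<^sub>0 * K0 \<le> C" using assms(3) K0(1) c\<^sub>1 c\<^sub>2(1) by (simp add: C_def)
      qed (use C_pos in auto)
      finally show ?thesis .
    next
      case False
      define \<tau> where "\<tau> = c\<^sub>1 * R powr (- \<beta>)"
      define E where "E = c\<^sub>2 * sqrt T * R powr (- (p / 2))"
      \<comment> \<open>Twice the sum of the two contributions, so that the square covers both
        squares with their factor 2.\<close>
      define B where "B = 2 * (J\<^sub>0 * \<tau>) + 2 * (J\<^sub>0 * K0 * E)"
      have nn: "0 \<le> J\<^sub>0 * \<tau>" "0 \<le> J\<^sub>0 * K0 * E"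
        using assms(3) K0(1) c\<^sub>1 c\<^sub>2(1) T by (auto simp: \<tau>_def E_def)
      \<comment> \<open>The constant 1/(4 v) in the time condition is chosen so that the front of
        the weight travels at most R/4.\<close>
      have "T \<le> 1 / (4 * v) * R"
      proof -
        have "T \<le> (1 / (4 * v)) / real n * R powr (min 1 ((\<beta> - \<eta>) / 3))" using TR by simp
        also have "\<dots> \<le> (1 / (4 * v)) * R powr 1"
        proof (intro mult_mono)
          show "1 / (4 * v) / real n \<le> 1 / (4 * v)" using n v by (simp add: divide_le_eq mult_le_cancel_left1)
          show "R powr min 1 ((\<beta> - \<eta>) / 3) \<le> R powr 1" using False by (intro powr_mono) auto
        qed (use v in auto)
        finally show ?thesis using R by simp
      qed
      then have vT: "v * T \<le> R / 4" using v by (simp add: field_simps)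
      have tail: "(\<Sum>j | j \<in> \<Lambda> \<and> j \<noteq> i \<and> R / 2 < d i j. d i j powr (- \<alpha>)) \<le> \<tau>" if "i \<in> \<Lambda>" for i
      proof -
        have "(\<Sum>j | j \<in> \<Lambda> \<and> j \<noteq> i \<and> R / 2 < d i j. d i j powr (- \<alpha>))
            \<le> \<kappa> * 2 ^ D / (1 - 2 powr (real D - \<alpha>)) * (R / 2) powr (real D - \<alpha>)"
          using R assms(4) by (intro finite_lattice_tail[OF lat that]) auto
        also have "real D - \<alpha> = - \<beta>" by (simp add: \<beta>_def)
        also have "(R / 2) powr (- \<beta>) = 2 powr \<beta> * R powr (- \<beta>)"
          using R by (simp add: powr_divide powr_minus_divide)
        finally show ?thesis by (simp add: \<tau>_def c\<^sub>1_def mult_ac)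
      qed
      have E2: "2 powr p * J\<^sub>0 * Kp * T * (R / 4) powr (- p) = E\<^sup>2"
      proof -
        have "(R / 4) powr (- p) = 4 powr p * R powr (- p)"
          using R by (simp add: powr_divide powr_minus_divide)
        moreover have "(R powr (- (p / 2)))\<^sup>2 = R powr (- p)"
          using R by (simp add: power2_eq_square flip: powr_add)
        ultimately show ?thesis using T by (simp add: E_def power_mult_distrib c\<^sub>2(2))
      qed
      have B2: "2 * (J\<^sub>0 * \<tau>)\<^sup>2 + 2 * (J\<^sub>0 * K0)\<^sup>2 * E\<^sup>2 \<le> B\<^sup>2"
      proof -
        have "2 * x\<^sup>2 + 2 * y\<^sup>2 \<le> (2 * x + 2 * y)\<^sup>2" if "0 \<le> x" "0 \<le> y" for x y :: real
          using that by (simp add: power2_eq_square algebra_simps)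
        from this[OF nn] show ?thesis by (simp add: B_def power_mult_distrib)
      qed
      have "?lhs \<le> 2 * real n * B * T * T"
      proof (rule main)
        show "0 \<le> B" using nn by (simp add: B_def)
        show "J\<^sub>0 * K0 \<le> B \<or> (p > 1 \<and> v * T \<le> R / 4 \<and> 0 \<le> v \<and> 2 powr p * J\<^sub>0 * K1 \<le> v \<and>
          (\<forall>i\<in>\<Lambda>. (\<Sum>j\<in>\<Lambda> - {i}. d i j powr (- (\<alpha> - 1))) \<le> K1) \<and>
          (\<forall>i\<in>\<Lambda>. (\<Sum>j\<in>\<Lambda> - {i}. d i j powr (- (\<alpha> - p))) \<le> Kp) \<and> 0 \<le> Kp \<and>
          (\<forall>i\<in>\<Lambda>. (\<Sum>j | j \<in> \<Lambda> \<and> j \<noteq> i \<and> R / 2 < d i j. d i j powr (- \<alpha>)) \<le> \<tau>) \<and>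
          2 * (J\<^sub>0 * \<tau>)\<^sup>2 + 2 * (J\<^sub>0 * K0)\<^sup>2 * (2 powr p * J\<^sub>0 * Kp * T * (R / 4) powr (- p)) \<le> B\<^sup>2)"
          unfolding E2 using p(1) vT v v_def K1(2)[OF lat] Kp(2)[OF lat] Kp(1) tail B2 by auto
      qed
      also have "\<dots> = real n * (4 * J\<^sub>0 * c\<^sub>1 * A + 4 * J\<^sub>0 * K0 * c\<^sub>2 * (T\<^sup>2 * sqrt T * R powr (- (p / 2))))"
        by (simp add: B_def \<tau>_def E_def A_def powr_minus_divide power2_eq_square algebra_simps)
      also have "\<dots> \<le> real n * (C * A + C * (4 / 5 * A'))"
      proof (intro mult_left_mono add_mono)
        show "4 * J\<^sub>0 * c\<^sub>1 * A \<le> C * A"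
          using assms(3) K0(1) c\<^sub>1 c\<^sub>2(1) A by (intro mult_right_mono) (auto simp: C_def)
        \<comment> \<open>Two powers of \<open>T\<close> come from drift and output, the half power
          from the square root of the far probability.\<close>
        have "T\<^sup>2 * sqrt T = T powr (5 / 2)"
          using T by (simp add: powr_half_sqrt[symmetric] flip: powr_numeral powr_add)
        moreover have "R powr (- (p / 2)) \<le> R powr (- ((\<beta> - \<eta>) / 2))"
          using False p(3) by (intro powr_mono) auto
        ultimately have "T\<^sup>2 * sqrt T * R powr (- (p / 2)) \<le> T powr (5 / 2) * R powr (- ((\<beta> - \<eta>) / 2))"
          by (simp only: mult_left_mono powr_ge_zero)
        also have "\<dots> = A'" unfolding A'_def by (simp only: powr_minus divide_inverse)
        finally have "T\<^sup>2 * sqrt T * R powr (- (p / 2)) \<le> A'" .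
        then have "4 * J\<^sub>0 * K0 * c\<^sub>2 * (T\<^sup>2 * sqrt T * R powr (- (p / 2))) \<le> 4 * J\<^sub>0 * K0 * c\<^sub>2 * A'"
          using assms(3) K0(1) c\<^sub>2(1) by (intro mult_left_mono) auto
        also have "\<dots> = (5 * J\<^sub>0 * K0 * c\<^sub>2) * (4 / 5 * A')" by simp
        also have "\<dots> \<le> C * (4 / 5 * A')"
          using assms(3) K0(1) c\<^sub>1 A by (intro mult_right_mono) (auto simp: C_def)
        finally show "4 * J\<^sub>0 * K0 * c\<^sub>2 * (T\<^sup>2 * sqrt T * R powr (- (p / 2))) \<le> C * (4 / 5 * A')" .
      qed simp
      also have "\<dots> = real n * (C * (A + 4 / 5 * A'))" by (simp add: distrib_left)
      finally show ?thesis .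
    qed
    also have "\<dots> \<le> (real n)\<^sup>2 * (C * (A + 4 / 5 * A'))"
      using n2 C_pos A by (intro mult_right_mono) auto
    finally show ?thesis by (simp add: A_def A'_def mult_ac)
  qed
  note bound = this[unfolded \<beta>_def]
  show ?thesis
    unfolding Let_def
  proof (intro exI conjI allI impI)
    show "0 < C" by (rule C_pos)
    show "0 < 1 / (4 * v)" using v by simp
  qed (rule bound)
qed

end
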